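(* There exist $\omega_0,\rho_0\in C_0^\infty$ on $[0,1]$ for which the solution $(\omega,\rho)$ of the system $$\begin{cases}\partial_t\rho(t,x)+u(t,x)\,\partial_x\rho(t,x)=0,\\ \partial_t\omega(t,x)+u(t,x)\,\partial_x\omega(t,x)=\partial_x\rho(t,x),\\ u(t,x)=-x\,\Omega(t,x),\quad \Omega(t,x)=\int_x^1\frac{\omega(t,y)}{y}\,dy,\\ \omega(0,x)=\omega_0(x),\quad \rho(0,x)=\rho_0(x),\end{cases}$$ with $x\in[0,1]$ and Dirichlet boundary conditions $\omega=\rho=0$ at $x=0,1$, blows up in finite time. In particular, there is $T^*<\infty$ such that the solution exists on $[0,T^* )$ and $$\int_0^{T^*}\|\omega(t)\|_{L^\infty}\,dt=\infty,\qquad\text{i.e. } \int_0^{t}\|\omega(s)\|_{L^\infty}\,ds\to\infty\ \text{ as } t\uparrow T^*.$$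
   Context: $C_0^\infty$ denotes smooth functions compactly supported in $(0,1)$. $L^\infty=L^\infty((0,1))$. $H_0^m=H_0^m((0,1))$ is the closure of $C_0^\infty((0,1))$ in the Sobolev space $H^m((0,1))$. For initial data $\omega_0,\rho_0\in C_0^\infty$, "the solution" is the unique classical solution $(\omega,\rho)$ on its maximal time interval $[0,T_{\max})$, belonging to $C([0,T_{\max});H_0^m\times H_0^{m+1})$ for all integers $m\ge 2$ (such a local-in-time solution exists and is unique). Finite time blow up means that $T_{\max}<\infty$. *)

theory Defs
  imports "HOL-Probability.Essential_Supremum"
begin

text \<open>
  Functions on the unit interval are represented by total functions of type
  \<^typ>\<open>real \<Rightarrow> real\<close>. Elements of \<open>C_0^\<infinity>\<close> are extended by zero to the real line; for all other
  functions only the values on the interval matter.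
\<close>

definition C0_infty :: "(real \<Rightarrow> real) set" where
  "C0_infty = {\<phi>. (\<forall>k x. ((deriv ^^ k) \<phi>) differentiable (at x)) \<and>
                  compact (closure {x. \<phi> x \<noteq> 0}) \<and> closure {x. \<phi> x \<noteq> 0} \<subseteq> {0<..<1}}"

abbreviation unit_measure :: "real measure" where
  "unit_measure \<equiv> lebesgue_on {0<..<1}"

definition L2 :: "(real \<Rightarrow> real) set" where
  "L2 = {f. f \<in> borel_measurable unit_measure \<and> integrable unit_measure (\<lambda>x. (f x)\<^sup>2)}"

definition L2_norm :: "(real \<Rightarrow> real) \<Rightarrow> real" where
  "L2_norm f = sqrt (\<integral>x. (f x)\<^sup>2 \<partial>unit_measure)"

definition Linfty_norm :: "(real \<Rightarrow> real) \<Rightarrow> ennreal" where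
  "Linfty_norm f = esssup unit_measure (\<lambda>x. ennreal \<bar>f x\<bar>)"

definition locally_integrable :: "(real \<Rightarrow> real) \<Rightarrow> bool" where
  "locally_integrable f \<longleftrightarrow> (\<forall>K. compact K \<and> K \<subseteq> {0<..<1} \<longrightarrow> set_integrable lebesgue K f)"

definition has_weak_deriv :: "nat \<Rightarrow> (real \<Rightarrow> real) \<Rightarrow> (real \<Rightarrow> real) \<Rightarrow> bool" where
  "has_weak_deriv k f g \<longleftrightarrow> locally_integrable f \<and> locally_integrable g \<and>
     (\<forall>\<phi>\<in>C0_infty. (\<integral>x. f x * (deriv ^^ k) \<phi> x \<partial>unit_measure)
                   = (-1) ^ k * (\<integral>x. g x * \<phi> x \<partial>unit_measure))"

text \<open>Weak derivatives are unique up to null sets, so the choice does not affect the norms below.\<close>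

definition weak_deriv :: "nat \<Rightarrow> (real \<Rightarrow> real) \<Rightarrow> real \<Rightarrow> real" where
  "weak_deriv k f = (SOME g. has_weak_deriv k f g)"

definition Sobolev :: "nat \<Rightarrow> (real \<Rightarrow> real) set" where
  "Sobolev m = {f. f \<in> L2 \<and> (\<forall>k\<le>m. \<exists>g\<in>L2. has_weak_deriv k f g)}"

text \<open>Only meaningful for members of \<^term>\<open>Sobolev m\<close>.\<close>

definition Sobolev_norm :: "nat \<Rightarrow> (real \<Rightarrow> real) \<Rightarrow> real" where
  "Sobolev_norm m f = sqrt (\<Sum>k\<le>m. (L2_norm (weak_deriv k f))\<^sup>2)"

definition Sobolev0 :: "nat \<Rightarrow> (real \<Rightarrow> real) set" where
  "Sobolev0 m = {f \<in> Sobolev m. \<forall>\<epsilon>>0. \<exists>\<phi>\<in>C0_infty. Sobolev_norm m (\<lambda>x. f x - \<phi> x) < \<epsilon>}"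

definition time_interval :: "ereal \<Rightarrow> real set" where
  "time_interval T = {t. 0 \<le> t \<and> ereal t < T}"

text \<open>The space \<open>C([0,T); H_0^m)\<close>.\<close>

definition continuous_Sobolev0 :: "ereal \<Rightarrow> nat \<Rightarrow> (real \<Rightarrow> real \<Rightarrow> real) \<Rightarrow> bool" where
  "continuous_Sobolev0 T m f \<longleftrightarrow>
     (\<forall>t\<in>time_interval T. f t \<in> Sobolev0 m) \<and>
     (\<forall>t\<in>time_interval T.
        ((\<lambda>s. Sobolev_norm m (\<lambda>x. f s x - f t x)) \<longlongrightarrow> 0) (at t within time_interval T))"

text \<open>\<open>f\<close> is of class \<open>C^1\<close> on \<open>[0,T) \<times> [0,1]\<close>, one-sidedly at the boundary, with partial
  derivatives \<open>ft\<close> and \<open>fx\<close>.\<close>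

definition C1_with_partials ::
  "ereal \<Rightarrow> (real \<Rightarrow> real \<Rightarrow> real) \<Rightarrow> (real \<Rightarrow> real \<Rightarrow> real) \<Rightarrow> (real \<Rightarrow> real \<Rightarrow> real) \<Rightarrow> bool" where
  "C1_with_partials T f ft fx \<longleftrightarrow>
     continuous_on (time_interval T \<times> {0..1}) (\<lambda>(t, x). ft t x) \<and>
     continuous_on (time_interval T \<times> {0..1}) (\<lambda>(t, x). fx t x) \<and>
     (\<forall>t\<in>time_interval T. \<forall>x\<in>{0..1}.
        ((\<lambda>s. f s x) has_real_derivative ft t x) (at t within time_interval T) \<and>
        ((\<lambda>y. f t y) has_real_derivative fx t x) (at x within {0..1}))"

definition Omega :: "(real \<Rightarrow> real \<Rightarrow> real) \<Rightarrow> real \<Rightarrow> real \<Rightarrow> real" where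
  "Omega \<omega> t x = (LINT y:{x..1}|lebesgue. \<omega> t y / y)"

definition velocity :: "(real \<Rightarrow> real \<Rightarrow> real) \<Rightarrow> real \<Rightarrow> real \<Rightarrow> real" where
  "velocity \<omega> t x = - x * Omega \<omega> t x"

definition classical_solution ::
  "ereal \<Rightarrow> (real \<Rightarrow> real) \<Rightarrow> (real \<Rightarrow> real) \<Rightarrow>
   (real \<Rightarrow> real \<Rightarrow> real) \<Rightarrow> (real \<Rightarrow> real \<Rightarrow> real) \<Rightarrow> bool" where
  "classical_solution T \<omega>0 \<rho>0 \<omega> \<rho> \<longleftrightarrow>
     0 < T \<and>
     (\<exists>\<omega>t \<omega>x \<rho>t \<rho>x.
        C1_with_partials T \<omega> \<omega>t \<omega>x \<and> C1_with_partials T \<rho> \<rho>t \<rho>x \<and>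
        (\<forall>t\<in>time_interval T. \<forall>x\<in>{0..1}.
           \<rho>t t x + velocity \<omega> t x * \<rho>x t x = 0 \<and>
           \<omega>t t x + velocity \<omega> t x * \<omega>x t x = \<rho>x t x)) \<and>
     (\<forall>t\<in>time_interval T. \<omega> t 0 = 0 \<and> \<omega> t 1 = 0 \<and> \<rho> t 0 = 0 \<and> \<rho> t 1 = 0) \<and>
     (\<forall>x\<in>{0..1}. \<omega> 0 x = \<omega>0 x \<and> \<rho> 0 x = \<rho>0 x) \<and>
     (\<forall>m\<ge>2. continuous_Sobolev0 T m \<omega> \<and> continuous_Sobolev0 T (m + 1) \<rho>)"

text \<open>\<open>(\<omega>, \<rho>)\<close> on \<open>[0,T)\<close> is the unique solution on its maximal time interval: every solution with
  the same data is a restriction of it.\<close>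

definition maximal_solution ::
  "ereal \<Rightarrow> (real \<Rightarrow> real) \<Rightarrow> (real \<Rightarrow> real) \<Rightarrow>
   (real \<Rightarrow> real \<Rightarrow> real) \<Rightarrow> (real \<Rightarrow> real \<Rightarrow> real) \<Rightarrow> bool" where
  "maximal_solution T \<omega>0 \<rho>0 \<omega> \<rho> \<longleftrightarrow>
     classical_solution T \<omega>0 \<rho>0 \<omega> \<rho> \<and>
     (\<forall>T' \<omega>' \<rho>'. classical_solution T' \<omega>0 \<rho>0 \<omega>' \<rho>' \<longrightarrow>
        T' \<le> T \<and> (\<forall>t\<in>time_interval T'. \<forall>x\<in>{0..1}. \<omega>' t x = \<omega> t x \<and> \<rho>' t x = \<rho> t x))"

end

theory Submission
  imports Defs "HOL-Computational_Algebra.Polynomial"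
begin

text \<open>
  In the coordinate \<open>z = - ln x\<close> the velocity becomes \<open>\<Omega> = \<integral> \<omega>\<close> over \<open>[0, z]\<close>. If \<open>Z(t, a)\<close> is the
  position at time \<open>t\<close> of the particle starting at \<open>a\<close> and \<open>\<partial>\<^sub>a Z = e\<^sup>h\<close>, then \<open>\<omega> = \<partial>\<^sub>t h\<close> along
  trajectories, and for \<open>\<omega>0 = 0\<close>, \<open>\<rho>0(x) = r(- ln x)\<close>, \<open>g = - r'\<close> the system is equivalent to the
  integro-differential equation \<open>h'' = g e\<^sup>Z e\<^sup>-\<^sup>h\<close> with zero initial data. It is of Volterra type with
  locally Lipschitz nonlinearity, its solution is smooth in \<open>a\<close> and continues as long as \<open>h\<close>, hence
  the time integral of the sup norm of \<open>\<omega>\<close>, stays bounded. A second solution of the Eulerian system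
  yields a second solution of this equation, so solutions are unique.

  Blow-up: \<open>Z'' = \<integral> (g e\<^sup>Z + \<omega>\<^sup>2 e\<^sup>h)\<close> over \<open>[0, a]\<close>. If \<open>r\<close> is a large negative bump, \<open>g\<close> is
  nonnegative to the left of its minimum, so \<open>Z\<close> at a label is driven by \<open>e\<^sup>Z\<close> at the smaller labels.
  Iterating this along labels and times that converge geometrically forces \<open>Z = \<infinity>\<close> by time 2.
\<close>

section \<open>Volterra equations\<close>

text \<open>In Eulerian form the vorticity equation loses a derivative, since it contains the slope
  of \<open>\<rho>\<close>. Along trajectories \<open>\<rho>\<close> is constant and its slope is g
  e^(Z-h), which involves no derivative of the unknown; the only nonlocal term left is Z, an
  integral of e^h over smaller labels.

  The exponentials are not globally Lipschitz, so each level N has its own equation, with a cutoff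
  that is inactive while |h| \<le> N. It is solved for all real times and labels at once, so that
  existence and smoothness never meet a boundary of the domain. The actual solution is glued from
  the levels, and its lifespan is the supremum of the times up to which some level is uncut.

  Two demands of the statement shape the rest. Sobolev norms are taken of an arbitrarily chosen weak
  derivative, so every weak derivative of a test function has to be identified with the classical
  one almost everywhere. Maximality concerns every classical solution, so uniqueness is proved in
  the Eulerian class and combined with the divergence of the norm integral to bound every
  lifespan.\<close>

definition cts2 :: "(real \<Rightarrow> real \<Rightarrow> real) \<Rightarrow> bool" where
  "cts2 f \<longleftrightarrow> continuous_on UNIV (\<lambda>p. f (fst p) (snd p))"

lemma cts2_compose:
  assumes "cts2 f" "continuous_on S u" "continuous_on S v"
  shows "continuous_on S (\<lambda>x. f (u x) (v x))"
proof -
  have "continuous_on S ((\<lambda>p. f (fst p) (snd p)) \<circ> (\<lambda>x. (u x, v x)))"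
    using assms unfolding cts2_def
    by (intro continuous_on_compose continuous_on_Pair) (auto intro: continuous_on_subset)
  then show ?thesis by (simp add: o_def)
qed

text \<open>The oriented integral from \<open>0\<close> to \<open>x\<close>, for either sign of \<open>x\<close>. Rescaling to the fixed
  interval \<open>[0, 1]\<close> makes the library results on parameter-dependent integrals applicable.\<close>

definition prim :: "(real \<Rightarrow> real) \<Rightarrow> real \<Rightarrow> real" where
  "prim f x = x * integral {0..1} (\<lambda>\<theta>. f (\<theta> * x))"

lemma prim_0 [simp]: "prim f 0 = 0"
  by (simp add: prim_def)

lemma prim_zero [simp]: "prim (\<lambda>_. 0) x = 0"
  by (simp add: prim_def)

lemma prim_cong: "(\<And>s. s \<in> closed_segment 0 x \<Longrightarrow> f s = g s) \<Longrightarrow> prim f x = prim g x"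
  unfolding prim_def
  by (intro arg_cong2[where f = "(*)"] refl integral_cong) (auto simp: closed_segment_def)

text \<open>Derivatives are required only within the segment, because solutions on a closed time
  interval have one-sided derivatives at its ends.\<close>

lemma prim_FTC_segment:
  assumes "\<And>s. s \<in> closed_segment 0 x \<Longrightarrow> (G has_real_derivative f s) (at s within closed_segment 0 x)"
  shows "prim f x = G x - G 0"
proof -
  have "((\<lambda>\<theta>. G (\<theta> * x)) has_real_derivative f (\<theta> * x) * x) (at \<theta> within {0..1})"
    if "\<theta> \<in> {0..1}" for \<theta>
  proof -
    have "\<theta> * x \<in> closed_segment 0 x" using that by (auto simp: closed_segment_def)
    from assms[OF this]
    have "(G has_real_derivative f (\<theta> * x)) (at (\<theta> * x) within (\<lambda>\<theta>. \<theta> * x) ` {0..1})"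
      by (rule has_field_derivative_subset) (auto simp: closed_segment_def)
    moreover have "((\<lambda>\<theta>. \<theta> * x) has_real_derivative x) (at \<theta> within {0..1})"
      by (rule DERIV_cmult_right[OF DERIV_ident, of x, simplified])
    ultimately have "(G \<circ> (\<lambda>\<theta>. \<theta> * x) has_real_derivative f (\<theta> * x) * x) (at \<theta> within {0..1})"
      by (rule DERIV_image_chain)
    then show ?thesis by (simp only: o_def)
  qed
  then have "((\<lambda>\<theta>. f (\<theta> * x) * x) has_integral (G (1 * x) - G (0 * x))) {0..1}"
    by (intro fundamental_theorem_of_calculus)
       (auto simp: has_real_derivative_iff_has_vector_derivative[symmetric])
  then have "integral {0..1} (\<lambda>\<theta>. f (\<theta> * x)) * x = G x - G 0"
    by (simp only: integral_mult_left[symmetric] integral_unique mult_1 mult_zero_left)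
  then show ?thesis by (simp only: prim_def mult.commute)
qed

lemma prim_FTC: "(\<And>s. (G has_real_derivative f s) (at s)) \<Longrightarrow> prim f x = G x - G 0"
  by (rule prim_FTC_segment) (blast intro: has_field_derivative_at_within)

lemma prim_deriv:
  assumes "continuous_on UNIV f"
  shows "(prim f has_real_derivative f x) (at x)"
proof -
  \<comment> \<open>Integrating from \<open>-c\<close> instead of 0 makes \<open>x\<close> an
    interior point for either sign of \<open>x\<close>; the two primitives differ by the constant
    \<open>G 0\<close>.\<close>
  define c where "c = \<bar>x\<bar> + 1"
  define G where "G = (\<lambda>y. integral {-c..y} f)"
  have G: "(G has_real_derivative f y) (at y within {-c..c})" if "y \<in> {-c..c}" for y
    unfolding G_def by (rule integral_has_real_derivative[OF continuous_on_subset[OF assms] that]) simp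
  have eq: "prim f y = G y - G 0" if "y \<in> {-c<..<c}" for y
  proof (rule prim_FTC_segment)
    fix s assume "s \<in> closed_segment 0 y"
    then have "s \<in> {-c..c}" "closed_segment 0 y \<subseteq> {-c..c}" using that
      by (auto simp: closed_segment_eq_real_ivl split: if_splits)
    then show "(G has_real_derivative f s) (at s within closed_segment 0 y)"
      by (rule has_field_derivative_subset[OF G])
  qed
  have x: "x \<in> {-c<..<c}" unfolding c_def by (simp, arith)
  have "(G has_real_derivative f x) (at x within {-c<..<c})"
    by (rule has_field_derivative_subset[OF G]) (use x in auto)
  then have "(G has_real_derivative f x) (at x)"
    unfolding at_within_open[OF x open_greaterThanLessThan] .
  from DERIV_diff[OF this DERIV_const[of "G 0"]]
  have "((\<lambda>y. G y - G 0) has_real_derivative f x) (at x)" by simp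
  then show ?thesis
  proof (rule has_field_derivative_transform_within_open)
    show "open {-c<..<c}" "x \<in> {-c<..<c}" using x by simp_all
  qed (rule eq[symmetric])
qed

lemma prim_deriv_comp [derivative_intros]:
  assumes "continuous_on UNIV f" "(g has_real_derivative g') (at x within S)"
  shows "((\<lambda>x. prim f (g x)) has_real_derivative f (g x) * g') (at x within S)"
  by (rule DERIV_chain2[where f = "prim f" and g = g, OF prim_deriv[OF assms(1)] assms(2)])

lemma prim_reflect: "prim f (- x) = prim (\<lambda>s. - f (- s)) x"
  by (simp add: prim_def)

lemma prim_cmult: "prim (\<lambda>s. c * f s) x = c * prim f x"
  by (simp add: prim_def)

lemma prim_diff:
  assumes "continuous_on UNIV f" "continuous_on UNIV g"
  shows "prim (\<lambda>s. f s - g s) x = prim f x - prim g x"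
proof -
  have "prim (\<lambda>s. f s - g s) x = (prim f x - prim g x) - (prim f 0 - prim g 0)"
    by (rule prim_FTC) (intro DERIV_diff prim_deriv assms)
  then show ?thesis by simp
qed

lemma prim_mono:
  assumes "continuous_on UNIV f" "continuous_on UNIV g" "0 \<le> x"
    "\<And>s. 0 \<le> s \<Longrightarrow> s \<le> x \<Longrightarrow> f s \<le> g s"
  shows "prim f x \<le> prim g x"
proof -
  have c: "continuous_on {0..1} (\<lambda>\<theta>. u (\<theta> * x))" if "continuous_on UNIV u" for u :: "real \<Rightarrow> real"
    by (rule continuous_on_compose2[OF that]) (intro continuous_intros, simp)
  have "integral {0..1} (\<lambda>\<theta>. f (\<theta> * x)) \<le> integral {0..1} (\<lambda>\<theta>. g (\<theta> * x))"
  proof (intro integral_le integrable_continuous_real c assms(1,2))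
    fix \<theta> :: real assume "\<theta> \<in> {0..1}"
    then show "f (\<theta> * x) \<le> g (\<theta> * x)"
      using assms(3) by (intro assms(4)) (auto simp: mult_left_le_one_le)
  qed
  then show ?thesis unfolding prim_def using assms(3) by (rule mult_left_mono)
qed

lemma prim_abs_le:
  assumes "continuous_on UNIV f" "\<And>s. s \<in> closed_segment 0 x \<Longrightarrow> \<bar>f s\<bar> \<le> B"
  shows "\<bar>prim f x\<bar> \<le> \<bar>x\<bar> * B"
proof -
  have "norm (integral {0..1} (\<lambda>\<theta>. f (\<theta> * x))) \<le> B * (1 - 0)"
  proof (rule integral_bound)
    show "continuous_on {0..1} (\<lambda>\<theta>. f (\<theta> * x))"
      by (intro continuous_intros continuous_on_compose2[OF assms(1)]) simp
    fix \<theta> :: real assume "\<theta> \<in> {0..1}"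
    then show "norm (f (\<theta> * x)) \<le> B"
      using assms(2)[of "\<theta> * x"] by (auto simp: closed_segment_def)
  qed simp
  then show ?thesis unfolding prim_def abs_mult
    by (intro mult_left_mono) simp_all
qed

lemma prim_cts2:
  assumes "cts2 f"
  shows "cts2 (\<lambda>t a. prim (f t) a)"
proof -
  have "continuous_on UNIV (\<lambda>p. integral (cbox 0 1) (\<lambda>\<theta>. f (fst p) (\<theta> * snd p)))"
    by (rule integral_continuous_on_param, unfold case_prod_beta')
       (intro continuous_intros cts2_compose[OF assms])
  then show ?thesis
    unfolding cts2_def prim_def cbox_interval by (intro continuous_intros)
qed

lemma cts2_swap: "cts2 f \<Longrightarrow> cts2 (\<lambda>a t. f t a)"
  using cts2_compose[of f UNIV snd fst] unfolding cts2_def[of "\<lambda>a t. f t a"]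
  by (simp add: continuous_on_fst continuous_on_snd)

lemma prim_cts2_time:
  assumes "cts2 f"
  shows "cts2 (\<lambda>t a. prim (\<lambda>s. f s a) t)"
  using cts2_swap[OF prim_cts2[OF cts2_swap[OF assms]]] .

lemma cts2_slice_right: "cts2 f \<Longrightarrow> continuous_on S (f t)"
  using cts2_compose[of f S "\<lambda>_. t" "\<lambda>a. a"] by simp

lemma cts2_slice_left: "cts2 f \<Longrightarrow> continuous_on S (\<lambda>t. f t a)"
  using cts2_compose[of f S "\<lambda>t. t" "\<lambda>_. a"] by simp

lemma prim_param_deriv:
  assumes d: "\<And>t b. ((\<lambda>t. f t b) has_real_derivative f' t b) (at t)"
    and f: "cts2 f" and f': "cts2 f'"
  shows "((\<lambda>t. prim (f t) a) has_real_derivative prim (f' t) a) (at t)"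
proof -
  have "((\<lambda>t. integral (cbox 0 1) (\<lambda>\<theta>. f t (\<theta> * a))) has_real_derivative
          integral (cbox 0 1) (\<lambda>\<theta>. f' t (\<theta> * a))) (at t within UNIV)"
  proof (rule leibniz_rule_field_derivative)
    show "continuous_on (UNIV \<times> cbox 0 1) (\<lambda>(x, \<theta>). f' x (\<theta> * a))"
      unfolding case_prod_beta' by (intro continuous_intros cts2_compose[OF f'])
    show "(\<lambda>\<theta>. f t (\<theta> * a)) integrable_on cbox 0 1" for t
      by (intro integrable_continuous continuous_intros cts2_compose[OF f])
  qed (use d in auto)
  then show ?thesis
    unfolding prim_def cbox_interval by (auto intro!: derivative_eq_intros)
qed

text \<open>The weight \<open>exp (2 |\<integral>m|)\<close> makes the Volterra operator \<open>prim\<close> a contraction by one half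
  on every interval, uniformly in \<open>m\<close>.\<close>

lemma prim_weight_pos:
  assumes F: "continuous_on UNIV F" and m: "continuous_on UNIV m" and t: "0 \<le> t" and C: "0 \<le> C"
    and le: "\<And>s. 0 \<le> s \<Longrightarrow> s \<le> t \<Longrightarrow> \<bar>F s\<bar> \<le> C * m s * exp (2 * prim m s)"
  shows "\<bar>prim F t\<bar> \<le> C / 2 * exp (2 * prim m t)"
proof -
  \<comment> \<open>Both signs of \<open>\<sigma>\<close> together bound the absolute value. The
    right-hand side is chosen so that its time derivative is exactly the assumed bound on
    \<open>F\<close>.\<close>
  have *: "\<sigma> * prim F t \<le> C / 2 * exp (2 * prim m t)" if \<sigma>: "\<bar>\<sigma>\<bar> = 1" for \<sigma>
  proof -
    define \<phi> where "\<phi> = (\<lambda>s. C / 2 * exp (2 * prim m s) - \<sigma> * prim F s)"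
    have "\<phi> 0 \<le> \<phi> t"
    proof (rule DERIV_nonneg_imp_nondecreasing[OF t])
      fix s assume s: "0 \<le> s" "s \<le> t"
      have "(\<phi> has_real_derivative C * m s * exp (2 * prim m s) - \<sigma> * F s) (at s)"
        unfolding \<phi>_def
        by (rule derivative_eq_intros refl prim_deriv F m | simp)+
      moreover have "\<sigma> * F s \<le> \<bar>F s\<bar>" using \<sigma> by (metis abs_ge_self abs_mult mult_1)
      ultimately show "\<exists>y. (\<phi> has_real_derivative y) (at s) \<and> 0 \<le> y"
        using le[OF s] by (intro exI conjI) auto
    qed
    moreover have "0 \<le> \<phi> 0" using C by (simp add: \<phi>_def)
    ultimately show ?thesis by (simp add: \<phi>_def)
  qed
  from *[of 1] *[of "-1"] show ?thesis by auto
qed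

lemma prim_nonneg:
  assumes "continuous_on UNIV f" "0 \<le> x" "\<And>s. 0 \<le> s \<Longrightarrow> s \<le> x \<Longrightarrow> 0 \<le> f s"
  shows "0 \<le> prim f x"
  using prim_mono[of "\<lambda>_. 0" f x] assms by auto

text \<open>Negative times reduce to positive ones by reflection: evenness of \<open>m\<close> makes
  \<open>prim m\<close> odd, so the weight is the same at \<open>t\<close> and at
  \<open>- t\<close>.\<close>

lemma prim_weight:
  assumes F: "continuous_on UNIV F" and m: "continuous_on UNIV m" "\<And>s. 0 \<le> m s" and C: "0 \<le> C"
    and even: "\<And>s. m (- s) = m s"
    and le: "\<And>s. s \<in> closed_segment 0 t \<Longrightarrow> \<bar>F s\<bar> \<le> C * m s * exp (2 * \<bar>prim m s\<bar>)"
  shows "\<bar>prim F t\<bar> \<le> C / 2 * exp (2 * \<bar>prim m t\<bar>)"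
proof -
  have nn: "\<bar>prim m s\<bar> = prim m s" if "0 \<le> s" for s
    using prim_nonneg[OF m(1) that m(2)] by simp
  have odd: "prim m (- s) = - prim m s" for s
    by (simp add: prim_reflect even) (simp add: prim_def)
  show ?thesis
  proof (cases "0 \<le> t")
    case True
    have "\<bar>prim F t\<bar> \<le> C / 2 * exp (2 * prim m t)"
    proof (rule prim_weight_pos[OF F m(1) True C])
      fix s assume "0 \<le> s" "s \<le> t"
      then show "\<bar>F s\<bar> \<le> C * m s * exp (2 * prim m s)"
        using le[of s] nn[of s] True by (simp add: closed_segment_eq_real_ivl)
    qed
    then show ?thesis using nn True by simp
  next
    case False
    then have t: "0 \<le> - t" by simp
    have F': "continuous_on UNIV (\<lambda>s. - F (- s))"
      by (intro continuous_intros continuous_on_compose2[OF F]) auto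
    have "\<bar>prim (\<lambda>s. - F (- s)) (- t)\<bar> \<le> C / 2 * exp (2 * prim m (- t))"
    proof (rule prim_weight_pos[OF F' m(1) t C])
      fix s :: real assume "0 \<le> s" "s \<le> - t"
      then show "\<bar>- F (- s)\<bar> \<le> C * m s * exp (2 * prim m s)"
        using le[of "-s"] nn[of s] False by (simp add: odd even closed_segment_eq_real_ivl)
    qed
    then show ?thesis using nn[OF t] prim_reflect[of F "-t"] by (simp add: odd)
  qed
qed

text \<open>Starting from any bound, \<open>n\<close> applications of \<open>half\<close> leave the
  constant \<open>C / 2 ^ n\<close>, which tends to 0. This plays the role of Gronwall's inequality
  in the uniqueness proofs.\<close>

lemma halving_zero:
  assumes b: "\<And>p. p \<in> D \<Longrightarrow> \<bar>d p :: real\<bar> \<le> C * w p" and C: "0 \<le> C"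
    and half: "\<And>C. 0 \<le> C \<Longrightarrow> (\<And>p. p \<in> D \<Longrightarrow> \<bar>d p\<bar> \<le> C * w p) \<Longrightarrow> (\<And>p. p \<in> D \<Longrightarrow> \<bar>d p\<bar> \<le> C / 2 * w p)"
    and p: "p \<in> D"
  shows "d p = 0"
proof -
  have "\<forall>p\<in>D. \<bar>d p\<bar> \<le> C / 2 ^ n * w p" for n
  proof (induction n)
    case 0
    then show ?case using b by simp
  next
    case (Suc n)
    then show ?case using half[of "C / 2 ^ n"] C by (simp add: field_simps)
  qed
  then have "\<bar>d p\<bar> \<le> C * w p * (1 / 2) ^ n" for n
    using p by (simp add: field_simps)
  moreover have "(\<lambda>n. C * w p * (1 / 2) ^ n) \<longlonglongrightarrow> C * w p * 0"
    by (intro tendsto_intros) auto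
  ultimately have "\<bar>d p\<bar> \<le> 0"
    by (intro LIMSEQ_le_const[of _ 0]) auto
  then show ?thesis by simp
qed

section \<open>Fixed points in an exponentially weighted norm\<close>

definition weight :: "(real \<Rightarrow> real \<Rightarrow> real) \<Rightarrow> real \<Rightarrow> real \<Rightarrow> real" where
  "weight m t a = exp (2 * \<bar>prim (\<lambda>s. m s a) t\<bar>)"

lemma weight_ge_1: "1 \<le> weight m t a"
  by (simp add: weight_def)

lemma weight_cts2: "cts2 m \<Longrightarrow> cts2 (weight m)"
  using prim_cts2_time[of m] unfolding cts2_def weight_def
  by (intro continuous_intros) auto

lemma prim_weight2:
  assumes "cts2 F" "cts2 m" "\<And>s a. 0 \<le> m s a" "0 \<le> C" "\<And>s a. m (- s) a = m s a"
    "\<And>s. \<bar>F s a\<bar> \<le> C * m s a * weight m s a"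
  shows "\<bar>prim (\<lambda>s. F s a) t\<bar> \<le> C / 2 * weight m t a"
  unfolding weight_def
  by (rule prim_weight) (use assms in \<open>auto simp: weight_def intro!: cts2_slice_left\<close>)

text \<open>Picard iteration in the Bielecki norm, the supremum of
  \<open>\<bar>h\<bar> / weight m\<close>: the Lipschitz bound on \<open>F\<close> carries a factor
  \<open>m\<close>, and integrating \<open>m * weight m\<close> in time costs at most half of the
  weight. \<open>lip\<close> assumes closeness on the whole plane, because \<open>F\<close> may read
  \<open>h\<close> at other labels. A label-dependent \<open>m\<close> accommodates coefficients
  that are unbounded in \<open>a\<close>.\<close>

lemma volterra_fixpoint:
  fixes F :: "(real \<Rightarrow> real \<Rightarrow> real) \<Rightarrow> real \<Rightarrow> real \<Rightarrow> real"
  assumes m: "cts2 m" "\<And>s a. 0 \<le> m s a" "\<And>s a. m (- s) a = m s a"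
    and F: "\<And>h. cts2 h \<Longrightarrow> cts2 (F h)"
    and F0: "\<And>t a. \<bar>F (\<lambda>_ _. 0) t a\<bar> \<le> C0 * m t a * weight m t a" and C0: "0 \<le> C0"
    and lip: "\<And>h1 h2 C. cts2 h1 \<Longrightarrow> cts2 h2 \<Longrightarrow> 0 \<le> C \<Longrightarrow>
      (\<And>t a. \<bar>h1 t a - h2 t a\<bar> \<le> C * weight m t a) \<Longrightarrow>
      (\<And>t a. \<bar>F h1 t a - F h2 t a\<bar> \<le> C * m t a * weight m t a)"
  obtains h where "cts2 h" "\<And>t a. h t a = prim (\<lambda>s. F h s a) t"
proof -
  let ?W = "weight m"
  have W1: "?W t a > 0" for t a using weight_ge_1[of m t a] by linarith
  define P where "P = (\<lambda>h t a. prim (\<lambda>s. F h s a) t)"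
  have P: "cts2 (P h)" if "cts2 h" for h
    unfolding P_def by (rule prim_cts2_time[OF F[OF that]])
  have Pl: "\<bar>P h1 t a - P h2 t a\<bar> \<le> C / 2 * ?W t a"
    if "cts2 h1" "cts2 h2" "0 \<le> C" "\<And>t a. \<bar>h1 t a - h2 t a\<bar> \<le> C * ?W t a" for h1 h2 C t a
  proof -
    have d: "cts2 (\<lambda>t a. F h1 t a - F h2 t a)"
      using F[OF that(1)] F[OF that(2)] unfolding cts2_def by (intro continuous_intros)
    have "P h1 t a - P h2 t a = prim (\<lambda>s. F h1 s a - F h2 s a) t"
      unfolding P_def by (intro prim_diff[symmetric] cts2_slice_left F that)
    also have "\<bar>\<dots>\<bar> \<le> C / 2 * ?W t a"
      by (rule prim_weight2[where F = "\<lambda>t a. F h1 t a - F h2 t a"])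
         (use d m that lip[OF that] in auto)
    finally show ?thesis .
  qed
  define H where "H = (\<lambda>n. (P ^^ n) (\<lambda>_ _. 0))"
  have H0: "H 0 = (\<lambda>_ _. 0)" and HS: "H (Suc n) = P (H n)" for n by (auto simp: H_def)
  have Hc: "cts2 (H n)" for n
    by (induction n) (auto simp: H0 HS P cts2_def[of "\<lambda>_ _. 0"])
  have step: "\<bar>H (Suc n) t a - H n t a\<bar> \<le> C0 / 2 ^ n * ?W t a" for n t a
  proof (induction n arbitrary: t a)
    case 0
    have "\<bar>prim (\<lambda>s. F (\<lambda>_ _. 0) s a) t\<bar> \<le> C0 / 2 * ?W t a"
      by (rule prim_weight2) (use F0 C0 m F Hc[of 0, unfolded H0] in auto)
    also have "\<dots> \<le> C0 * ?W t a" using C0 W1[of t a] by simp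
    finally show ?case using C0 by (simp add: H0 HS P_def)
  next
    case (Suc n)
    have "\<bar>P (H (Suc n)) t a - P (H n) t a\<bar> \<le> (C0 / 2 ^ n) / 2 * ?W t a"
      by (rule Pl[OF Hc Hc _ Suc]) (use C0 in auto)
    then show ?case by (simp only: HS) (simp add: field_simps)
  qed
  \<comment> \<open>Increments of the iteration divided by the weight. They are dominated by a
    geometric series uniformly on the plane, so their sum converges uniformly and is
    continuous.\<close>
  define q where "q = (\<lambda>n p. (H (Suc n) (fst p) (snd p) - H n (fst p) (snd p)) / ?W (fst p) (snd p))"
  have q: "\<bar>q n p\<bar> \<le> C0 * (1 / 2) ^ n" for n p
    using step[of n "fst p" "snd p"] W1[of "fst p" "snd p"] 
    by (simp add: q_def abs_divide divide_le_eq field_simps power_one_over)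
  have sq: "summable (\<lambda>n. C0 * (1 / 2) ^ n)" by (intro summable_mult summable_geometric) auto
  have ul: "uniform_limit UNIV (\<lambda>n p. \<Sum>i<n. q i p) (\<lambda>p. \<Sum>i. q i p) sequentially"
    by (rule Weierstrass_m_test[OF _ sq]) (use q in auto)
  have tel: "(\<Sum>i<n. q i p) = H n (fst p) (snd p) / ?W (fst p) (snd p)" for n p
    by (induction n) (auto simp: H0 q_def field_simps diff_divide_distrib)
  define h where "h = (\<lambda>t a. ?W t a * (\<Sum>i. q i (t, a)))"
  have Wc: "continuous_on UNIV (\<lambda>p. ?W (fst p) (snd p))"
    using weight_cts2[OF m(1)] by (simp add: cts2_def)
  have Wn: "weight m t a \<noteq> 0" for t a using W1[of t a] by simp
  have "continuous_on UNIV (\<lambda>p. \<Sum>i. q i p)"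
  proof (rule uniform_limit_theorem[OF _ ul])
    show "\<forall>\<^sub>F n in sequentially. continuous_on UNIV (\<lambda>p. \<Sum>i<n. q i p)"
      unfolding tel using Hc Wn
      by (intro always_eventually allI continuous_intros Wc cts2_compose[OF Hc]) auto
  qed simp
  then have hc: "cts2 h"
    unfolding cts2_def h_def by (intro continuous_intros Wc) simp_all
  \<comment> \<open>Closeness to two consecutive iterates is asked for because \<open>P h\<close>
    will be compared with \<open>P (H n)\<close>, which is \<open>H (Suc n)\<close>.\<close>
  have close: "\<exists>n. \<forall>t a. \<bar>h t a - H n t a\<bar> \<le> e * ?W t a \<and> \<bar>h t a - H (Suc n) t a\<bar> \<le> e * ?W t a"
    if "e > 0" for e
  proof -
    from ul that have "\<forall>\<^sub>F n in sequentially. \<forall>p. dist (\<Sum>i<n. q i p) (\<Sum>i. q i p) < e"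
      by (auto simp: uniform_limit_iff)
    then obtain n where n: "\<And>k p. k \<ge> n \<Longrightarrow> dist (\<Sum>i<k. q i p) (\<Sum>i. q i p) < e"
      by (auto simp: eventually_sequentially)
    have "\<bar>h t a - H k t a\<bar> \<le> e * ?W t a" if "k \<ge> n" for k t a
    proof -
      have "h t a - H k t a = ?W t a * ((\<Sum>i. q i (t,a)) - (\<Sum>i<k. q i (t,a)))"
        using W1[of t a] unfolding tel h_def by (simp add: field_simps)
      also have "\<bar>\<dots>\<bar> = ?W t a * dist (\<Sum>i<k. q i (t,a)) (\<Sum>i. q i (t,a))"
        using W1[of t a] by (simp add: abs_mult dist_real_def abs_minus_commute)
      also have "\<dots> \<le> ?W t a * e" using n[OF that, of "(t,a)"] W1[of t a] by simp
      finally show ?thesis by (simp add: mult.commute)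
    qed
    then show ?thesis by (intro exI[of _ n]) auto
  qed
  have "h t a = P h t a" for t a
  proof -
    have "\<bar>h t a - P h t a\<bar> \<le> e * (2 * ?W t a)" if e: "e > 0" for e
    proof -
      obtain n where n: "\<And>t a. \<bar>h t a - H n t a\<bar> \<le> e * ?W t a" "\<And>t a. \<bar>h t a - H (Suc n) t a\<bar> \<le> e * ?W t a"
        using close[OF e] by blast
      have "\<bar>P h t a - P (H n) t a\<bar> \<le> e / 2 * ?W t a"
        by (rule Pl[OF hc Hc _ n(1)]) (use e in auto)
      also have "\<dots> \<le> e * ?W t a" using e W1[of t a] by simp
      finally show ?thesis using n(2)[of t a] by (simp add: HS)
    qed
    from this[of "e / (2 * ?W t a)" for e] have "\<bar>h t a - P h t a\<bar> \<le> e" if "e > 0" for e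
      using that W1[of t a] by (force simp: field_simps)
    then have "\<bar>h t a - P h t a\<bar> \<le> 0" by (rule field_le_epsilon) simp
    then show ?thesis by simp
  qed
  with hc show ?thesis by (intro that) (auto simp: P_def)
qed

lemma cts2_const: "cts2 (\<lambda>_ _. c)"
  and cts2_snd: "cts2 (\<lambda>t a. a)"
  and cts2_fst: "cts2 (\<lambda>t a. t)"
  unfolding cts2_def by (intro continuous_intros)+

lemma cts2_add: "cts2 f \<Longrightarrow> cts2 g \<Longrightarrow> cts2 (\<lambda>t a. f t a + g t a)"
  and cts2_diff: "cts2 f \<Longrightarrow> cts2 g \<Longrightarrow> cts2 (\<lambda>t a. f t a - g t a)"
  and cts2_mult: "cts2 f \<Longrightarrow> cts2 g \<Longrightarrow> cts2 (\<lambda>t a. f t a * g t a)"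
  and cts2_minus: "cts2 f \<Longrightarrow> cts2 (\<lambda>t a. - f t a)"
  and cts2_abs: "cts2 f \<Longrightarrow> cts2 (\<lambda>t a. \<bar>f t a\<bar>)"
  and cts2_exp: "cts2 f \<Longrightarrow> cts2 (\<lambda>t a. exp (f t a))"
  unfolding cts2_def by (intro continuous_intros; assumption)+

lemma cts2_comp: "cts2 F \<Longrightarrow> cts2 u \<Longrightarrow> cts2 v \<Longrightarrow> cts2 (\<lambda>t a. F (u t a) (v t a))"
  unfolding cts2_def[of u] cts2_def[of v] cts2_def[of "\<lambda>t a. F (u t a) (v t a)"]
  by (rule cts2_compose)

lemma cts2_fun: "continuous_on UNIV \<phi> \<Longrightarrow> cts2 (\<lambda>t. \<phi>)"
  unfolding cts2_def by (rule continuous_on_compose2[of UNIV \<phi>]) (auto intro: continuous_intros)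

lemma cts2_fun_comp: "continuous_on UNIV \<phi> \<Longrightarrow> cts2 f \<Longrightarrow> cts2 (\<lambda>t a. \<phi> (f t a))"
  unfolding cts2_def by (rule continuous_on_compose2[of UNIV \<phi>]) auto

lemmas cts2_intros = cts2_const cts2_fst cts2_snd cts2_add cts2_diff cts2_mult cts2_minus cts2_abs cts2_exp

section \<open>Smooth dependence on the label\<close>

text \<open>Only derivatives in the second variable, the label, are counted. At each order they are
  jointly continuous in time and label, which later gives continuity in time of Sobolev norms.
  Functions of one variable enter as families constant in time.\<close>

primrec Ck :: "nat \<Rightarrow> (real \<Rightarrow> real \<Rightarrow> real) \<Rightarrow> bool" where
  "Ck 0 f \<longleftrightarrow> cts2 f"
| "Ck (Suc n) f \<longleftrightarrow> cts2 f \<and> (\<exists>f'. (\<forall>t a. (f t has_real_derivative f' t a) (at a)) \<and> Ck n f')"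

lemma Ck_SucI:
  "cts2 f \<Longrightarrow> (\<And>t a. (f t has_real_derivative f' t a) (at a)) \<Longrightarrow> Ck n f' \<Longrightarrow> Ck (Suc n) f"
  by auto

lemma Ck_SucD:
  "Ck (Suc n) f \<Longrightarrow> \<exists>f'. cts2 f \<and> (\<forall>t a. (f t has_real_derivative f' t a) (at a)) \<and> Ck n f'"
  by simp

lemma Ck_deriv:
  assumes "Ck (Suc n) f" "\<And>t a. (f t has_real_derivative f' t a) (at a)"
  shows "Ck n f'"
proof -
  obtain g where g: "\<And>t a. (f t has_real_derivative g t a) (at a)" "Ck n g"
    using Ck_SucD[OF assms(1)] by blast
  have "g = f'" by (intro ext DERIV_unique[OF g(1) assms(2)])
  with g show ?thesis by simp
qed

lemma Ck_cts2: "Ck n f \<Longrightarrow> cts2 f"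
  by (cases n) auto

lemma Ck_Suc: "Ck (Suc n) f \<Longrightarrow> Ck n f"
proof (induction n arbitrary: f)
  case 0
  then show ?case by (auto dest: Ck_cts2)
next
  case (Suc n)
  obtain f' where "cts2 f" "\<And>t a. (f t has_real_derivative f' t a) (at a)" "Ck (Suc n) f'"
    using Ck_SucD[OF Suc.prems] by blast
  with Suc.IH show ?case by (intro Ck_SucI[of f f']) auto
qed

lemma Ck_const: "Ck n (\<lambda>_ _. c)"
proof (induction n arbitrary: c)
  case (Suc n)
  show ?case by (rule Ck_SucI[of _ "\<lambda>_ _. 0"]) (auto intro: cts2_intros Suc)
qed (simp add: cts2_intros)

lemma Ck_id: "Ck n (\<lambda>t a. a)"
proof (cases n)
  case (Suc m)
  then show ?thesis using Ck_SucI[OF cts2_snd _ Ck_const, of 1 m] by simp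
qed (simp add: cts2_intros)

lemma Ck_add: "Ck n f \<Longrightarrow> Ck n g \<Longrightarrow> Ck n (\<lambda>t a. f t a + g t a)"
proof (induction n arbitrary: f g)
  case (Suc n)
  obtain f' where f: "cts2 f" "\<And>t a. (f t has_real_derivative f' t a) (at a)" "Ck n f'"
    using Ck_SucD[OF Suc.prems(1)] by blast
  obtain g' where g: "cts2 g" "\<And>t a. (g t has_real_derivative g' t a) (at a)" "Ck n g'"
    using Ck_SucD[OF Suc.prems(2)] by blast
  show ?case
    by (rule Ck_SucI[OF _ _ Suc.IH[OF f(3) g(3)]]) (intro cts2_add f g DERIV_add)+
qed (simp add: cts2_add)

lemma Ck_mult: "Ck n f \<Longrightarrow> Ck n g \<Longrightarrow> Ck n (\<lambda>t a. f t a * g t a)"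
proof (induction n arbitrary: f g)
  case (Suc n)
  obtain f' where f: "cts2 f" "\<And>t a. (f t has_real_derivative f' t a) (at a)" "Ck n f'"
    using Ck_SucD[OF Suc.prems(1)] by blast
  obtain g' where g: "cts2 g" "\<And>t a. (g t has_real_derivative g' t a) (at a)" "Ck n g'"
    using Ck_SucD[OF Suc.prems(2)] by blast
  have "Ck n (\<lambda>t a. f' t a * g t a + g' t a * f t a)"
    by (intro Ck_add Suc.IH f g Ck_Suc[OF Suc.prems(1)] Ck_Suc[OF Suc.prems(2)])
  then show ?case
    by (rule Ck_SucI[rotated 2]) (intro cts2_mult f g DERIV_mult)+
qed (simp add: cts2_mult)

lemma Ck_minus: "Ck n f \<Longrightarrow> Ck n (\<lambda>t a. - f t a)"
  using Ck_mult[OF Ck_const[of n "-1"]] by simp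

lemma Ck_diff: "Ck n f \<Longrightarrow> Ck n g \<Longrightarrow> Ck n (\<lambda>t a. f t a - g t a)"
  using Ck_add[OF _ Ck_minus] by simp

lemma Ck_comp: "Ck n F \<Longrightarrow> Ck n f \<Longrightarrow> Ck n (\<lambda>t a. F t (f t a))"
proof (induction n arbitrary: F f)
  case 0
  then show ?case by (auto intro!: cts2_comp[of F "\<lambda>t a. t" f] cts2_intros)
next
  case (Suc n)
  obtain F' where F: "cts2 F" "\<And>t a. (F t has_real_derivative F' t a) (at a)" "Ck n F'"
    using Ck_SucD[OF Suc.prems(1)] by blast
  obtain f' where f: "cts2 f" "\<And>t a. (f t has_real_derivative f' t a) (at a)" "Ck n f'"
    using Ck_SucD[OF Suc.prems(2)] by blast
  have "Ck n (\<lambda>t a. F' t (f t a) * f' t a)"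
    by (rule Ck_mult[OF Suc.IH[OF F(3) Ck_Suc[OF Suc.prems(2)]] f(3)])
  then show ?case
  proof (rule Ck_SucI[rotated 2])
    show "cts2 (\<lambda>t a. F t (f t a))" by (rule cts2_comp[OF F(1) cts2_fst f(1)])
    show "((\<lambda>a. F t (f t a)) has_real_derivative F' t (f t a) * f' t a) (at a)" for t a
      by (rule DERIV_chain2[OF F(2) f(2)])
  qed
qed

lemma Ck_exp_fun: "Ck n (\<lambda>t. exp)"
proof (induction n)
  case (Suc n)
  then show ?case
    by (intro Ck_SucI[OF _ _ Suc]) (auto intro: cts2_intros)
qed (simp add: cts2_intros)

lemma Ck_exp: "Ck n f \<Longrightarrow> Ck n (\<lambda>t a. exp (f t a))"
  by (rule Ck_comp[OF Ck_exp_fun])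

lemma Ck_inverse:
  assumes "Ck n f" "\<And>t a. f t a \<noteq> 0"
  shows "Ck n (\<lambda>t a. inverse (f t a))"
  using assms
proof (induction n arbitrary: f)
  case 0
  then show ?case by (auto simp: cts2_def intro!: continuous_intros)
next
  case (Suc n)
  obtain f' where f: "cts2 f" "\<And>t a. (f t has_real_derivative f' t a) (at a)" "Ck n f'"
    using Ck_SucD[OF Suc.prems(1)] by blast
  have "Ck n (\<lambda>t a. - (inverse (f t a) * f' t a * inverse (f t a)))"
    by (intro Ck_minus Ck_mult Suc.IH f Ck_Suc[OF Suc.prems(1)] Suc.prems)
  then show ?case
  proof (rule Ck_SucI[rotated 2])
    show "cts2 (\<lambda>t a. inverse (f t a))"
      using f(1) Suc.prems(2) unfolding cts2_def by (intro continuous_intros) auto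
    show "((\<lambda>a. inverse (f t a)) has_real_derivative - (inverse (f t a) * f' t a * inverse (f t a))) (at a)" for t a
      by (rule DERIV_inverse'[OF f(2) Suc.prems(2)])
  qed
qed

lemma Ck_prim: "Ck n f \<Longrightarrow> Ck (Suc n) (\<lambda>t. prim (f t))"
  by (rule Ck_SucI) (auto intro!: prim_cts2 prim_deriv cts2_slice_right dest: Ck_cts2)

lemma Ck_prim_time: "Ck n f \<Longrightarrow> Ck n (\<lambda>t a. prim (\<lambda>s. f s a) t)"
proof (induction n arbitrary: f)
  case (Suc n)
  obtain f' where f: "cts2 f" "\<And>t a. (f t has_real_derivative f' t a) (at a)" "Ck n f'"
    using Ck_SucD[OF Suc.prems(1)] by blast
  show ?case
  proof (rule Ck_SucI[OF _ _ Suc.IH[OF f(3)]])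
    show "cts2 (\<lambda>t a. prim (\<lambda>s. f s a) t)" by (rule prim_cts2_time[OF f(1)])
    show "((\<lambda>a. prim (\<lambda>s. f s a) t) has_real_derivative prim (\<lambda>s. f' s a) t) (at a)" for t a
      by (rule prim_param_deriv[OF f(2) cts2_swap[OF f(1)] cts2_swap[OF Ck_cts2[OF f(3)]]])
  qed
qed (simp add: prim_cts2_time)

text \<open>The bridge from the derivatives under the existential quantifier in \<open>Ck\<close> to
  the iterates of \<open>deriv\<close>, in which \<open>C0_infty\<close> is phrased and Sobolev
  norms are later computed.\<close>

lemma Ck_deriv_iter:
  "Ck n f \<Longrightarrow> k \<le> n \<Longrightarrow> cts2 (\<lambda>t. (deriv ^^ k) (f t)) \<and>
     (k < n \<longrightarrow> (\<forall>t a. (deriv ^^ k) (f t) differentiable at a))"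
proof (induction n arbitrary: f k)
  case (Suc n)
  obtain f' where f: "cts2 f" "\<And>t a. (f t has_real_derivative f' t a) (at a)" "Ck n f'"
    using Ck_SucD[OF Suc.prems(1)] by blast
  have "deriv (f t) = f' t" for t by (intro ext DERIV_imp_deriv f)
  then show ?case using f Suc.IH[OF f(3), of "k - 1"] Suc.prems(2)
    by (cases k) (auto simp: funpow_swap1[of deriv] real_differentiable_def
          simp del: funpow.simps intro: funpow_simps_right simp: funpow_Suc_right)
qed simp

lemma DERIV_zero_open:
  fixes f :: "real \<Rightarrow> real"
  assumes "(f has_real_derivative D) (at x)" "open S" "x \<in> S" "\<And>y. y \<in> S \<Longrightarrow> f y = 0"
  shows "D = 0"
proof -
  have "(f has_real_derivative 0) (at x)"
    by (rule has_field_derivative_transform_within_open[OF DERIV_const assms(2,3)]) (simp add: assms(4))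
  then show ?thesis using DERIV_unique[OF assms(1)] by blast
qed

section \<open>Second-order Volterra equations and their dependence on a parameter\<close>

definition prim2 :: "(real \<Rightarrow> real) \<Rightarrow> real \<Rightarrow> real" where
  "prim2 f t = prim (prim f) t"

lemma prim_continuous: "continuous_on UNIV f \<Longrightarrow> continuous_on UNIV (prim f)"
  by (meson DERIV_isCont continuous_at_imp_continuous_on prim_deriv)

lemma prim2_diff:
  assumes "continuous_on UNIV f" "continuous_on UNIV g"
  shows "prim2 (\<lambda>s. f s - g s) x = prim2 f x - prim2 g x"
  unfolding prim2_def prim_diff[OF assms, abs_def]
  by (simp add: prim_diff prim_continuous assms)

lemma prim2_cmult: "prim2 (\<lambda>s. c * f s) x = c * prim2 f x"
  unfolding prim2_def prim_cmult[abs_def] by (simp add: prim_cmult)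

text \<open>One time integration is absorbed into the operator \<open>F\<close>, so the first-order
  fixed point applies. The bound \<open>1 \<le> m\<close> lets the inner integral, at most
  \<open>C / 2 * weight m t a\<close>, be enlarged to the form
  \<open>C * m t a * weight m t a\<close> that the outer one expects.\<close>

lemma volterra_fixpoint2:
  fixes G :: "(real \<Rightarrow> real \<Rightarrow> real) \<Rightarrow> real \<Rightarrow> real \<Rightarrow> real"
  assumes m: "cts2 m" "\<And>s a. 1 \<le> m s a" "\<And>s a. m (- s) a = m s a"
    and G: "\<And>h. cts2 h \<Longrightarrow> cts2 (G h)"
    and G0: "\<And>t a. \<bar>G (\<lambda>_ _. 0) t a\<bar> \<le> C0 * m t a" and C0: "0 \<le> C0"
    and lip: "\<And>h1 h2 C t a. cts2 h1 \<Longrightarrow> cts2 h2 \<Longrightarrow> 0 \<le> C \<Longrightarrow>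
      (\<And>t a. \<bar>h1 t a - h2 t a\<bar> \<le> C * weight m t a) \<Longrightarrow>
      \<bar>G h1 t a - G h2 t a\<bar> \<le> C * m t a * weight m t a"
  obtains h where "cts2 h" "\<And>t a. h t a = prim2 (\<lambda>s. G h s a) t"
proof -
  define F where "F = (\<lambda>h t a. prim (\<lambda>s. G h s a) t)"
  have m0: "0 \<le> m s a" for s a using m(2)[of s a] by linarith
  have bd: "\<bar>prim (\<lambda>s. \<gamma> s a) t\<bar> \<le> C * m t a * weight m t a"
    if "cts2 \<gamma>" "0 \<le> C" "\<And>s. \<bar>\<gamma> s a\<bar> \<le> C * m s a * weight m s a" for \<gamma> C t a
  proof -
    have "C / 2 \<le> C * m t a" using that(2) mult_left_mono[OF m(2) that(2), of t a] by simp
    then have "C / 2 * weight m t a \<le> C * m t a * weight m t a"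
      using weight_ge_1[of m t a] by (intro mult_right_mono) auto
    with prim_weight2[OF that(1) m(1) m0 that(2) m(3) that(3), of t] show ?thesis by linarith
  qed
  obtain h where h: "cts2 h" "\<And>t a. h t a = prim (\<lambda>s. F h s a) t"
  proof (rule volterra_fixpoint[OF m(1) m0 m(3), where F = F and ?C0.0 = C0])
    show "cts2 (F h)" if "cts2 h" for h
      unfolding F_def by (rule prim_cts2_time[OF G[OF that]])
    show "\<bar>F (\<lambda>_ _. 0) t a\<bar> \<le> C0 * m t a * weight m t a" for t a
      unfolding F_def
    proof (rule bd[OF G[OF cts2_const] C0])
      fix s
      have "C0 * m s a * 1 \<le> C0 * m s a * weight m s a"
        using C0 m0[of s a] weight_ge_1[of m s a] by (intro mult_left_mono) auto
      with G0[of s a] show "\<bar>G (\<lambda>_ _. 0) s a\<bar> \<le> C0 * m s a * weight m s a" by linarith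
    qed
    fix h1 h2 C t a
    assume h: "cts2 h1" "cts2 h2" "0 \<le> C" "\<And>t a. \<bar>h1 t a - h2 t a\<bar> \<le> C * weight m t a"
    have "F h1 t a - F h2 t a = prim (\<lambda>s. G h1 s a - G h2 s a) t"
      unfolding F_def by (intro prim_diff[symmetric] cts2_slice_left G h)
    also have "\<bar>\<dots>\<bar> \<le> C * m t a * weight m t a"
      by (rule bd[OF cts2_diff[OF G[OF h(1)] G[OF h(2)]] h(3) lip[OF h]])
    finally show "\<bar>F h1 t a - F h2 t a\<bar> \<le> C * m t a * weight m t a" .
  next
    fix h assume "cts2 h" "\<And>t a. h t a = prim (\<lambda>s. F h s a) t"
    then show thesis by (rule that)
  qed (rule C0)
  have "h t a = prim2 (\<lambda>s. G h s a) t" for t a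
    unfolding prim2_def using h(2)[of t a] unfolding F_def .
  with h(1) show ?thesis by (rule that)
qed

lemma volterra_linear:
  assumes \<alpha>: "cts2 \<alpha>" and \<beta>: "cts2 \<beta>"
  obtains K where "cts2 K" "\<And>t a. K t a = prim2 (\<lambda>s. \<alpha> s a * K s a + \<beta> s a) t"
\<comment> \<open>The rate dominates both coefficients, is symmetrized in time because it must be
  even, and contains 1 for its lower bound. Including \<open>\<beta>\<close> lets the bound at the
  zero function hold with constant 1.\<close>
proof (rule volterra_fixpoint2[where G = "\<lambda>K t a. \<alpha> t a * K t a + \<beta> t a" and ?C0.0 = 1
      and m = "\<lambda>s a. 1 + \<bar>\<alpha> s a\<bar> + \<bar>\<alpha> (- s) a\<bar> + \<bar>\<beta> s a\<bar> + \<bar>\<beta> (- s) a\<bar>"])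
  let ?m = "\<lambda>s a. 1 + \<bar>\<alpha> s a\<bar> + \<bar>\<alpha> (- s) a\<bar> + \<bar>\<beta> s a\<bar> + \<bar>\<beta> (- s) a\<bar>"
  show "cts2 ?m"
    by (intro cts2_intros \<alpha> \<beta> cts2_comp[OF \<alpha>, of "\<lambda>s a. - s" "\<lambda>s a. a"] cts2_comp[OF \<beta>, of "\<lambda>s a. - s" "\<lambda>s a. a"])
  fix h1 h2 :: "real \<Rightarrow> real \<Rightarrow> real" and C t a
  assume le: "\<And>t a. \<bar>h1 t a - h2 t a\<bar> \<le> C * weight ?m t a"
  have "\<bar>\<alpha> t a\<bar> * \<bar>h1 t a - h2 t a\<bar> \<le> ?m t a * (C * weight ?m t a)"
    by (intro mult_mono le) auto
  moreover have "\<alpha> t a * h1 t a + \<beta> t a - (\<alpha> t a * h2 t a + \<beta> t a) = \<alpha> t a * (h1 t a - h2 t a)"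
    by (simp add: algebra_simps)
  ultimately show "\<bar>\<alpha> t a * h1 t a + \<beta> t a - (\<alpha> t a * h2 t a + \<beta> t a)\<bar> \<le> C * ?m t a * weight ?m t a"
    by (simp only: abs_mult mult_ac)
next
  fix K assume "cts2 K" "\<And>t a. K t a = prim2 (\<lambda>s. \<alpha> s a * K s a + \<beta> s a) t"
  then show ?thesis by (rule that)
qed (auto intro!: cts2_add cts2_mult \<alpha> \<beta>)

text \<open>On a compact time interval the continuous \<open>d\<close> has some bound, and passing
  it through the double integral halves it in the weighted norm.\<close>

lemma volterra_linear_unique:
  assumes d: "continuous_on UNIV d" and \<alpha>: "continuous_on UNIV \<alpha>"
    and eq: "\<And>t. d t = prim2 (\<lambda>s. \<alpha> s * d s) t"
  shows "d t = 0"
proof -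
  define T where "T = \<bar>t\<bar>"
  define m where "m = (\<lambda>s. 1 + \<bar>\<alpha> s\<bar> + \<bar>\<alpha> (- s)\<bar>)"
  have m: "continuous_on UNIV m" unfolding m_def
    by (intro continuous_intros continuous_on_compose2[OF \<alpha>]) auto
  have m1: "1 \<le> m s" "\<bar>\<alpha> s\<bar> \<le> m s" "m (- s) = m s" for s by (auto simp: m_def)
  have m0: "0 \<le> m s" for s using m1(1)[of s] by linarith
  define w where "w = (\<lambda>s. exp (2 * \<bar>prim m s\<bar>))"
  have w1: "1 \<le> w s" for s by (simp add: w_def)
  have "bounded (d ` {-T..T})"
    by (intro compact_imp_bounded compact_continuous_image continuous_on_subset[OF d]) auto
  then obtain C0 where "\<forall>y\<in>d ` {-T..T}. norm y \<le> C0" unfolding bounded_iff by blast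
  then have C0: "\<bar>d s\<bar> \<le> C0" if "s \<in> {-T..T}" for s using that by simp
  show ?thesis
  proof (rule halving_zero[where d = d and p = t and D = "{-T..T}" and C = "\<bar>C0\<bar>" and w = w])
    fix s assume s: "s \<in> {-T..T}"
    show "\<bar>d s\<bar> \<le> \<bar>C0\<bar> * w s"
      using C0[OF s] mult_left_mono[OF w1[of s] abs_ge_zero[of C0]] by linarith
  next
    fix C s assume C: "(0::real) \<le> C" and le: "\<And>s. s \<in> {-T..T} \<Longrightarrow> \<bar>d s\<bar> \<le> C * w s"
      and s: "s \<in> {-T..T}"
    have sub: "closed_segment 0 r \<subseteq> {-T..T}" if "r \<in> {-T..T}" for r
      using that by (auto simp: closed_segment_eq_real_ivl)
    have c: "continuous_on UNIV (\<lambda>s. \<alpha> s * d s)" by (intro continuous_intros \<alpha> d)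
    have 1: "\<bar>prim (\<lambda>s. \<alpha> s * d s) r\<bar> \<le> C / 2 * w r" if r: "r \<in> {-T..T}" for r
      unfolding w_def
    proof (rule prim_weight[OF c m m0 C m1(3)])
      fix q assume "q \<in> closed_segment 0 r"
      then have "q \<in> {-T..T}" using sub[OF r] by auto
      from mult_mono[OF m1(2)[of q] le[OF this]] m0[of q]
      show "\<bar>\<alpha> q * d q\<bar> \<le> C * m q * exp (2 * \<bar>prim m q\<bar>)"
        by (simp add: abs_mult mult_ac w_def)
    qed
    show "\<bar>d s\<bar> \<le> C / 2 * w s"
      unfolding w_def eq[of s] prim2_def
    proof (rule prim_weight[OF prim_continuous[OF c] m m0 C m1(3)])
      fix q assume "q \<in> closed_segment 0 s"
      then have "q \<in> {-T..T}" using sub[OF s] by auto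
      note 1[OF this]
      also have "C / 2 * w q \<le> C * m q * w q"
        using mult_left_mono[OF m1(1)[of q] C] C w1[of q] by (intro mult_right_mono) auto
      finally show "\<bar>prim (\<lambda>s. \<alpha> s * d s) q\<bar> \<le> C * m q * exp (2 * \<bar>prim m q\<bar>)"
        by (simp add: w_def)
    qed
  qed (auto simp: T_def)
qed

text \<open>The difference quotient in the parameter solves a linear Volterra equation whose
  coefficients are continuous up to \<open>a = a0\<close>; its solution there is the derivative.\<close>

lemma volterra_param_deriv:
  assumes K: "cts2 K" "\<And>t a. K t a = prim2 (\<lambda>s. Q s a) t" and Q: "cts2 Q"
    and \<alpha>: "cts2 \<alpha>" and \<beta>: "cts2 \<beta>"
    and quot: "\<And>s a. Q s a - Q s a0 = \<alpha> s a * (K s a - K s a0) + (a - a0) * \<beta> s a"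
    and k: "continuous_on UNIV k" "\<And>t. k t = prim2 (\<lambda>s. \<alpha> s a0 * k s + \<beta> s a0) t"
  shows "(K t has_real_derivative k t) (at a0)"
proof -
  obtain R where R: "cts2 R" "\<And>t a. R t a = prim2 (\<lambda>s. \<alpha> s a * R s a + \<beta> s a) t"
    by (rule volterra_linear[OF \<alpha> \<beta>]) blast
  note c = cts2_slice_left[OF K(1)] cts2_slice_left[OF Q] cts2_slice_left[OF R(1)]
    cts2_slice_left[OF \<alpha>] cts2_slice_left[OF \<beta>]
  have "K t a - K t a0 - (a - a0) * R t a = 0" for t a
  proof (rule volterra_linear_unique[where d = "\<lambda>t. K t a - K t a0 - (a - a0) * R t a" and \<alpha> = "\<lambda>t. \<alpha> t a"])
    fix t
    have "K t a - K t a0 - (a - a0) * R t a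
        = prim2 (\<lambda>s. Q s a) t - prim2 (\<lambda>s. Q s a0) t
          - prim2 (\<lambda>s. (a - a0) * (\<alpha> s a * R s a + \<beta> s a)) t"
      unfolding prim2_cmult by (simp add: K(2)[symmetric] R(2)[symmetric])
    also have "\<dots> = prim2 (\<lambda>s. Q s a - Q s a0 - (a - a0) * (\<alpha> s a * R s a + \<beta> s a)) t"
      by (subst prim2_diff, (intro continuous_intros c)+, subst prim2_diff) (intro continuous_intros c refl)+
    also have "\<dots> = prim2 (\<lambda>s. \<alpha> s a * (K s a - K s a0 - (a - a0) * R s a)) t"
      unfolding quot by (simp add: algebra_simps)
    finally show "K t a - K t a0 - (a - a0) * R t a =
      prim2 (\<lambda>s. \<alpha> s a * (K s a - K s a0 - (a - a0) * R s a)) t" .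
  qed (intro continuous_intros c)+
  then have KR: "K t a - K t a0 = R t a * (a - a0)" for t a by (simp add: algebra_simps)
  have "R t a0 - k t = 0" for t
  proof (rule volterra_linear_unique[where d = "\<lambda>t. R t a0 - k t" and \<alpha> = "\<lambda>t. \<alpha> t a0"])
    fix t
    have "R t a0 - k t = prim2 (\<lambda>s. \<alpha> s a0 * R s a0 + \<beta> s a0) t - prim2 (\<lambda>s. \<alpha> s a0 * k s + \<beta> s a0) t"
      using R(2) k(2) by metis
    also have "\<dots> = prim2 (\<lambda>s. \<alpha> s a0 * R s a0 + \<beta> s a0 - (\<alpha> s a0 * k s + \<beta> s a0)) t"
      by (subst prim2_diff) (intro continuous_intros c k refl)+
    also have "\<dots> = prim2 (\<lambda>s. \<alpha> s a0 * (R s a0 - k s)) t"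
      by (simp add: algebra_simps)
    finally show "R t a0 - k t = prim2 (\<lambda>s. \<alpha> s a0 * (R s a0 - k s)) t" .
  qed (intro continuous_intros c k)+
  then have "R t a0 = k t" by simp
  moreover have "isCont (R t) a0"
    using cts2_slice_right[OF R(1), of UNIV t] by (simp add: continuous_on_eq_continuous_at)
  ultimately show ?thesis
    unfolding CARAT_DERIV using KR by (intro exI[of _ "R t"]) auto
qed

text \<open>Hadamard's lemma: the average of \<open>f'\<close> over the segment from
  \<open>b\<close> to \<open>a\<close> is a difference quotient that stays continuous across the
  diagonal. Continuity is stated after substituting \<open>u\<close> and \<open>v\<close>, since
  \<open>D\<close> has three arguments and \<open>cts2\<close> speaks of two.\<close>

lemma divided_difference:
  assumes d: "\<And>t a. (f t has_real_derivative f' t a) (at a)" and f': "cts2 f'"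
  obtains D where "\<And>t a b. f t a - f t b = (a - b) * D t a b" "\<And>t a. D t a a = f' t a"
    "\<And>u v. cts2 u \<Longrightarrow> cts2 v \<Longrightarrow> cts2 (\<lambda>t a. D t (u t a) (v t a))"
proof
  define D where "D = (\<lambda>t a b. integral {0..1} (\<lambda>\<theta>. f' t (b + \<theta> * (a - b))))"
  have c: "continuous_on UNIV (f' t)" for t by (rule cts2_slice_right[OF f'])
  show "f t a - f t b = (a - b) * D t a b" for t a b
  proof -
    have "prim (\<lambda>s. f' t (s + b)) (a - b) = f t (a - b + b) - f t (0 + b)"
      by (rule prim_FTC[of "\<lambda>s. f t (s + b)"]) (rule DERIV_shift[THEN iffD1, OF d])
    then show ?thesis by (simp add: prim_def D_def add.commute)
  qed
  show "D t a a = f' t a" for t a by (simp add: D_def)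
  show "cts2 (\<lambda>t a. D t (u t a) (v t a))" if "cts2 u" "cts2 v" for u v
  proof -
    have "continuous_on UNIV (\<lambda>p. integral (cbox 0 1)
        (\<lambda>\<theta>. f' (fst p) (v (fst p) (snd p) + \<theta> * (u (fst p) (snd p) - v (fst p) (snd p)))))"
      by (rule integral_continuous_on_param, unfold case_prod_beta')
         (intro continuous_intros cts2_compose[OF f'] cts2_compose[OF that(1)] cts2_compose[OF that(2)])
    then show ?thesis unfolding cts2_def D_def cbox_interval .
  qed
qed

text \<open>The derivative solves the formally differentiated equation. That equation is again
  linear with the same \<open>\<alpha>\<close>, and its inhomogeneity contains \<open>K\<close>
  itself, already of order \<open>n\<close> by the induction hypothesis. The hypothesis applied to
  the new equation then gives \<open>K\<close> one more derivative.\<close>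

lemma volterra_linear_Ck:
  assumes "Ck n \<alpha>" "Ck n \<beta>" "cts2 K" "\<And>t a. K t a = prim2 (\<lambda>s. \<alpha> s a * K s a + \<beta> s a) t"
  shows "Ck n K"
  using assms
proof (induction n arbitrary: \<alpha> \<beta> K)
  case (Suc n)
  obtain \<alpha>' where \<alpha>: "cts2 \<alpha>" "\<And>t a. (\<alpha> t has_real_derivative \<alpha>' t a) (at a)" "Ck n \<alpha>'"
    using Ck_SucD[OF Suc.prems(1)] by blast
  obtain \<beta>' where \<beta>: "cts2 \<beta>" "\<And>t a. (\<beta> t has_real_derivative \<beta>' t a) (at a)" "Ck n \<beta>'"
    using Ck_SucD[OF Suc.prems(2)] by blast
  note K = Suc.prems(3,4)
  have CkK: "Ck n K" by (rule Suc.IH[OF Ck_Suc[OF Suc.prems(1)] Ck_Suc[OF Suc.prems(2)] K])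
  have \<gamma>: "Ck n (\<lambda>t a. \<alpha>' t a * K t a + \<beta>' t a)" by (intro Ck_add Ck_mult \<alpha> \<beta> CkK)
  obtain K' where K': "cts2 K'" "\<And>t a. K' t a = prim2 (\<lambda>s. \<alpha> s a * K' s a + (\<alpha>' s a * K s a + \<beta>' s a)) t"
    by (rule volterra_linear[OF \<alpha>(1) Ck_cts2[OF \<gamma>]]) blast
  obtain D where D: "\<And>t a b. \<alpha> t a - \<alpha> t b = (a - b) * D t a b" "\<And>t a. D t a a = \<alpha>' t a"
    "\<And>u v. cts2 u \<Longrightarrow> cts2 v \<Longrightarrow> cts2 (\<lambda>t a. D t (u t a) (v t a))"
    by (rule divided_difference[OF \<alpha>(2) Ck_cts2[OF \<alpha>(3)]]) blast
  obtain E where E: "\<And>t a b. \<beta> t a - \<beta> t b = (a - b) * E t a b" "\<And>t a. E t a a = \<beta>' t a"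
    "\<And>u v. cts2 u \<Longrightarrow> cts2 v \<Longrightarrow> cts2 (\<lambda>t a. E t (u t a) (v t a))"
    by (rule divided_difference[OF \<beta>(2) Ck_cts2[OF \<beta>(3)]]) blast
  show ?case
  proof (rule Ck_SucI[OF K(1)])
    show "Ck n K'" by (rule Suc.IH[OF Ck_Suc[OF Suc.prems(1)] \<gamma> K'])
    fix t a0
    show "(K t has_real_derivative K' t a0) (at a0)"
    proof (rule volterra_param_deriv[OF K, where k = "\<lambda>t. K' t a0" and \<alpha> = \<alpha>
          and \<beta> = "\<lambda>t a. D t a a0 * K t a0 + E t a a0"])
      have "cts2 (\<lambda>t a. K t a0)" by (rule cts2_comp[OF K(1)]) (intro cts2_intros)+
      then show "cts2 (\<lambda>t a. D t a a0 * K t a0 + E t a a0)"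
        by (intro cts2_intros D E)
      show "(\<alpha> s a * K s a + \<beta> s a) - (\<alpha> s a0 * K s a0 + \<beta> s a0) =
        \<alpha> s a * (K s a - K s a0) + (a - a0) * (D s a a0 * K s a0 + E s a a0)" for s a
        using D(1)[of s a a0] E(1)[of s a a0] by algebra
      show "K' t a0 = prim2 (\<lambda>s. \<alpha> s a0 * K' s a0 + (D s a0 a0 * K s a0 + E s a0 a0)) t" for t
        unfolding D E by (rule K'(2))
    qed (intro cts2_intros \<alpha> \<beta> K cts2_slice_left K')+
  qed
qed simp

section \<open>Bumps and cutoffs\<close>

text \<open>The functions \<open>P(1/x) exp (-\<epsilon>/x)\<close> form a class that is closed under differentiation.\<close>

definition flat :: "real poly \<Rightarrow> real \<Rightarrow> real \<Rightarrow> real" where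
  "flat P \<epsilon> x = (if 0 < x then poly P (1 / x) * exp (- \<epsilon> / x) else 0)"

lemma poly_exp_decay:
  assumes "0 < (\<epsilon>::real)"
  shows "((\<lambda>u. poly P u * exp (- \<epsilon> * u)) \<longlongrightarrow> 0) at_top"
proof -
  have lim: "((\<lambda>u. (\<epsilon> * u) ^ k / exp (\<epsilon> * u)) \<longlongrightarrow> 0) at_top" for k
    by (rule filterlim_compose[OF tendsto_power_div_exp_0])
       (rule filterlim_tendsto_pos_mult_at_top[OF tendsto_const assms filterlim_ident])
  have "((\<lambda>u. \<Sum>k\<le>degree P. coeff P k / \<epsilon> ^ k * ((\<epsilon> * u) ^ k / exp (\<epsilon> * u))) \<longlongrightarrow>
      (\<Sum>k\<le>degree P. coeff P k / \<epsilon> ^ k * 0)) at_top"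
    by (intro tendsto_sum tendsto_mult tendsto_const lim)
  moreover have "(\<Sum>k\<le>degree P. coeff P k / \<epsilon> ^ k * ((\<epsilon> * u) ^ k / exp (\<epsilon> * u))) = poly P u * exp (- \<epsilon> * u)" for u
    unfolding poly_altdef sum_distrib_right
    by (rule sum.cong) (use assms in \<open>simp_all add: power_mult_distrib exp_minus divide_inverse\<close>)
  ultimately show ?thesis by simp
qed

text \<open>With u = 1/x the derivative of P(u) exp(-\<epsilon> u) is u^2 (\<epsilon> P - P')(u)
  exp(-\<epsilon> u); the factor \<open>[:0, 0, 1:]\<close> is u^2. At 0 the right difference
  quotient is u P(u) exp(-\<epsilon> u), and the exponential beats the polynomial.\<close>

lemma flat_deriv:
  assumes "0 < \<epsilon>"
  shows "(flat P \<epsilon> has_real_derivative flat ([:0, 0, 1:] * (smult \<epsilon> P - pderiv P)) \<epsilon> x) (at x)"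
proof -
  let ?Q = "[:0, 0, 1:] * (smult \<epsilon> P - pderiv P)"
  consider "0 < x" | "x < 0" | "x = 0" by linarith
  then show ?thesis
  proof cases
    case 1
    have "((\<lambda>x. poly P (1 / x) * exp (- \<epsilon> / x)) has_real_derivative
        poly (pderiv P) (1 / x) * (- 1 / x\<^sup>2) * exp (- \<epsilon> / x)
        + exp (- \<epsilon> / x) * (\<epsilon> / x\<^sup>2) * poly P (1 / x)) (at x)"
    proof (rule DERIV_mult)
      have "((\<lambda>x. 1 / x) has_real_derivative - 1 / x\<^sup>2) (at x)"
        using 1 by (auto intro!: derivative_eq_intros simp: power2_eq_square)
      from DERIV_chain2[OF poly_DERIV this]
      show "((\<lambda>x. poly P (1 / x)) has_real_derivative poly (pderiv P) (1 / x) * (- 1 / x\<^sup>2)) (at x)" .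
      show "((\<lambda>x. exp (- \<epsilon> / x)) has_real_derivative exp (- \<epsilon> / x) * (\<epsilon> / x\<^sup>2)) (at x)"
        using 1 by (auto intro!: derivative_eq_intros simp: power2_eq_square)
    qed
    then have "((\<lambda>x. poly P (1 / x) * exp (- \<epsilon> / x)) has_real_derivative flat ?Q \<epsilon> x) (at x)"
      by (rule DERIV_cong) (use 1 in \<open>simp add: flat_def field_simps power2_eq_square\<close>)
    then show ?thesis
      by (rule has_field_derivative_transform_within_open[of _ _ _ "{0<..}"])
         (use 1 in \<open>auto simp: flat_def\<close>)
  next
    case 2
    have "((\<lambda>_. 0) has_real_derivative flat ?Q \<epsilon> x) (at x)" using 2 by (simp add: flat_def)
    then show ?thesis
      by (rule has_field_derivative_transform_within_open[of _ _ _ "{..<0}"])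
         (use 2 in \<open>auto simp: flat_def\<close>)
  next
    case 3
    have "((\<lambda>h. flat P \<epsilon> h / h) \<longlongrightarrow> 0) (at_right 0)"
    proof -
      have "((\<lambda>h. poly (pCons 0 P) (inverse h) * exp (- \<epsilon> * inverse h)) \<longlongrightarrow> 0) (at_right 0)"
        by (rule filterlim_compose[OF poly_exp_decay[OF assms] filterlim_inverse_at_top_right])
      moreover have "\<forall>\<^sub>F h in at_right 0. poly (pCons 0 P) (inverse h) * exp (- \<epsilon> * inverse h) = flat P \<epsilon> h / h"
        using eventually_at_right_less by eventually_elim (simp add: flat_def field_simps)
      ultimately show ?thesis by (rule Lim_transform_eventually)
    qed
    moreover have "((\<lambda>h. flat P \<epsilon> h / h) \<longlongrightarrow> 0) (at_left 0)"
    proof (rule tendsto_eventually)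
      show "\<forall>\<^sub>F h in at_left 0. flat P \<epsilon> h / h = 0"
        by (rule eventually_at_leftI[of "-1"]) (auto simp: flat_def)
    qed
    ultimately have "((\<lambda>h. flat P \<epsilon> h / h) \<longlongrightarrow> 0) (at 0)" by (simp add: filterlim_at_split)
    then show ?thesis unfolding 3 by (simp add: DERIV_def flat_def[of _ _ 0])
  qed
qed

lemma flat_Ck: "0 < \<epsilon> \<Longrightarrow> Ck n (\<lambda>t. flat P \<epsilon>)"
proof (induction n arbitrary: P)
  case 0
  have "continuous_on UNIV (flat P \<epsilon>)"
    by (intro continuous_at_imp_continuous_on ballI DERIV_isCont[OF flat_deriv[OF 0]])
  then show ?case by (simp add: cts2_fun)
next
  case (Suc n)
  have "continuous_on UNIV (flat P \<epsilon>)"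
    by (intro continuous_at_imp_continuous_on ballI DERIV_isCont[OF flat_deriv[OF Suc.prems]])
  then show ?case
    by (intro Ck_SucI[OF cts2_fun flat_deriv[OF Suc.prems] Suc.IH[OF Suc.prems]])
qed

text \<open>The parameter is kept because cutoffs use \<open>\<epsilon> = 1\<close> while later test
  functions let \<open>\<epsilon>\<close> tend to 0.\<close>

abbreviation ebump :: "real \<Rightarrow> real \<Rightarrow> real" where
  "ebump \<epsilon> \<equiv> flat 1 \<epsilon>"

lemma ebump_simps: "0 < x \<Longrightarrow> ebump \<epsilon> x = exp (- \<epsilon> / x)" "x \<le> 0 \<Longrightarrow> ebump \<epsilon> x = 0"
  by (simp_all add: flat_def)

lemma ebump_pos: "0 < x \<Longrightarrow> 0 < ebump \<epsilon> x" and ebump_nonneg: "0 \<le> ebump \<epsilon> x"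
  by (simp_all add: flat_def)

definition bump :: "real \<Rightarrow> real \<Rightarrow> real \<Rightarrow> real \<Rightarrow> real" where
  "bump \<epsilon> a b x = ebump \<epsilon> (x - a) * ebump \<epsilon> (b - x)"

lemma Ck_affine: "Ck n (\<lambda>t x. x - a)" "Ck n (\<lambda>t x. a - x)" "Ck n (\<lambda>t x. a + x)"
  by (intro Ck_diff Ck_add Ck_id Ck_const)+

lemma bump_Ck: "0 < \<epsilon> \<Longrightarrow> Ck n (\<lambda>t. bump \<epsilon> a b)"
  using Ck_mult[OF Ck_comp[OF flat_Ck Ck_affine(1)] Ck_comp[OF flat_Ck Ck_affine(2)]]
  unfolding bump_def[abs_def] by blast

lemma C0_inftyI:
  assumes "\<And>n. Ck n (\<lambda>t. \<phi>)" "\<And>x. \<phi> x \<noteq> 0 \<Longrightarrow> a \<le> x \<and> x \<le> b" "0 < a" "b < 1"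
  shows "\<phi> \<in> C0_infty"
proof -
  have sub: "closure {x. \<phi> x \<noteq> 0} \<subseteq> {a..b}"
    by (rule closure_minimal) (use assms(2) in auto)
  have "compact (closure {x. \<phi> x \<noteq> 0})"
    using compact_Int_closed[OF compact_Icc closed_closure] sub by (metis inf.absorb2)
  moreover have "((deriv ^^ k) \<phi>) differentiable (at x)" for k x
    using Ck_deriv_iter[OF assms(1)[of "Suc k"], of k] by simp
  ultimately show ?thesis using sub assms(3,4) by (auto simp: C0_infty_def)
qed

section \<open>Smooth transitions and cutoffs\<close>

definition smooth_step :: "real \<Rightarrow> real" where
  "smooth_step u = ebump 1 u * inverse (ebump 1 u + ebump 1 (1 - u))"

lemma smooth_step_denom: "0 < ebump 1 u + ebump 1 (1 - u)"
  using ebump_pos[of u 1] ebump_pos[of "1 - u" 1] ebump_nonneg[of 1 u] ebump_nonneg[of 1 "1 - u"]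
  by (cases "0 < u") auto

lemma smooth_step_Ck: "Ck n (\<lambda>t. smooth_step)"
proof -
  have 1: "Ck n (\<lambda>t. ebump 1)" by (simp add: flat_Ck)
  have 2: "Ck n (\<lambda>t u. ebump 1 (1 - u))" by (rule Ck_comp[OF 1 Ck_affine(2)])
  have "Ck n (\<lambda>t u. ebump 1 u * inverse (ebump 1 u + ebump 1 (1 - u)))"
    by (rule Ck_mult[OF 1 Ck_inverse[OF Ck_add[OF 1 2]]]) (use smooth_step_denom in \<open>metis less_irrefl\<close>)
  then show ?thesis by (simp add: smooth_step_def[abs_def])
qed

lemma smooth_step_1: "1 \<le> u \<Longrightarrow> smooth_step u = 1"
  using ebump_pos[of u 1] by (simp add: smooth_step_def ebump_simps)

lemma smooth_step_0: "u \<le> 0 \<Longrightarrow> smooth_step u = 0"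
  by (simp add: smooth_step_def ebump_simps)

lemma bounded_compact_support:
  assumes "continuous_on UNIV (f :: real \<Rightarrow> real)" "\<And>x. R < \<bar>x\<bar> \<Longrightarrow> f x = 0"
  shows "\<exists>B\<ge>0. \<forall>x. \<bar>f x\<bar> \<le> B"
proof -
  have "bounded (f ` {-\<bar>R\<bar>..\<bar>R\<bar>})"
    by (intro compact_imp_bounded compact_continuous_image continuous_on_subset[OF assms(1)]) auto
  then obtain B where B: "\<forall>y\<in>f ` {-\<bar>R\<bar>..\<bar>R\<bar>}. norm y \<le> B" unfolding bounded_iff by blast
  have "\<bar>f x\<bar> \<le> \<bar>B\<bar>" for x
  proof (cases "R < \<bar>x\<bar>")
    case True
    then show ?thesis using assms(2) by simp
  next
    case False
    then have "x \<in> {-\<bar>R\<bar>..\<bar>R\<bar>}" by auto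
    then have "\<bar>f x\<bar> \<le> B" using B by auto
    then show ?thesis by linarith
  qed
  then show ?thesis by (intro exI[of _ "\<bar>B\<bar>"]) auto
qed

lemma DERIV_bound_lipschitz:
  fixes f :: "real \<Rightarrow> real"
  assumes "\<And>x. (f has_real_derivative f' x) (at x)" "\<And>x. \<bar>f' x\<bar> \<le> B"
  shows "\<bar>f x - f y\<bar> \<le> B * \<bar>x - y\<bar>"
proof -
  have "norm (f x - f y) \<le> B * norm (x - y)"
    by (rule field_differentiable_bound[OF convex_UNIV]) (use assms in auto)
  then show ?thesis by simp
qed

text \<open>The identity is multiplied by two transitions that are 1 up to \<open>N + 1\<close> and
  together vanish beyond \<open>N + 2\<close>. The margin between \<open>N\<close> and
  \<open>N + 1\<close> later makes the derivative equal to 1 at every value of size at most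
  \<open>N\<close>, endpoints included.\<close>

lemma cutoff_exists:
  fixes N :: real
  shows "\<exists>\<kappa> B L. (\<forall>n. Ck n (\<lambda>t. \<kappa>)) \<and> (\<forall>x. \<bar>x\<bar> \<le> N + 1 \<longrightarrow> \<kappa> x = x) \<and>
     (\<forall>x. \<bar>\<kappa> x\<bar> \<le> B) \<and> (\<forall>x y. \<bar>\<kappa> x - \<kappa> y\<bar> \<le> L * \<bar>x - y\<bar>)"
proof -
  define \<kappa> where "\<kappa> = (\<lambda>x. x * (smooth_step (N + 2 - x) * smooth_step (N + 2 + x)))"
  have ck: "Ck n (\<lambda>t. \<kappa>)" for n
    unfolding \<kappa>_def
    by (rule Ck_mult[OF Ck_id Ck_mult[OF Ck_comp[OF smooth_step_Ck Ck_affine(2)] Ck_comp[OF smooth_step_Ck Ck_affine(3)]]])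
  have id: "\<kappa> x = x" if "\<bar>x\<bar> \<le> N + 1" for x
    using that by (simp add: \<kappa>_def smooth_step_1)
  have z: "\<kappa> x = 0" if "N + 2 < \<bar>x\<bar>" for x
  proof -
    have "N + 2 - x \<le> 0 \<or> N + 2 + x \<le> 0" using that by linarith
    then show ?thesis by (auto simp: \<kappa>_def smooth_step_0)
  qed
  have c: "continuous_on UNIV \<kappa>" using cts2_slice_right[OF Ck_cts2[OF ck[of 0]]] .
  obtain B where B: "\<forall>x. \<bar>\<kappa> x\<bar> \<le> B" using bounded_compact_support[OF c z] by blast
  obtain \<kappa>' where \<kappa>': "\<And>x. (\<kappa> has_real_derivative \<kappa>' 0 x) (at x)" "Ck 0 \<kappa>'"
    using Ck_SucD[OF ck[of 1, unfolded One_nat_def]] by blast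
  have "\<kappa>' 0 x = 0" if "N + 2 < \<bar>x\<bar>" for x
  proof (rule DERIV_zero_open[OF \<kappa>'(1)])
    show "open {x. N + 2 < \<bar>x\<bar>}" by (intro open_Collect_less continuous_intros)
  qed (use that z in auto)
  then obtain L where "\<forall>x. \<bar>\<kappa>' 0 x\<bar> \<le> L"
    using bounded_compact_support[of "\<kappa>' 0" "N + 2"] cts2_slice_right[of \<kappa>' UNIV 0] \<kappa>'(2) by auto
  then have "\<bar>\<kappa> x - \<kappa> y\<bar> \<le> L * \<bar>x - y\<bar>" for x y
    by (intro DERIV_bound_lipschitz[OF \<kappa>'(1)]) auto
  with ck id B show ?thesis
    by (intro exI[of _ \<kappa>] exI[of _ B] exI[of _ L] conjI allI impI) auto
qed

lemma exp_lipschitz: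
  assumes "x \<le> M" "y \<le> (M::real)"
  shows "\<bar>exp x - exp y\<bar> \<le> exp M * \<bar>x - y\<bar>"
proof -
  have "norm (exp x - exp y) \<le> exp M * norm (x - y)"
    by (rule field_differentiable_bound[where S = "{..M}" and f' = exp])
       (use assms in \<open>auto intro: has_field_derivative_at_within\<close>)
  then show ?thesis by simp
qed

section \<open>The truncated Lagrangian equation\<close>

text \<open>The Lagrangian equation is \<open>h'' = g e\<^sup>Z e\<^sup>-\<^sup>h\<close> with \<open>Z(t, a) = \<integral> e\<^sup>h\<close> over \<open>[0, a]\<close>; replacing
  \<open>h\<close> by \<open>\<kappa>(h)\<close> on the right-hand side, for a cutoff \<open>\<kappa>\<close>, makes it globally Lipschitz.\<close>

locale truncated =
  fixes g \<kappa> :: "real \<Rightarrow> real" and R Gm B L :: real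
  assumes g_cont: "continuous_on UNIV g" and g_bound: "\<And>a. \<bar>g a\<bar> \<le> Gm" and g_supp: "\<And>a. R < \<bar>a\<bar> \<Longrightarrow> g a = 0"
    and R: "0 \<le> R"
    and \<kappa>_cont: "continuous_on UNIV \<kappa>" and \<kappa>_bound: "\<And>x. \<bar>\<kappa> x\<bar> \<le> B"
    and \<kappa>_lip: "\<And>x y. \<bar>\<kappa> x - \<kappa> y\<bar> \<le> L * \<bar>x - y\<bar>"
begin

definition Zt :: "(real \<Rightarrow> real \<Rightarrow> real) \<Rightarrow> real \<Rightarrow> real \<Rightarrow> real" where
  "Zt h t a = prim (\<lambda>b. exp (\<kappa> (h t b))) a"

definition Gt :: "(real \<Rightarrow> real \<Rightarrow> real) \<Rightarrow> real \<Rightarrow> real \<Rightarrow> real" where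
  "Gt h t a = g a * exp (Zt h t a) * exp (- \<kappa> (h t a))"

text \<open>On the support of \<open>g\<close>, |Z| is at most \<open>R * exp B\<close>, so e^Z is
  at most \<open>exp (R * exp B)\<close>, and e^(-\<kappa>(h)) is at most \<open>exp B\<close>. A
  change \<delta> of h moves Z by at most \<open>R * exp B * L * \<delta>\<close> and \<kappa>(h) by
  at most \<open>L * \<delta>\<close>; the last factor adds the two effects.\<close>

definition Lip :: real where
  "Lip = Gm * exp (R * exp B) * exp B * L * (R * exp B + 1)"

lemma L_nonneg: "0 \<le> L" using \<kappa>_lip[of 1 0] by simp
lemma Gm_nonneg: "0 \<le> Gm" using g_bound[of 0] by linarith
lemma Lip_nonneg: "0 \<le> Lip"
  unfolding Lip_def using L_nonneg Gm_nonneg R by (intro mult_nonneg_nonneg add_nonneg_nonneg) auto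

lemma exp_cutoff_cts2: "cts2 h \<Longrightarrow> cts2 (\<lambda>t b. exp (\<kappa> (h t b)))"
  by (rule cts2_exp[OF cts2_fun_comp[OF \<kappa>_cont]])

lemma Zt_cts2: "cts2 h \<Longrightarrow> cts2 (Zt h)"
  unfolding Zt_def by (intro prim_cts2 exp_cutoff_cts2)

lemma Gt_cts2: "cts2 h \<Longrightarrow> cts2 (Gt h)"
  unfolding Gt_def by (intro cts2_intros Zt_cts2 cts2_fun_comp[OF \<kappa>_cont] cts2_fun g_cont)

lemma Zt_le: assumes "cts2 h" shows "\<bar>Zt h t a\<bar> \<le> \<bar>a\<bar> * exp B"
  unfolding Zt_def
  by (rule prim_abs_le[OF cts2_slice_right[OF exp_cutoff_cts2[OF assms]]])
     (use \<kappa>_bound in \<open>auto simp: abs_le_iff\<close>)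

lemma exp_cutoff_lipschitz:
  assumes "\<bar>x - y\<bar> \<le> \<delta>" "\<bar>\<sigma>\<bar> = 1"
  shows "\<bar>exp (\<sigma> * \<kappa> x) - exp (\<sigma> * \<kappa> y)\<bar> \<le> exp B * (L * \<delta>)"
proof -
  have le: "\<kappa> u \<le> B" "- \<kappa> u \<le> B" for u using \<kappa>_bound[of u] by auto
  have "\<sigma> = 1 \<or> \<sigma> = -1" using assms(2) by linarith
  then have "\<bar>exp (\<sigma> * \<kappa> x) - exp (\<sigma> * \<kappa> y)\<bar> \<le> exp B * \<bar>\<kappa> x - \<kappa> y\<bar>"
    using exp_lipschitz[of "\<kappa> x" B "\<kappa> y"] exp_lipschitz[of "- \<kappa> x" B "- \<kappa> y"]
      le by (auto simp: abs_minus_commute)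
  also have "\<bar>\<kappa> x - \<kappa> y\<bar> \<le> L * \<bar>x - y\<bar>" by (rule \<kappa>_lip)
  also have "\<dots> \<le> L * \<delta>" by (intro mult_left_mono assms L_nonneg)
  finally show ?thesis by simp
qed

lemma Zt_lipschitz:
  assumes h: "cts2 h1" "cts2 h2"
    and \<delta>: "\<And>b. b \<in> closed_segment 0 a \<Longrightarrow> \<bar>h1 t b - h2 t b\<bar> \<le> \<delta>"
  shows "\<bar>Zt h1 t a - Zt h2 t a\<bar> \<le> \<bar>a\<bar> * (exp B * (L * \<delta>))"
proof -
  note c = cts2_slice_right[OF exp_cutoff_cts2[OF h(1)]] cts2_slice_right[OF exp_cutoff_cts2[OF h(2)]]
  have "\<bar>Zt h1 t a - Zt h2 t a\<bar> = \<bar>prim (\<lambda>b. exp (\<kappa> (h1 t b)) - exp (\<kappa> (h2 t b))) a\<bar>"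
    unfolding Zt_def by (simp add: prim_diff c)
  also have "\<dots> \<le> \<bar>a\<bar> * (exp B * (L * \<delta>))"
    using exp_cutoff_lipschitz[OF \<delta>, of _ 1] by (intro prim_abs_le continuous_intros c) simp
  finally show ?thesis .
qed

text \<open>Only labels between 0 and \<open>a\<close> are compared, because \<open>Zt\<close>
  integrates over that segment. This locality is what makes uniqueness on a rectangle of times and
  labels possible.\<close>

lemma Gt_lipschitz:
  assumes h: "cts2 h1" "cts2 h2"
    and \<delta>: "\<And>b. b \<in> closed_segment 0 a \<Longrightarrow> \<bar>h1 t b - h2 t b\<bar> \<le> \<delta>"
  shows "\<bar>Gt h1 t a - Gt h2 t a\<bar> \<le> Lip * \<delta>"
proof (cases "R < \<bar>a\<bar>")
  case True
  have "0 \<le> \<delta>" using \<delta>[of a] by auto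
  with True show ?thesis using Lip_nonneg by (simp add: Gt_def g_supp)
next
  case False
  then have a: "\<bar>a\<bar> \<le> R" by simp
  have \<delta>0: "0 \<le> \<delta>" using \<delta>[of a] by auto
  have le: "\<bar>\<kappa> x\<bar> \<le> B" "\<kappa> x \<le> B" "- \<kappa> x \<le> B" for x using \<kappa>_bound[of x] by auto
  have dZ: "\<bar>Zt h1 t a - Zt h2 t a\<bar> \<le> R * (exp B * (L * \<delta>))"
    by (rule order_trans[OF Zt_lipschitz[OF h \<delta>]]) (use a L_nonneg \<delta>0 in \<open>auto intro!: mult_right_mono\<close>)
  define M where "M = R * exp B"
  have ZM: "Zt h t a \<le> M" if "cts2 h" for h
    unfolding M_def
    using Zt_le[OF that, of t a] mult_right_mono[OF a exp_ge_zero[of B]] abs_ge_self[of "Zt h t a"] by linarith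
  have eM: "exp (Zt h2 t a) \<le> exp M" using ZM[OF h(2)] by simp
  have "Gt h1 t a - Gt h2 t a = g a * ((exp (Zt h1 t a) - exp (Zt h2 t a)) * exp (- \<kappa> (h1 t a))
      + exp (Zt h2 t a) * (exp (- \<kappa> (h1 t a)) - exp (- \<kappa> (h2 t a))))"
    by (simp add: Gt_def algebra_simps)
  also have "\<bar>\<dots>\<bar> \<le> Gm * (exp M * (R * (exp B * (L * \<delta>))) * exp B + exp M * (exp B * (L * \<delta>)))"
    unfolding abs_mult
  proof (intro mult_mono g_bound order_trans[OF abs_triangle_ineq] add_mono; (unfold abs_mult)?)
    show "\<bar>exp (Zt h1 t a) - exp (Zt h2 t a)\<bar> * \<bar>exp (- \<kappa> (h1 t a))\<bar>
        \<le> exp M * (R * (exp B * (L * \<delta>))) * exp B"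
    proof (intro mult_mono)
      show "\<bar>exp (Zt h1 t a) - exp (Zt h2 t a)\<bar> \<le> exp M * (R * (exp B * (L * \<delta>)))"
        by (rule order_trans[OF exp_lipschitz[OF ZM[OF h(1)] ZM[OF h(2)]] mult_left_mono[OF dZ exp_ge_zero]])
    qed (use le R L_nonneg \<delta>0 in auto)
    show "\<bar>exp (Zt h2 t a)\<bar> * \<bar>exp (- \<kappa> (h1 t a)) - exp (- \<kappa> (h2 t a))\<bar> \<le> exp M * (exp B * (L * \<delta>))"
      using exp_cutoff_lipschitz[OF \<delta>, of a "-1"] eM by (intro mult_mono) auto
  qed (use Gm_nonneg in auto)
  also have "\<dots> = Lip * \<delta>"
    by (simp add: Lip_def M_def algebra_simps)
  finally show ?thesis .
qed

lemma trunc_exists: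
  obtains h where "cts2 h" "\<And>t a. h t a = prim2 (\<lambda>s. Gt h s a) t"
proof -
  \<comment> \<open>A constant rate makes the weight independent of the label, so the bound at one
    label serves for the whole segment over which \<open>Zt\<close> integrates.\<close>
  define m where "m = (\<lambda>(s::real) (a::real). Lip + 1)"
  define C0 where "C0 = Gm * exp (R * exp B) * exp B"
  have C0: "0 \<le> C0" using Gm_nonneg by (simp add: C0_def)
  show ?thesis
  proof (rule volterra_fixpoint2[where G = Gt and m = m and ?C0.0 = C0])
    show "\<bar>Gt (\<lambda>_ _. 0) t a\<bar> \<le> C0 * m t a" for t a
    proof -
      have "\<bar>Gt (\<lambda>_ _. 0) t a\<bar> \<le> C0"
      proof (cases "R < \<bar>a\<bar>")
        case False
        then have "\<bar>a\<bar> * exp B \<le> R * exp B" by simp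
        with Zt_le[OF cts2_const, of 0 t a] have "Zt (\<lambda>_ _. 0) t a \<le> R * exp B" by linarith
        moreover have "- \<kappa> 0 \<le> B" using \<kappa>_bound[of 0] by linarith
        ultimately show ?thesis unfolding Gt_def C0_def abs_mult
          by (intro mult_mono g_bound) (use Gm_nonneg in auto)
      qed (use C0 in \<open>simp add: Gt_def g_supp\<close>)
      also have "C0 \<le> C0 * (Lip + 1)" using C0 Lip_nonneg by (simp add: algebra_simps)
      finally show ?thesis by (simp add: m_def)
    qed
    fix h1 h2 C t a
    assume h: "cts2 h1" "cts2 h2" "0 \<le> C" "\<And>t a. \<bar>h1 t a - h2 t a\<bar> \<le> C * weight m t a"
    have "weight m t b = weight m t a" for b by (simp add: weight_def m_def)
    with h(4) have "\<bar>Gt h1 t a - Gt h2 t a\<bar> \<le> Lip * (C * weight m t a)"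
      by (intro Gt_lipschitz[OF h(1,2)]) metis
    also have "\<dots> \<le> (Lip + 1) * (C * weight m t a)"
      using h(3) weight_ge_1[of m t a] by (intro mult_right_mono) auto
    finally show "\<bar>Gt h1 t a - Gt h2 t a\<bar> \<le> C * m t a * weight m t a" by (simp add: m_def mult_ac)
  next
    fix h assume "cts2 h" "\<And>t a. h t a = prim2 (\<lambda>s. Gt h s a) t"
    then show thesis by (rule that)
  qed (use Lip_nonneg C0 in \<open>auto simp: m_def intro: cts2_const Gt_cts2\<close>)
qed

text \<open>The rectangle contains all earlier times and all smaller nonnegative labels, hence
  everything that the equation reads at one of its points. A second Eulerian solution provides the
  equation only for times up to \<open>t1\<close> and nonnegative labels.\<close>

lemma trunc_unique:
  assumes h1: "cts2 h1" "\<And>t a. 0 \<le> t \<Longrightarrow> t \<le> t1 \<Longrightarrow> 0 \<le> a \<Longrightarrow> a \<le> A \<Longrightarrow> h1 t a = prim2 (\<lambda>s. Gt h1 s a) t"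
    and h2: "cts2 h2" "\<And>t a. 0 \<le> t \<Longrightarrow> t \<le> t1 \<Longrightarrow> 0 \<le> a \<Longrightarrow> a \<le> A \<Longrightarrow> h2 t a = prim2 (\<lambda>s. Gt h2 s a) t"
    and ta: "0 \<le> t" "t \<le> t1" "0 \<le> a" "a \<le> A"
  shows "h1 t a = h2 t a"
proof -
  define D where "D = {0..t1} \<times> {0..A}"
  define d where "d = (\<lambda>(t, a). h1 t a - h2 t a)"
  define \<Lambda> where "\<Lambda> = Lip + 1"
  have \<Lambda>: "1 \<le> \<Lambda>" "Lip \<le> \<Lambda>" using Lip_nonneg by (auto simp: \<Lambda>_def)
  define w where "w = (\<lambda>(t::real, a::real). exp (2 * prim (\<lambda>_. \<Lambda>) t))"
  have pos: "0 \<le> prim (\<lambda>_. \<Lambda>) t" if "0 \<le> t" for t using \<Lambda> that by (simp add: prim_def)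
  have w1: "1 \<le> w p" if "p \<in> D" for p
    using pos[of "fst p"] that by (simp add: D_def w_def case_prod_beta' mem_Times_iff)
  have "continuous_on D d"
    unfolding d_def case_prod_beta'
    by (intro continuous_intros cts2_compose[OF h1(1)] cts2_compose[OF h2(1)])
  then have "bounded (d ` D)"
    by (intro compact_imp_bounded compact_continuous_image) (auto simp: D_def intro: compact_Times)
  then obtain C0 where "\<forall>y\<in>d ` D. norm y \<le> C0" unfolding bounded_iff by blast
  then have C0: "\<bar>d p\<bar> \<le> C0" if "p \<in> D" for p using that by simp
  have "d (t, a) = 0"
  proof (rule halving_zero[where d = d and p = "(t, a)" and D = D and C = "\<bar>C0\<bar>" and w = w])
    fix p assume p: "p \<in> D"
    show "\<bar>d p\<bar> \<le> \<bar>C0\<bar> * w p"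
      using C0[OF p] mult_left_mono[OF w1[OF p] abs_ge_zero[of C0]] by linarith
  next
    fix C p assume C: "(0::real) \<le> C" and le: "\<And>p. p \<in> D \<Longrightarrow> \<bar>d p\<bar> \<le> C * w p" and "p \<in> D"
    obtain t a where p: "p = (t, a)" by (cases p)
    with \<open>p \<in> D\<close> have ta: "0 \<le> t" "t \<le> t1" "0 \<le> a" "a \<le> A" by (auto simp: D_def)
    define F where "F = (\<lambda>s. Gt h1 s a - Gt h2 s a)"
    have c: "continuous_on UNIV F"
      unfolding F_def by (intro continuous_intros cts2_slice_left Gt_cts2 h1 h2)
    have 1: "\<bar>prim F s\<bar> \<le> C / 2 * exp (2 * prim (\<lambda>_. \<Lambda>) s)" if s: "0 \<le> s" "s \<le> t" for s
    proof (rule prim_weight_pos[OF c _ s(1) C])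
      fix r assume r: "0 \<le> r" "r \<le> s"
      have "\<bar>F r\<bar> \<le> Lip * (C * exp (2 * prim (\<lambda>_. \<Lambda>) r))"
        unfolding F_def
      proof (rule Gt_lipschitz[OF h1(1) h2(1)])
        fix b assume "b \<in> closed_segment 0 a"
        then have "(r, b) \<in> D" using r s ta by (auto simp: D_def closed_segment_eq_real_ivl)
        from le[OF this] show "\<bar>h1 r b - h2 r b\<bar> \<le> C * exp (2 * prim (\<lambda>_. \<Lambda>) r)"
          by (simp add: d_def w_def)
      qed
      also have "\<dots> \<le> \<Lambda> * (C * exp (2 * prim (\<lambda>_. \<Lambda>) r))"
        using \<Lambda>(2) C by (intro mult_right_mono) auto
      finally show "\<bar>F r\<bar> \<le> C * \<Lambda> * exp (2 * prim (\<lambda>_. \<Lambda>) r)" by (simp add: mult_ac)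
    qed simp
    have "\<bar>prim (prim F) t\<bar> \<le> C / 2 * exp (2 * prim (\<lambda>_. \<Lambda>) t)"
    proof (rule prim_weight_pos[OF prim_continuous[OF c] _ ta(1) C])
      fix s assume s: "0 \<le> s" "s \<le> t"
      have "C / 2 * exp (2 * prim (\<lambda>_. \<Lambda>) s) \<le> C * \<Lambda> * exp (2 * prim (\<lambda>_. \<Lambda>) s)"
        using mult_left_mono[OF \<Lambda>(1) C] C by (intro mult_right_mono) auto
      with 1[OF s] show "\<bar>prim F s\<bar> \<le> C * \<Lambda> * exp (2 * prim (\<lambda>_. \<Lambda>) s)" by linarith
    qed simp
    moreover have "d p = prim2 F t"
      unfolding p d_def F_def
      using h1(2)[OF ta] h2(2)[OF ta]
      by (simp add: prim2_diff cts2_slice_left Gt_cts2 h1(1) h2(1))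
    ultimately show "\<bar>d p\<bar> \<le> C / 2 * w p" by (simp add: prim2_def w_def p)
  qed (use ta in \<open>auto simp: D_def\<close>)
  then show ?thesis by (simp add: d_def)
qed

text \<open>\<open>Zt\<close> integrates in the label, so \<open>q\<close> has one derivative more
  than \<open>h\<close>; only the factor exp(-\<kappa>(h)) involves \<open>h\<close> itself.
  Differentiation therefore gives a linear Volterra equation for the label derivative, with
  coefficients of the order already known, and linear regularity closes the induction.\<close>

lemma trunc_Ck:
  assumes g: "\<And>n. Ck n (\<lambda>t. g)" and \<kappa>: "\<And>n. Ck n (\<lambda>t. \<kappa>)"
    and h: "cts2 h" "\<And>t a. h t a = prim2 (\<lambda>s. Gt h s a) t"
  shows "Ck n h"
proof (induction n)
  case (Suc n)
  define q where "q = (\<lambda>t a. g a * exp (Zt h t a))"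
  have q: "Ck (Suc n) q"
    unfolding q_def Zt_def by (intro Ck_mult g Ck_exp Ck_prim Ck_comp[OF \<kappa>] Suc)
  obtain q' where q': "\<And>t a. (q t has_real_derivative q' t a) (at a)" "Ck n q'"
    using Ck_SucD[OF q] by blast
  define e where "e = (\<lambda>x. exp (- \<kappa> x))"
  have e: "Ck n (\<lambda>t. e)" for n unfolding e_def by (intro Ck_exp Ck_minus \<kappa>)
  obtain e' where e': "\<And>t x. (e has_real_derivative e' t x) (at x)" "Ck n e'"
    using Ck_SucD[OF e] by blast
  define \<alpha> where "\<alpha> = (\<lambda>t a. q t a * e' t (h t a))"
  define \<beta> where "\<beta> = (\<lambda>t a. q' t a * e (h t a))"
  have \<alpha>: "Ck n \<alpha>" unfolding \<alpha>_def by (intro Ck_mult Ck_Suc[OF q] Ck_comp[OF e'(2)] Suc)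
  have \<beta>: "Ck n \<beta>" unfolding \<beta>_def by (intro Ck_mult q' Ck_comp[OF e] Suc)
  obtain k where k: "cts2 k" "\<And>t a. k t a = prim2 (\<lambda>s. \<alpha> s a * k s a + \<beta> s a) t"
    by (rule volterra_linear[OF Ck_cts2[OF \<alpha>] Ck_cts2[OF \<beta>]]) blast
  obtain Dq where Dq: "\<And>t a b. q t a - q t b = (a - b) * Dq t a b" "\<And>t a. Dq t a a = q' t a"
    "\<And>u v. cts2 u \<Longrightarrow> cts2 v \<Longrightarrow> cts2 (\<lambda>t a. Dq t (u t a) (v t a))"
    by (rule divided_difference[OF q'(1) Ck_cts2[OF q'(2)]]) blast
  obtain De where De: "\<And>t a b. e a - e b = (a - b) * De t a b" "\<And>t a. De t a a = e' t a"
    "\<And>u v. cts2 u \<Longrightarrow> cts2 v \<Longrightarrow> cts2 (\<lambda>t a. De t (u t a) (v t a))"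
    by (rule divided_difference[of "\<lambda>t. e", OF e'(1) Ck_cts2[OF e'(2)]]) blast
  have Q: "Gt h t a = q t a * e (h t a)" for t a by (simp add: Gt_def q_def e_def)
  show ?case
  proof (rule Ck_SucI[OF h(1) _ volterra_linear_Ck[OF \<alpha> \<beta> k]])
    fix t a0
    have h0: "cts2 (\<lambda>t a. h t a0)" by (rule cts2_comp[OF h(1) cts2_fst cts2_const])
    show "(h t has_real_derivative k t a0) (at a0)"
    proof (rule volterra_param_deriv[OF h Gt_cts2[OF h(1)], where k = "\<lambda>t. k t a0"
          and \<alpha> = "\<lambda>t a. q t a * De t (h t a) (h t a0)" and \<beta> = "\<lambda>t a. Dq t a a0 * e (h t a0)"])
      show "cts2 (\<lambda>t a. q t a * De t (h t a) (h t a0))"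
        by (intro cts2_mult De(3) h(1) h0 Ck_cts2[OF q])
      show "cts2 (\<lambda>t a. Dq t a a0 * e (h t a0))"
        by (intro cts2_mult Dq(3) cts2_snd cts2_const cts2_fun_comp[OF _ h0] cts2_slice_right[OF Ck_cts2[OF e]])
      show "Gt h s a - Gt h s a0 = q s a * De s (h s a) (h s a0) * (h s a - h s a0) + (a - a0) * (Dq s a a0 * e (h s a0))" for s a
        unfolding Q using Dq(1)[of s a a0] De(1)[of "h s a" "h s a0" s] by algebra
      show "k t a0 = prim2 (\<lambda>s. q s a0 * De s (h s a0) (h s a0) * k s a0 + Dq s a0 a0 * e (h s a0)) t" for t
        unfolding De Dq using k(2)[of t a0] by (simp add: \<alpha>_def \<beta>_def)
    qed (rule cts2_slice_left[OF k(1)])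
  qed
qed (simp add: h(1))

end

section \<open>From Lagrangian to Eulerian fields\<close>

text \<open>A chain rule from separate partial derivatives, one of them continuous, on a product
  that need not be open. It applies up to the boundary of the time and space intervals.\<close>

lemma DERIV_along_curve:
  fixes f :: "real \<Rightarrow> real \<Rightarrow> real"
  assumes ft: "((\<lambda>s. f s (\<gamma> t)) has_real_derivative ft) (at t within X)"
    and fx: "\<And>s y. s \<in> X \<Longrightarrow> y \<in> Y \<Longrightarrow> (f s has_real_derivative fx s y) (at y within Y)"
    and c: "continuous_on (X \<times> Y) (\<lambda>(s, y). fx s y)"
    and \<gamma>: "(\<gamma> has_real_derivative \<gamma>') (at t within X)" and t: "t \<in> X"
    and sub: "\<And>s. s \<in> X \<Longrightarrow> \<gamma> s \<in> Y" and Y: "convex Y"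
  shows "((\<lambda>s. f s (\<gamma> s)) has_real_derivative ft + fx t (\<gamma> t) * \<gamma>') (at t within X)"
proof -
  have f: "((\<lambda>(x, y). f x y) has_derivative (\<lambda>(tx, ty). ft * tx + blinfun_mult_right (fx t (\<gamma> t)) ty))
      (at (t, \<gamma> t) within X \<times> Y)"
  proof (rule has_derivative_partialsI[where fy = "\<lambda>x y. blinfun_mult_right (fx x y)"])
    show "((\<lambda>x. f x (\<gamma> t)) has_derivative (\<lambda>h. ft * h)) (at t within X)"
      using ft by (simp add: has_field_derivative_def)
    show "((\<lambda>y. f x y) has_derivative blinfun_apply (blinfun_mult_right (fx x y))) (at y within Y)"
      if "x \<in> X" "y \<in> Y" for x y
      using fx[OF that] by (simp add: has_field_derivative_def)
    have "continuous_on (X \<times> Y) (\<lambda>p. blinfun_mult_right ((\<lambda>(s, y). fx s y) p))"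
      by (rule bounded_linear.continuous_on[OF bounded_linear_blinfun_mult_right c])
    then show "continuous (at (t, \<gamma> t) within X \<times> Y) (\<lambda>(x, y). blinfun_mult_right (fx x y))"
      using t sub[OF t] by (simp add: continuous_on_eq_continuous_within case_prod_beta')
  qed (use t sub Y in auto)
  have "((\<lambda>s. (s, \<gamma> s)) has_derivative (\<lambda>h. (h, \<gamma>' * h))) (at t within X)"
    using \<gamma> by (intro has_derivative_Pair has_derivative_ident) (simp add: has_field_derivative_def)
  from has_derivative_in_compose[OF this has_derivative_subset[OF f]] sub
  have "((\<lambda>s. f s (\<gamma> s)) has_derivative (\<lambda>h. ft * h + fx t (\<gamma> t) * (\<gamma>' * h))) (at t within X)"
    by auto
  moreover have "(\<lambda>h. ft * h + fx t (\<gamma> t) * (\<gamma>' * h)) = (*) (ft + fx t (\<gamma> t) * \<gamma>')"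
    by (auto simp: algebra_simps)
  ultimately show ?thesis by (simp only: has_field_derivative_def)
qed

lemma Ck_freeze:
  assumes "Ck n f" shows "Ck n (\<lambda>_. f t)"
  using assms
proof (induction n arbitrary: f)
  case 0
  then show ?case by (auto intro: cts2_fun cts2_slice_right)
next
  case (Suc n)
  obtain f' where f: "cts2 f" "\<And>t a. (f t has_real_derivative f' t a) (at a)" "Ck n f'"
    using Ck_SucD[OF Suc.prems] by blast
  show ?case
    by (rule Ck_SucI[OF cts2_fun[OF cts2_slice_right[OF f(1)]] f(2) Suc.IH[OF f(3)]])
qed

text \<open>In the coordinates \<open>a = - ln y\<close> of a label \<open>y\<close> and \<open>Z = - ln X\<close> of its position \<open>X\<close>, \<open>H\<close> is the
  logarithm of the Jacobian of the flow and \<open>V = \<partial>\<^sub>t Z\<close> equals \<open>\<Omega>\<close> along trajectories. \<open>Lab\<close> maps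
  positions to labels, and \<open>Eul q\<close> is the Eulerian field with Lagrangian description \<open>q\<close>.\<close>

locale flow =
  fixes H Ht :: "real \<Rightarrow> real \<Rightarrow> real" and a0 a1 :: real
  assumes H_Ck: "\<And>n. Ck n H" and Ht_cts2: "cts2 Ht"
    and H_t: "\<And>t a. ((\<lambda>t. H t a) has_real_derivative Ht t a) (at t)"
    and H_supp: "\<And>t a. a < a0 \<or> a1 < a \<Longrightarrow> H t a = 0"
    and a01: "0 < a0" "a0 < a1"
begin

definition Z :: "real \<Rightarrow> real \<Rightarrow> real" where "Z t a = prim (\<lambda>b. exp (H t b)) a"
definition V :: "real \<Rightarrow> real \<Rightarrow> real" where "V t a = prim (\<lambda>b. Ht t b * exp (H t b)) a"
definition A :: "real \<Rightarrow> real \<Rightarrow> real" where "A t = inv (Z t)"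
definition Lab :: "real \<Rightarrow> real \<Rightarrow> real" where "Lab t x = A t (- ln x)"
definition Eul :: "(real \<Rightarrow> real \<Rightarrow> real) \<Rightarrow> real \<Rightarrow> real \<Rightarrow> real" where
  "Eul q t x = (if 0 < x then q t (Lab t x) else 0)"

definition supp :: "(real \<Rightarrow> real \<Rightarrow> real) \<Rightarrow> bool" where
  "supp q \<longleftrightarrow> (\<forall>t a. a < a0 \<or> a1 < a \<longrightarrow> q t a = 0)"

lemma H_cts2: "cts2 H" using Ck_cts2[OF H_Ck] .
lemma J_Ck: "Ck n (\<lambda>t b. exp (H t b))" by (rule Ck_exp[OF H_Ck])
lemma Z_Ck: "Ck n Z" unfolding Z_def by (rule Ck_Suc[OF Ck_prim[OF J_Ck]])
lemma Z_cts2: "cts2 Z" using Ck_cts2[OF Z_Ck] .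
lemma V_cts2: "cts2 V" unfolding V_def by (intro prim_cts2 cts2_mult cts2_exp H_cts2 Ht_cts2)

lemma Z_a: "(Z t has_real_derivative exp (H t a)) (at a)"
  unfolding Z_def by (rule prim_deriv[OF cts2_slice_right[OF cts2_exp[OF H_cts2]]])

lemma V_a: "(V t has_real_derivative Ht t a * exp (H t a)) (at a)"
  unfolding V_def by (rule prim_deriv[OF cts2_slice_right[OF cts2_mult[OF Ht_cts2 cts2_exp[OF H_cts2]]]])

lemma Z_t: "((\<lambda>t. Z t a) has_real_derivative V t a) (at t)"
  unfolding Z_def V_def
proof (rule prim_param_deriv)
  show "((\<lambda>t. exp (H t b)) has_real_derivative Ht t b * exp (H t b)) (at t)" for t b
    using DERIV_chain2[OF DERIV_exp H_t[of b t]] by (simp add: mult.commute)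
qed (intro cts2_mult cts2_exp H_cts2 Ht_cts2)+

lemma Z_0 [simp]: "Z t 0 = 0" and V_0 [simp]: "V t 0 = 0"
  by (simp_all add: Z_def V_def)

lemma Z_strict_mono: "a < b \<Longrightarrow> Z t a < Z t b"
  by (rule DERIV_pos_imp_increasing) (use Z_a in \<open>auto intro!: exI\<close>)

lemma Z_less_iff [simp]: "Z t a < Z t b \<longleftrightarrow> a < b"
  using Z_strict_mono by (metis less_asym linorder_neqE_linordered_idom)

lemma Z_le_iff [simp]: "Z t a \<le> Z t b \<longleftrightarrow> a \<le> b"
  using Z_less_iff[of t b a] by (simp only: not_less[symmetric])

lemma Z_inj: "inj (Z t)"
  by (rule injI) (metis Z_less_iff less_irrefl linorder_neqE_linordered_idom)

lemma Z_low: "a \<le> 0 \<Longrightarrow> Z t a = a"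
proof -
  assume a: "a \<le> 0"
  have "prim (\<lambda>b. exp (H t b)) a = a - 0"
    by (rule prim_FTC_segment)
       (use a a01 H_supp in \<open>auto simp: closed_segment_eq_real_ivl intro!: derivative_eq_intros\<close>)
  then show ?thesis by (simp add: Z_def)
qed

text \<open>Beyond \<open>a1\<close> the Jacobian is 1, so \<open>Z t\<close> is unbounded above;
  together with the identity on nonpositive labels this makes it onto.\<close>

lemma Z_high:
  assumes "a1 \<le> a" shows "Z t a1 + (a - a1) \<le> Z t a"
proof (cases "a = a1")
  case False
  with assms have "a1 < a" by simp
  from MVT2[OF this, of "Z t" "\<lambda>a. exp (H t a)"] Z_a
  obtain c where "a1 < c" "c < a" "Z t a - Z t a1 = (a - a1) * exp (H t c)" by blast
  then show ?thesis using H_supp[of c t] by simp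
qed simp

lemma Z_nonneg: "0 \<le> a \<Longrightarrow> 0 \<le> Z t a" using Z_le_iff[of t 0 a] by simp

lemma Z_surj: "surj (Z t)"
proof -
  have "\<exists>a. Z t a = z" for z
  proof (cases "z \<le> 0")
    case True
    then show ?thesis using Z_low[OF True] by blast
  next
    case False
    have "\<exists>a. 0 \<le> a \<and> a \<le> a1 + z \<and> Z t a = z"
    proof (rule IVT')
      show "z \<le> Z t (a1 + z)" using Z_high[of "a1 + z" t] Z_nonneg[of a1 t] a01 False by simp
      show "continuous_on {0..a1 + z} (Z t)" by (rule cts2_slice_right[OF Z_cts2])
    qed (use False a01 in auto)
    then show ?thesis by blast
  qed
  then show ?thesis by (metis surjI)
qed

section \<open>The inverse flow map and Eulerian fields\<close>

lemma Z_A [simp]: "Z t (A t z) = z" unfolding A_def by (rule surj_f_inv_f[OF Z_surj])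
lemma A_Z [simp]: "A t (Z t a) = a" unfolding A_def by (rule inv_f_f[OF Z_inj])

lemma A_less: "A t z < a \<longleftrightarrow> z < Z t a" using Z_less_iff[of t "A t z" a] by simp
lemma less_A: "a < A t z \<longleftrightarrow> Z t a < z" using Z_less_iff[of t a "A t z"] by simp

text \<open>By monotonicity of \<open>Z t\<close>, the sets where \<open>A\<close> lies strictly
  below or above a level are given by strict inequalities between \<open>z\<close> and the jointly
  continuous \<open>Z\<close>, so they are open.\<close>

lemma A_cts2: "cts2 A"
  unfolding cts2_def continuous_on_eq_continuous_at[OF open_UNIV] isCont_def
proof safe
  fix t z
  have "\<forall>\<^sub>F p in at (t, z). dist (A (fst p) (snd p)) (A t z) < e" if "0 < e" for e
  proof -
    let ?S = "{p. Z (fst p) (A t z - e) < snd p} \<inter> {p. snd p < Z (fst p) (A t z + e)}"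
    have "open ?S"
      by (intro open_Int open_Collect_less continuous_intros cts2_compose[OF Z_cts2])
    moreover have "(t, z) \<in> ?S" using that by (simp add: less_A[symmetric] A_less[symmetric])
    ultimately have "\<forall>\<^sub>F p in at (t, z). p \<in> ?S" using eventually_at_topological by blast
    then show ?thesis
      by eventually_elim (auto simp: less_A[symmetric] A_less[symmetric] dist_real_def abs_less_iff)
  qed
  then show "((\<lambda>p. A (fst p) (snd p)) \<longlongrightarrow> A (fst (t, z)) (snd (t, z))) (at (t, z))"
    by (intro tendstoI) auto
qed

lemma A_z: "(A t has_real_derivative exp (- H t (A t z))) (at z)"
proof -
  have "isCont (A t) z"
    using cts2_slice_right[OF A_cts2, of UNIV t] by (simp add: continuous_on_eq_continuous_at)
  then have "(A t has_real_derivative inverse (exp (H t (A t z)))) (at z)"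
    by (intro DERIV_inverse_function[where f = "Z t" and a = "z - 1" and b = "z + 1"] Z_a) auto
  then show ?thesis by (simp add: exp_minus)
qed

lemma A_t: "((\<lambda>t. A t z) has_real_derivative - V t (A t z) * exp (- H t (A t z))) (at t)"
proof -
  obtain D where D: "\<And>s a b. Z t a - Z t b = (a - b) * D s a b" "\<And>s a. D s a a = exp (H t a)"
    "\<And>u v. cts2 u \<Longrightarrow> cts2 v \<Longrightarrow> cts2 (\<lambda>t a. D t (u t a) (v t a))"
    by (rule divided_difference[of "\<lambda>_. Z t" "\<lambda>_ a. exp (H t a)",
          OF Z_a cts2_fun[OF cts2_slice_right[OF cts2_exp[OF H_cts2]]]]) blast
  obtain E where E: "\<And>a s r. Z s a - Z r a = (s - r) * E a s r" "\<And>a s. E a s s = V s a"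
    "\<And>u v. cts2 u \<Longrightarrow> cts2 v \<Longrightarrow> cts2 (\<lambda>a s. E a (u a s) (v a s))"
    by (rule divided_difference[of "\<lambda>a s. Z s a" "\<lambda>a s. V s a", OF Z_t cts2_swap[OF V_cts2]]) blast
  have D0: "D s a b \<noteq> 0" for s a b
  proof (cases "a = b")
    case False
    then have "Z t a \<noteq> Z t b" using Z_inj[of t] by (auto dest: injD)
    then show ?thesis using D(1)[of a b s] by auto
  qed (simp add: D(2))
  let ?q = "\<lambda>s. - E (A s z) s t / D s (A s z) (A t z)"
  have "A s z - A t z = ?q s * (s - t)" for s
    using D(1)[of "A s z" "A t z" s] E(1)[of s "A s z" t] D0[of s "A s z" "A t z"]
    by (simp add: field_simps)
  moreover have "continuous_on UNIV ?q"
  proof (intro continuous_intros ballI D0)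
    have "cts2 (\<lambda>a s. E a s t)" by (rule E(3)[OF cts2_snd cts2_const])
    then show "continuous_on UNIV (\<lambda>s. E (A s z) s t)"
      by (rule cts2_compose) (intro cts2_slice_left[OF A_cts2] continuous_on_id)+
    have "cts2 (\<lambda>s _. D s (A s z) (A t z))"
      by (intro D(3) cts2_comp[OF A_cts2 cts2_fst cts2_const] cts2_const)
    then show "continuous_on UNIV (\<lambda>s. D s (A s z) (A t z))" by (rule cts2_slice_left)
  qed
  moreover have "?q t = - V t (A t z) * exp (- H t (A t z))"
    by (simp add: D(2) E(2) exp_minus field_simps)
  ultimately show ?thesis
    unfolding CARAT_DERIV by (intro exI[of _ ?q]) (auto simp: continuous_on_eq_continuous_at)
qed

text \<open>A field whose labels stop at \<open>a1\<close> vanishes to the left of the position of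
  \<open>a1\<close>, hence near x = 0. This permits smooth extension across 0, where the coordinate
  -ln x is singular.\<close>

lemma Eul_zero: "supp q \<Longrightarrow> x < exp (- Z t a1) \<Longrightarrow> Eul q t x = 0"
proof (cases "0 < x")
  case True
  assume q: "supp q" and "x < exp (- Z t a1)"
  then have "ln x < - Z t a1" using True by (metis exp_less_cancel_iff exp_ln)
  then have "a1 < Lab t x" by (simp add: Lab_def less_A)
  with q show ?thesis by (simp add: Eul_def supp_def)
qed (simp add: Eul_def)

lemma Eul_cts2:
  assumes q: "cts2 q" "supp q" shows "cts2 (Eul q)"
proof -
  let ?U = "{p. (0::real) < snd p}" and ?W = "{p. snd p < exp (- Z (fst p) a1)}"
  have U: "open ?U" "open ?W"
    by (intro open_Collect_less continuous_intros cts2_compose[OF Z_cts2])+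
  have "continuous_on ?U (\<lambda>p. q (fst p) (A (fst p) (- ln (snd p))))"
    by (intro continuous_intros cts2_compose[OF q(1)] cts2_compose[OF A_cts2]) auto
  then have 1: "continuous_on ?U (\<lambda>p. Eul q (fst p) (snd p))"
    by (rule continuous_on_eq) (simp add: Eul_def Lab_def)
  have 2: "continuous_on ?W (\<lambda>p. Eul q (fst p) (snd p))"
    by (rule continuous_on_eq[OF continuous_on_const[of _ 0]]) (use Eul_zero[OF q(2)] in auto)
  have "?U \<union> ?W = UNIV"
    by (auto simp: not_less) (meson exp_gt_zero le_less_trans not_less)
  with continuous_on_open_Un[OF U 1 2] show ?thesis by (simp add: cts2_def)
qed

lemma Lab_x: "0 < x \<Longrightarrow> (Lab t has_real_derivative - exp (Z t (Lab t x) - H t (Lab t x))) (at x)"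
proof -
  assume x: "0 < x"
  have "((\<lambda>x. - ln x) has_real_derivative - (1 / x)) (at x)"
    using x by (auto intro!: derivative_eq_intros)
  from DERIV_chain2[OF A_z this]
  have "(Lab t has_real_derivative exp (- H t (Lab t x)) * - (1 / x)) (at x)"
    by (simp add: Lab_def[abs_def])
  moreover have "1 / x = exp (Z t (Lab t x))"
    using x by (simp add: Lab_def exp_minus inverse_eq_divide)
  ultimately show ?thesis by (simp add: exp_diff exp_minus field_simps)
qed

text \<open>In labels, d/dx is -e^(Z-H) d/da. The derivative of an Eulerian field is thus again an
  Eulerian field with label support in the same interval, and smoothness of every order follows by
  iteration.\<close>

lemma Eul_x:
  assumes "\<And>a. (q t has_real_derivative q' t a) (at a)" "supp q" "supp q'"
  shows "(Eul q t has_real_derivative Eul (\<lambda>t a. - q' t a * exp (Z t a - H t a)) t x) (at x)"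
proof (cases "0 < x")
  case True
  have "((\<lambda>x. q t (Lab t x)) has_real_derivative q' t (Lab t x) * - exp (Z t (Lab t x) - H t (Lab t x))) (at x)"
    by (rule DERIV_chain2[OF assms(1) Lab_x[OF True]])
  then have "((\<lambda>x. q t (Lab t x)) has_real_derivative Eul (\<lambda>t a. - q' t a * exp (Z t a - H t a)) t x) (at x)"
    using True by (simp add: Eul_def)
  then show ?thesis
    by (rule has_field_derivative_transform_within_open[of _ _ _ "{0<..}"])
       (use True in \<open>auto simp: Eul_def\<close>)
next
  case False
  have "((\<lambda>_. 0) has_real_derivative Eul (\<lambda>t a. - q' t a * exp (Z t a - H t a)) t x) (at x)"
    using False by (simp add: Eul_def)
  then show ?thesis
  proof (rule has_field_derivative_transform_within_open)
    show "open {..<exp (- Z t a1)}" "x \<in> {..<exp (- Z t a1)}"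
      using False by (auto intro: le_less_trans[of x 0])
  qed (use Eul_zero[OF assms(2)] in auto)
qed

lemma supp_deriv:
  assumes "\<And>t a. (q t has_real_derivative q' t a) (at a)" "supp q"
  shows "supp q'"
  unfolding supp_def
proof (intro allI impI)
  fix t a assume a: "a < a0 \<or> a1 < a"
  show "q' t a = 0"
    by (rule DERIV_zero_open[OF assms(1), of "{..<a0} \<union> {a1<..}"]) (use a assms(2) in \<open>auto simp: supp_def\<close>)
qed

lemma Eul_Ck: "Ck n q \<Longrightarrow> supp q \<Longrightarrow> Ck n (Eul q)"
proof (induction n arbitrary: q)
  case 0
  then show ?case by (simp add: Eul_cts2)
next
  case (Suc n)
  obtain q' where q: "cts2 q" "\<And>t a. (q t has_real_derivative q' t a) (at a)" "Ck n q'"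
    using Ck_SucD[OF Suc.prems(1)] by blast
  note s = supp_deriv[OF q(2) Suc.prems(2)]
  have "Ck n (\<lambda>t a. - q' t a * exp (Z t a - H t a))"
    by (intro Ck_mult Ck_minus q Ck_exp Ck_diff Z_Ck H_Ck)
  moreover have "supp (\<lambda>t a. - q' t a * exp (Z t a - H t a))" using s by (simp add: supp_def)
  ultimately have "Ck n (Eul (\<lambda>t a. - q' t a * exp (Z t a - H t a)))" by (rule Suc.IH)
  then show ?case
    by (rule Ck_SucI[rotated 2]) (intro Eul_cts2 Eul_x q s Suc.prems(2))+
qed

text \<open>At a fixed position the label drifts with speed -V e^(-H), which produces the second
  term.\<close>

lemma Eul_t:
  assumes qt: "\<And>t a. ((\<lambda>t. q t a) has_real_derivative qt t a) (at t)"
    and qa: "\<And>t a. (q t has_real_derivative qa t a) (at a)" "cts2 qa"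
  shows "((\<lambda>t. Eul q t x) has_real_derivative Eul (\<lambda>t a. qt t a - qa t a * V t a * exp (- H t a)) t x) (at t)"
proof (cases "0 < x")
  case True
  have "((\<lambda>s. q s (Lab s x)) has_real_derivative
      qt t (Lab t x) + qa t (Lab t x) * (- V t (Lab t x) * exp (- H t (Lab t x)))) (at t within UNIV)"
  proof (rule DERIV_along_curve[where Y = UNIV and f = q and fx = qa and \<gamma> = "\<lambda>s. Lab s x"])
    show "continuous_on (UNIV \<times> UNIV) (\<lambda>(s, y). qa s y)"
      using qa(2) by (simp add: cts2_def case_prod_beta')
    show "((\<lambda>s. Lab s x) has_real_derivative - V t (Lab t x) * exp (- H t (Lab t x))) (at t)"
      unfolding Lab_def by (rule A_t)
  qed (use qt qa in auto)
  then show ?thesis using True by (simp add: Eul_def algebra_simps)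
qed (simp add: Eul_def)

lemma Eul_flow [simp]: "Eul q t (exp (- Z t a)) = q t a"
  by (simp add: Eul_def Lab_def)

lemma Lab_1 [simp]: "Lab t 1 = 0"
  using A_Z[of t 0] by (simp add: Lab_def)

lemma Ht_supp: "supp Ht"
  unfolding supp_def
proof (intro allI impI)
  fix t a assume "a < a0 \<or> a1 < a"
  then have "(\<lambda>t. H t a) = (\<lambda>_. 0)" using H_supp by auto
  then have "((\<lambda>t. H t a) has_real_derivative 0) (at t)" by simp
  then show "Ht t a = 0" using DERIV_unique[OF H_t] by blast
qed

text \<open>An exact primitive is available: the integrand is the derivative of
  \<open>- V t (Lab t y)\<close>, and the label of y = 1 is 0, where \<open>V\<close> vanishes. This
  ties the velocity law of the system to the flow.\<close>

lemma Omega_Eul: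
  assumes x: "0 < x" "x \<le> 1"
  shows "(LINT y:{x..1}|lebesgue. Eul Ht t y / y) = V t (Lab t x)"
proof -
  have d: "((\<lambda>y. - V t (Lab t y)) has_real_derivative Eul Ht t y / y) (at y within {x..1})"
    if "y \<in> {x..1}" for y
  proof -
    have y: "0 < y" using that x by auto
    have "((\<lambda>y. V t (Lab t y)) has_real_derivative
       Ht t (Lab t y) * exp (H t (Lab t y)) * - exp (Z t (Lab t y) - H t (Lab t y))) (at y)"
      by (rule DERIV_chain2[OF V_a Lab_x[OF y]])
    from DERIV_minus[OF this]
    have "((\<lambda>y. - V t (Lab t y)) has_real_derivative Ht t (Lab t y) * exp (Z t (Lab t y))) (at y)"
      by (simp add: exp_diff)
    moreover have "exp (Z t (Lab t y)) = 1 / y"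
      using y by (simp add: Lab_def exp_minus inverse_eq_divide)
    ultimately show ?thesis
      using y by (auto simp: Eul_def intro: has_field_derivative_at_within)
  qed
  have "((\<lambda>y. Eul Ht t y / y) has_integral (- V t (Lab t 1) - - V t (Lab t x))) {x..1}"
    by (rule fundamental_theorem_of_calculus[OF x(2)])
       (use d in \<open>auto simp: has_real_derivative_iff_has_vector_derivative\<close>)
  moreover have "continuous_on {x..1} (\<lambda>y. Eul Ht t y / y)"
    using x by (intro continuous_intros cts2_slice_right[OF Eul_cts2[OF Ht_cts2 Ht_supp]]) auto
  then have "set_integrable lebesgue {x..1} (\<lambda>y. Eul Ht t y / y)"
    by (rule absolutely_integrable_continuous_real)
  ultimately show ?thesis
    by (simp add: set_lebesgue_integral_eq_integral(2) integral_unique)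
qed

lemma Eul_C0_infty:
  assumes "\<And>n. Ck n q" "supp q"
  shows "Eul q t \<in> C0_infty"
proof (rule C0_inftyI[of _ "exp (- Z t a1)" "exp (- Z t a0)"])
  show "Ck n (\<lambda>_. Eul q t)" for n by (rule Ck_freeze[OF Eul_Ck[OF assms]])
  show "exp (- Z t a0) < 1" using Z_less_iff[of t 0 a0] a01 by simp
  fix x assume nz: "Eul q t x \<noteq> 0"
  from nz have x: "0 < x" "\<not> x < exp (- Z t a1)"
    using Eul_zero[OF assms(2), of x t] by (simp add: Eul_def split: if_splits, blast)
  have "\<not> Lab t x < a0" using nz assms(2) by (auto simp: Eul_def supp_def split: if_splits)
  then have "Z t a0 \<le> - ln x" by (simp add: Lab_def A_less)
  then have "ln x \<le> - Z t a0" by simp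
  then have "x \<le> exp (- Z t a0)" using x by (metis exp_le_cancel_iff exp_ln)
  with x show "exp (- Z t a1) \<le> x \<and> x \<le> exp (- Z t a0)" by simp
qed simp

end

section \<open>Finite-time blow-up of the Lagrangian equation\<close>

lemma prim2_cong:
  assumes "\<And>s. s \<in> closed_segment 0 t \<Longrightarrow> f s = g s"
  shows "prim2 f t = prim2 g t"
  unfolding prim2_def
proof (rule prim_cong)
  fix s assume "s \<in> closed_segment 0 t"
  then have "closed_segment 0 s \<subseteq> closed_segment 0 t"
    by (simp add: subset_closed_segment)
  then show "prim f s = prim g s" by (intro prim_cong assms) auto
qed

lemma Ck_has_deriv:
  assumes "Ck (Suc n) f" shows "(f t has_real_derivative deriv (f t) a) (at a)"
proof -
  obtain f' where "\<And>t a. (f t has_real_derivative f' t a) (at a)"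
    using Ck_SucD[OF assms] by blast
  then have "(f t has_real_derivative f' t a) (at a)" .
  with DERIV_imp_deriv[OF this] show ?thesis by simp
qed

lemma prim2_zero [simp]: "prim2 (\<lambda>_. 0) t = 0"
  by (simp add: prim2_def prim_def)

section \<open>Levels of truncation and their agreement\<close>

definition cutoff :: "real \<Rightarrow> real \<Rightarrow> real" where
  "cutoff N = (SOME \<kappa>. \<exists>B L. (\<forall>n. Ck n (\<lambda>t. \<kappa>)) \<and> (\<forall>x. \<bar>x\<bar> \<le> N + 1 \<longrightarrow> \<kappa> x = x) \<and>
     (\<forall>x. \<bar>\<kappa> x\<bar> \<le> B) \<and> (\<forall>x y. \<bar>\<kappa> x - \<kappa> y\<bar> \<le> L * \<bar>x - y\<bar>))"

lemma
  shows cutoff_Ck: "Ck n (\<lambda>t. cutoff N)" and cutoff_id: "\<bar>x\<bar> \<le> N + 1 \<Longrightarrow> cutoff N x = x"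
    and cutoff_bounds: "\<exists>B L. (\<forall>x. \<bar>cutoff N x\<bar> \<le> B) \<and> (\<forall>x y. \<bar>cutoff N x - cutoff N y\<bar> \<le> L * \<bar>x - y\<bar>)"
proof -
  have *: "\<exists>B L. (\<forall>n. Ck n (\<lambda>t. cutoff N)) \<and> (\<forall>x. \<bar>x\<bar> \<le> N + 1 \<longrightarrow> cutoff N x = x) \<and>
     (\<forall>x. \<bar>cutoff N x\<bar> \<le> B) \<and> (\<forall>x y. \<bar>cutoff N x - cutoff N y\<bar> \<le> L * \<bar>x - y\<bar>)"
    unfolding cutoff_def by (rule someI_ex[OF cutoff_exists])
  from * show "Ck n (\<lambda>t. cutoff N)" by (elim exE conjE) (rule spec)
  from * show "cutoff N x = x" if "\<bar>x\<bar> \<le> N + 1" using that by (elim exE conjE) simp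
  from * show "\<exists>B L. (\<forall>x. \<bar>cutoff N x\<bar> \<le> B) \<and> (\<forall>x y. \<bar>cutoff N x - cutoff N y\<bar> \<le> L * \<bar>x - y\<bar>)"
    by (elim exE conjE) (intro exI conjI)
qed

lemma cutoff_cont: "continuous_on UNIV (cutoff N)"
  using cts2_slice_right[OF Ck_cts2[OF cutoff_Ck[of 0 N]]] .

lemma cutoff_deriv: "(cutoff N has_real_derivative deriv (cutoff N) x) (at x)"
  by (rule Ck_has_deriv[OF cutoff_Ck])

lemma cutoff_deriv_cont: "continuous_on UNIV (deriv (cutoff N))"
  using cts2_slice_right[OF Ck_cts2[OF Ck_deriv[OF cutoff_Ck[of "Suc 0" N] cutoff_deriv]]] .

lemma cutoff_deriv_1: "\<bar>x\<bar> < N + 1 \<Longrightarrow> deriv (cutoff N) x = 1"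
proof (rule DERIV_imp_deriv)
  assume x: "\<bar>x\<bar> < N + 1"
  show "(cutoff N has_real_derivative 1) (at x)"
  proof (rule has_field_derivative_transform_within_open[OF DERIV_ident])
    show "open {-(N+1)<..<N+1}" "x \<in> {-(N+1)<..<N+1}" using x by auto
  qed (auto simp: cutoff_id)
qed

locale data =
  fixes r :: "real \<Rightarrow> real" and a0 a1 :: real
  assumes r_Ck: "\<And>n. Ck n (\<lambda>t. r)" and r_supp: "\<And>a. a < a0 \<or> a1 < a \<Longrightarrow> r a = 0"
    and a01: "0 < a0" "a0 < a1"
begin

definition g :: "real \<Rightarrow> real" where "g a = - deriv r a"

lemma r_deriv: "(r has_real_derivative - g a) (at a)"
  using Ck_has_deriv[OF r_Ck, of a] by (simp add: g_def)

lemma g_Ck: "Ck n (\<lambda>t. g)"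
  using Ck_minus[OF Ck_deriv[OF r_Ck[of "Suc n"] r_deriv]] by simp

lemma g_cont: "continuous_on UNIV g"
  using cts2_slice_right[OF Ck_cts2[OF g_Ck[of 0]]] .

lemma g_supp: "a < a0 \<or> a1 < a \<Longrightarrow> g a = 0"
  using DERIV_zero_open[OF r_deriv, of "{..<a0} \<union> {a1<..}"] r_supp
  by (auto simp: open_Un)

abbreviation Gt :: "nat \<Rightarrow> (real \<Rightarrow> real \<Rightarrow> real) \<Rightarrow> real \<Rightarrow> real \<Rightarrow> real" where
  "Gt N \<equiv> truncated.Gt g (cutoff (real N))"

lemma truncated_ex: "\<exists>R Gm B L. truncated g (cutoff N) R Gm B L"
proof -
  obtain B L where BL: "\<forall>x. \<bar>cutoff N x\<bar> \<le> B" "\<forall>x y. \<bar>cutoff N x - cutoff N y\<bar> \<le> L * \<bar>x - y\<bar>"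
    using cutoff_bounds by blast
  have s: "g x = 0" if "a1 < \<bar>x\<bar>" for x using that g_supp[of x] a01 by fastforce
  obtain Gm where "\<forall>x. \<bar>g x\<bar> \<le> Gm" using bounded_compact_support[OF g_cont s] by blast
  then have "truncated g (cutoff N) a1 Gm B L"
    using BL s a01 by unfold_locales (auto simp: g_cont cutoff_cont)
  then show ?thesis by blast
qed

definition h :: "nat \<Rightarrow> real \<Rightarrow> real \<Rightarrow> real" where
  "h N = (SOME h. cts2 h \<and> (\<forall>t a. h t a = prim2 (\<lambda>s. Gt N h s a) t))"

lemma
  shows Gt_cts2: "cts2 f \<Longrightarrow> cts2 (Gt N f)"
    and Gt_eq: "Gt N f t a = g a * exp (prim (\<lambda>b. exp (cutoff N (f t b))) a) * exp (- cutoff N (f t a))"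
    and h_cts2: "cts2 (h N)"
    and h_eq: "h N t a = prim2 (\<lambda>s. Gt N (h N) s a) t"
    and h_Ck: "Ck n (h N)"
    and h_unique: "cts2 f \<Longrightarrow> (\<And>t a. 0 \<le> t \<Longrightarrow> t \<le> t1 \<Longrightarrow> 0 \<le> a \<Longrightarrow> a \<le> A \<Longrightarrow> f t a = prim2 (\<lambda>s. Gt N f s a) t) \<Longrightarrow>
      0 \<le> t \<Longrightarrow> t \<le> t1 \<Longrightarrow> 0 \<le> a \<Longrightarrow> a \<le> A \<Longrightarrow> f t a = h N t a"
proof -
  obtain R Gm B L where "truncated g (cutoff N) R Gm B L" using truncated_ex by blast
  then interpret T: truncated g "cutoff N" R Gm B L .
  show "cts2 f \<Longrightarrow> cts2 (Gt N f)" by (rule T.Gt_cts2)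
  show "Gt N f t a = g a * exp (prim (\<lambda>b. exp (cutoff N (f t b))) a) * exp (- cutoff N (f t a))"
    by (simp add: T.Gt_def T.Zt_def)
  obtain f where f: "cts2 f" "\<And>t a. f t a = prim2 (\<lambda>s. Gt N f s a) t"
    by (rule T.trunc_exists) blast
  have *: "cts2 (h N) \<and> (\<forall>t a. h N t a = prim2 (\<lambda>s. Gt N (h N) s a) t)"
    unfolding h_def by (rule someI[of _ f]) (use f in blast)
  then have h: "cts2 (h N)" "h N t a = prim2 (\<lambda>s. Gt N (h N) s a) t" for t a by blast+
  show "cts2 (h N)" "h N t a = prim2 (\<lambda>s. Gt N (h N) s a) t" by (rule h)+
  show "Ck n (h N)" by (rule T.trunc_Ck[OF g_Ck cutoff_Ck h])
  show "f t a = h N t a" if f: "cts2 f"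
    "\<And>t a. 0 \<le> t \<Longrightarrow> t \<le> t1 \<Longrightarrow> 0 \<le> a \<Longrightarrow> a \<le> A \<Longrightarrow> f t a = prim2 (\<lambda>s. Gt N f s a) t"
    and "0 \<le> t" "t \<le> t1" "0 \<le> a" "a \<le> A" for f
    by (rule T.trunc_unique[OF f h that(3-)])
qed

lemma Gt_Ck: "Ck n (Gt N (h N))"
  unfolding Gt_eq[abs_def]
  by (intro Ck_mult g_Ck Ck_exp Ck_minus Ck_Suc[OF Ck_prim] Ck_comp[OF cutoff_Ck h_Ck])

lemma Gt_untruncated:
  assumes "\<And>b. \<bar>f t b\<bar> \<le> N"
  shows "Gt N f t a = g a * exp (prim (\<lambda>b. exp (f t b)) a) * exp (- f t a)"
proof -
  have "cutoff N (f t b) = f t b" for b using assms[of b] by (intro cutoff_id) simp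
  then show ?thesis by (simp add: Gt_eq)
qed

lemma h_supp: "a < a0 \<or> a1 < a \<Longrightarrow> h N t a = 0"
  by (subst h_eq) (simp add: Gt_eq g_supp)

text \<open>The vorticity carried by the label \<open>a\<close>, which is the time derivative of
  \<open>h N t a\<close>.\<close>

definition w :: "nat \<Rightarrow> real \<Rightarrow> real \<Rightarrow> real" where
  "w N t a = prim (\<lambda>s. Gt N (h N) s a) t"

lemma w_Ck: "Ck n (w N)"
  using Ck_prim_time[OF Gt_Ck] by (simp add: w_def[abs_def])

lemma w_cts2: "cts2 (w N)" using Ck_cts2[OF w_Ck] .

lemma w_supp: "a < a0 \<or> a1 < a \<Longrightarrow> w N t a = 0"
  by (simp add: w_def Gt_eq g_supp)

lemma h_t: "((\<lambda>t. h N t a) has_real_derivative w N t a) (at t)"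
proof -
  have "continuous_on UNIV (prim (\<lambda>s. Gt N (h N) s a))"
    by (intro prim_continuous cts2_slice_left Gt_cts2 h_cts2)
  from prim_deriv[OF this] show ?thesis
    unfolding w_def by (subst h_eq) (simp add: prim2_def[abs_def])
qed

lemma w_t: "((\<lambda>t. w N t a) has_real_derivative Gt N (h N) t a) (at t)"
  unfolding w_def by (intro prim_deriv cts2_slice_left Gt_cts2 h_cts2)

lemma h_0 [simp]: "h N 0 a = 0" and w_0 [simp]: "w N 0 a = 0"
  by (subst h_eq) (simp_all add: prim2_def w_def)

text \<open>As long as this holds the cutoff, which is the identity up to \<open>N + 1\<close>, has
  not acted, so \<open>h N\<close> solves the untruncated equation up to time
  \<open>t\<close>.\<close>

definition good :: "nat \<Rightarrow> real \<Rightarrow> bool" where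
  "good N t \<longleftrightarrow> 0 \<le> t \<and> (\<forall>s\<in>{0..t}. \<forall>a. \<bar>h N s a\<bar> \<le> real N)"

lemma goodD: "good N t \<Longrightarrow> 0 \<le> s \<Longrightarrow> s \<le> t \<Longrightarrow> \<bar>h N s a\<bar> \<le> real N"
  by (auto simp: good_def)

lemma good_mono: "good N t \<Longrightarrow> 0 \<le> s \<Longrightarrow> s \<le> t \<Longrightarrow> good N s"
  by (auto simp: good_def)

lemma good_0: "good N 0"
  by (simp add: good_def)

lemma Gt_good: "good N t \<Longrightarrow> 0 \<le> s \<Longrightarrow> s \<le> t \<Longrightarrow>
   Gt N (h N) s a = g a * exp (prim (\<lambda>b. exp (h N s b)) a) * exp (- h N s a)"
  by (rule Gt_untruncated) (rule goodD)

text \<open>An uncut solution of level \<open>M\<close> that is bounded by \<open>N\<close> also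
  solves the equation of level \<open>N\<close>, so uniqueness for the truncated problem identifies
  the two. At negative labels both vanish.\<close>

lemma h_consistent:
  assumes M: "good M t" and N: "\<And>s a. 0 \<le> s \<Longrightarrow> s \<le> t \<Longrightarrow> \<bar>h M s a\<bar> \<le> real N"
    and s: "0 \<le> s" "s \<le> t"
  shows "h N s a = h M s a" "w N s a = w M s a"
proof -
  have eqG: "Gt N (h M) s a = Gt M (h M) s a" if "0 \<le> s" "s \<le> t" for s a
    using Gt_good[OF M that] Gt_untruncated[of "h M" s N, OF N[OF that]] by simp
  have hh: "h N s a = h M s a" if "0 \<le> s" "s \<le> t" for s a
  proof (cases "0 \<le> a")
    case True
    have "h M s a = h N s a"
    proof (rule h_unique[OF h_cts2])
      fix q b assume q: "0 \<le> q" "q \<le> t"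
      show "h M q b = prim2 (\<lambda>s. Gt N (h M) s b) q"
        by (subst h_eq, rule prim2_cong) (use q in \<open>auto simp: closed_segment_eq_real_ivl eqG\<close>)
    qed (use that True in auto)
    then show ?thesis by simp
  next
    case False
    then show ?thesis using h_supp a01 by simp
  qed
  then show "h N s a = h M s a" using s by blast
  have "Gt N (h N) q a = Gt M (h M) q a" if "0 \<le> q" "q \<le> t" for q
    unfolding eqG[OF that, symmetric] by (simp add: Gt_eq hh[OF that])
  then show "w N s a = w M s a"
    unfolding w_def using s by (intro prim_cong) (auto simp: closed_segment_eq_real_ivl)
qed

lemma good_le: "good M t \<Longrightarrow> M \<le> N \<Longrightarrow> good N t"
proof -
  assume M: "good M t" and MN: "M \<le> N"
  have le: "\<bar>h M s a\<bar> \<le> real N" if "0 \<le> s" "s \<le> t" for s a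
    using goodD[OF M that, of a] MN by linarith
  show ?thesis unfolding good_def
    using h_consistent(1)[OF M le] le M by (auto simp: good_def)
qed

lemma good_agree:
  assumes "good M t" "good N t" "0 \<le> s" "s \<le> t"
  shows "h N s a = h M s a" "w N s a = w M s a"
proof -
  have "h N s a = h M s a \<and> w N s a = w M s a" if MN: "M \<le> N" "good M t" for M N
  proof -
    have le: "\<bar>h M s a\<bar> \<le> real N" if "0 \<le> s" "s \<le> t" for s a
      using goodD[OF MN(2) that, of a] MN(1) by linarith
    show ?thesis using h_consistent[OF MN(2) le assms(3,4)] by blast
  qed
  from this[of M N] this[of N M] assms(1,2) show "h N s a = h M s a" "w N s a = w M s a"
    by (metis nle_le)+
qed

text \<open>\<open>h\<close> lives on the compact label range from \<open>a0\<close> to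
  \<open>a1\<close>, so uniform continuity gives a time step during which it changes by less than 1
  at every label; raising the level by one pays for that.\<close>

lemma good_extend:
  assumes "good N t" shows "\<exists>t'>t. good (Suc N) t'"
proof -
  note S = good_le[OF assms le_SucI[OF order_refl]]
  let ?K = "{t..t+1} \<times> {a0..a1}"
  have "uniformly_continuous_on ?K (\<lambda>p. h (Suc N) (fst p) (snd p))"
    by (intro compact_uniformly_continuous compact_Times compact_Icc cts2_compose[OF h_cts2] continuous_intros)
  then obtain d where d: "0 < d" "\<And>p p'. p \<in> ?K \<Longrightarrow> p' \<in> ?K \<Longrightarrow> dist p' p < d \<Longrightarrow>
      dist (h (Suc N) (fst p') (snd p')) (h (Suc N) (fst p) (snd p)) < 1"
    unfolding uniformly_continuous_on_def using zero_less_one by blast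
  define t' where "t' = t + min (d / 2) 1"
  have t': "t < t'" "t' \<le> t + 1" "t' < t + d" using d(1) by (auto simp: t'_def min_def)
  have "\<bar>h (Suc N) s a\<bar> \<le> real (Suc N)" if s: "0 \<le> s" "s \<le> t'" for s a
  proof (cases "s \<le> t")
    case True
    then show ?thesis using goodD[OF S s(1)] by simp
  next
    case False
    show ?thesis
    proof (cases "a < a0 \<or> a1 < a")
      case True
      then show ?thesis using h_supp by simp
    next
      case a: False
      have "dist (h (Suc N) (fst (s, a)) (snd (s, a))) (h (Suc N) (fst (t, a)) (snd (t, a))) < 1"
        by (rule d(2)) (use a False s t' in \<open>auto simp: dist_prod_def dist_real_def\<close>)
      moreover have "\<bar>h (Suc N) t a\<bar> \<le> real N"
      proof -
        have "0 \<le> t" using assms by (simp add: good_def)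
        then show ?thesis using good_agree(1)[OF assms S, of t a] goodD[OF assms, of t a] by simp
      qed
      ultimately show ?thesis by (auto simp: dist_real_def)
    qed
  qed
  then have "good (Suc N) t'" using t' assms by (auto simp: good_def)
  with t' show ?thesis by blast
qed

section \<open>Forced growth of the flow\<close>

lemma prim_lower:
  assumes f: "continuous_on UNIV f" and xy: "0 \<le> y" "y < x"
    and "\<And>s. 0 \<le> s \<Longrightarrow> s \<le> x \<Longrightarrow> 0 \<le> f s" "\<And>s. y \<le> s \<Longrightarrow> s \<le> x \<Longrightarrow> m \<le> f s"
  shows "m * (x - y) \<le> prim f x"
proof -
  obtain z where z: "y < z" "z < x" "prim f x - prim f y = (x - y) * f z"
    using MVT2[OF xy(2), of "prim f" f] prim_deriv[OF f] by blast
  have "m * (x - y) \<le> f z * (x - y)" using z xy assms(5)[of z] by (intro mult_right_mono) auto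
  moreover have "0 \<le> prim f y" using xy assms(4) by (intro prim_nonneg[OF f]) auto
  ultimately show ?thesis using z(3) by (simp add: mult.commute)
qed

text \<open>Applied with exponent 0 and then 1, this turns a constant lower bound for the second
  time derivative of Z into a quadratic one for Z.\<close>

lemma growth:
  fixes f f' :: "real \<Rightarrow> real"
  assumes "\<And>s. u \<le> s \<Longrightarrow> s \<le> T \<Longrightarrow> (f has_real_derivative f' s) (at s)"
    and "\<And>s. u \<le> s \<Longrightarrow> s \<le> T \<Longrightarrow> c * (s - u) ^ k \<le> f' s" and "0 \<le> f u" and t: "u \<le> t" "t \<le> T"
  shows "c / real (Suc k) * (t - u) ^ Suc k \<le> f t"
proof -
  let ?\<phi> = "\<lambda>s. f s - c / real (Suc k) * (s - u) ^ Suc k"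
  have "?\<phi> u \<le> ?\<phi> t"
  proof (rule DERIV_nonneg_imp_nondecreasing[OF t(1)])
    fix s assume s: "u \<le> s" "s \<le> t"
    have "((\<lambda>s. (s - u) ^ Suc k) has_real_derivative real (Suc k) * (s - u) ^ k) (at s)"
      by (rule DERIV_cong[OF DERIV_power[OF DERIV_diff[OF DERIV_ident DERIV_const]]]) simp
    from DERIV_diff[OF assms(1) DERIV_cmult[OF this, of "c / real (Suc k)"]] s t
    have "(?\<phi> has_real_derivative f' s - c * (s - u) ^ k) (at s)"
      by (simp del: of_nat_Suc power_Suc)
    then show "\<exists>y. (?\<phi> has_real_derivative y) (at s) \<and> 0 \<le> y"
      using assms(2)[of s] s t by (intro exI conjI) auto
  qed
  then show ?thesis using assms(3) by simp
qed

text \<open>Dropping the square in \<open>Z'' = \<integral> (g e\<^sup>Z + w\<^sup>2 e\<^sup>h)\<close> leaves a differential inequality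
  in which the value of \<open>Z\<close> at one label drives \<open>Z\<close> at all larger labels exponentially; along
  labels and times that converge geometrically this pushes \<open>Z\<close> to infinity by time 2.\<close>

lemma not_good_2:
  assumes b: "0 \<le> b0" and g_ge: "\<And>a. b0 \<le> a \<Longrightarrow> a \<le> b0 + 1/2 \<Longrightarrow> 32 \<le> g a"
    and g_nonneg: "\<And>a. 0 \<le> a \<Longrightarrow> a \<le> b0 + 1/2 \<Longrightarrow> 0 \<le> g a"
  shows "\<not> good N 2"
proof
  assume good: "good N 2"
  define Z where "Z = (\<lambda>t a. prim (\<lambda>b. exp (h N t b)) a)"
  define V where "V = (\<lambda>t a. prim (\<lambda>b. w N t b * exp (h N t b)) a)"
  \<comment> \<open>The time derivative of w e^h, so that \<open>prim (F t) a\<close> is the second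
    time derivative of \<open>Z t a\<close>.\<close>
  define F where "F = (\<lambda>t b. Gt N (h N) t b * exp (h N t b) + (w N t b * exp (h N t b)) * w N t b)"
  note cts = h_cts2[of N] w_cts2[of N] Gt_cts2[OF h_cts2, of N N]
  have F_cts2: "cts2 F" unfolding F_def by (intro cts2_add cts2_mult cts2_exp cts)
  have eh: "((\<lambda>t. exp (h N t b)) has_real_derivative w N t b * exp (h N t b)) (at t)" for t b
    using DERIV_chain2[OF DERIV_exp h_t[of N b t]] by (simp add: mult.commute)
  have Zt: "((\<lambda>t. Z t a) has_real_derivative V t a) (at t)" for t a
    unfolding Z_def V_def by (rule prim_param_deriv[OF eh]) (intro cts2_mult cts2_exp cts)+
  have Vt: "((\<lambda>t. V t a) has_real_derivative prim (F t) a) (at t)" for t a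
    unfolding V_def
  proof (rule prim_param_deriv[OF _ _ F_cts2])
    show "((\<lambda>t. w N t b * exp (h N t b)) has_real_derivative F t b) (at t)" for t b
      using DERIV_mult[OF w_t[of N b t] eh[of b t]] by (simp add: F_def)
  qed (intro cts2_mult cts2_exp cts)
  have Z_cts: "continuous_on UNIV (Z t)" for t
    unfolding Z_def by (intro prim_continuous cts2_slice_right[OF cts2_exp[OF cts(1)]])
  have Z0: "0 \<le> Z t a" if "0 \<le> a" for t a
    unfolding Z_def using that by (intro prim_nonneg cts2_slice_right[OF cts2_exp[OF cts(1)]]) auto
  have Zmono: "Z t a \<le> Z t b" if "a \<le> b" for t a b
  proof (rule DERIV_nonneg_imp_nondecreasing[OF that])
    fix x
    have "(Z t has_real_derivative exp (h N t x)) (at x)"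
      unfolding Z_def by (rule prim_deriv[OF cts2_slice_right[OF cts2_exp[OF cts(1)]]])
    then show "\<exists>y. (Z t has_real_derivative y) (at x) \<and> 0 \<le> y" by force
  qed
  have gF: "g b * exp (Z t b) \<le> F t b" if "0 \<le> t" "t \<le> 2" for t b
  proof -
    have "Gt N (h N) t b * exp (h N t b) = g b * exp (Z t b)"
      unfolding Gt_good[OF good that] Z_def by (simp add: exp_minus)
    then show ?thesis by (simp add: F_def mult.assoc) (simp add: mult.left_commute[of "w N t b"])
  qed
  have F0: "0 \<le> F t b" if "0 \<le> t" "t \<le> 2" "0 \<le> b" "b \<le> b0 + 1/2" for t b
    using gF[OF that(1,2), of b] g_nonneg[OF that(3,4)] by (meson exp_ge_zero mult_nonneg_nonneg order_trans)
  \<comment> \<open>The label gaps are 2^(-n)/4 and sum to 1/2; the time gaps are 2^(-n) and sum to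
    2. All labels thus stay where g is at least 32, and all times stay below 2.\<close>
  define a where "a = (\<lambda>n. b0 + 1/2 * (1 - (1/2)^n))"
  define \<tau> where "\<tau> = (\<lambda>n. 2 * (1 - (1/2::real)^n))"
  have pw: "0 < (1/2::real)^n" "(1/2::real)^n \<le> 1" for n by (auto simp: power_le_one)
  have a: "b0 \<le> a n" "a n \<le> b0 + 1/2" "0 \<le> a n" "a (Suc n) - a n = (1/2)^n / 4" "a n < a (Suc n)" for n
    using pw[of n] b by (simp_all add: a_def diff_divide_distrib)
  have \<tau>: "0 \<le> \<tau> n" "\<tau> n \<le> 2" "\<tau> (Suc n) = \<tau> n + (1/2)^n" for n
    using pw[of n] by (auto simp: \<tau>_def field_simps)
  have V0: "0 \<le> V t x" if t: "0 \<le> t" "t \<le> 2" and x: "0 \<le> x" "x \<le> b0 + 1/2" for t x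
  proof -
    have "V 0 x \<le> V t x"
    proof (rule DERIV_nonneg_imp_nondecreasing[OF t(1)])
      fix s assume "0 \<le> s" "s \<le> t"
      then have "0 \<le> prim (F s) x"
        using t x F0[of s] by (intro prim_nonneg cts2_slice_right[OF F_cts2]) auto
      then show "\<exists>y. ((\<lambda>t. V t x) has_real_derivative y) (at s) \<and> 0 \<le> y" using Vt by blast
    qed
    then show ?thesis by (simp add: V_def)
  qed
  have key: "\<forall>t. \<tau> n \<le> t \<and> t \<le> 2 \<longrightarrow> 4 * real n \<le> Z t (a n)" for n
  proof (induction n)
    case 0
    then show ?case using Z0 a by simp
  next
    case (Suc n)
    \<comment> \<open>\<open>F\<close> is at least 32 e^(4n) between the two labels, so
      \<open>c\<close> bounds the second time derivative of \<open>Z\<close> at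
      \<open>a (Suc n)\<close> from below. Two integrations over a time step 2^(-n) give 4
      (e^4/8)^n; the threshold 32 makes the leading factor 4, and e^4 \<ge> 16 yields at least 4 *
      2^n \<ge> 4 (n + 1).\<close>
    define c where "c = 32 * exp (4 * real n) * (a (Suc n) - a n)"
    have Fn: "c \<le> prim (F s) (a (Suc n))" if s: "\<tau> n \<le> s" "s \<le> 2" for s
      unfolding c_def
    proof (rule prim_lower[OF cts2_slice_right[OF F_cts2] a(3) a(5)])
      have s0: "0 \<le> s" using s \<tau>(1)[of n] by linarith
      show "0 \<le> F s q" if "0 \<le> q" "q \<le> a (Suc n)" for q
        using F0[OF s0 s(2) that(1)] that a(2)[of "Suc n"] by linarith
      show "32 * exp (4 * real n) \<le> F s q" if q: "a n \<le> q" "q \<le> a (Suc n)" for q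
      proof -
        have "4 * real n \<le> Z s q" using Suc[rule_format, of s] s Zmono[OF q(1), of s] by linarith
        then have "32 * exp (4 * real n) \<le> g q * exp (Z s q)"
          using g_ge[of q] q a(1)[of n] a(2)[of "Suc n"] by (intro mult_mono) auto
        also have "\<dots> \<le> F s q" by (rule gF[OF s0 s(2)])
        finally show ?thesis .
      qed
    qed
    have Vn: "c * (s - \<tau> n) \<le> V s (a (Suc n))" if s: "\<tau> n \<le> s" "s \<le> 2" for s
      using growth[where k = 0, OF Vt _ _ s, of c] Fn V0[OF \<tau>(1,2) a(3,2), of n "Suc n"] by simp
    show ?case
    proof (intro allI impI)
      fix t assume t: "\<tau> (Suc n) \<le> t \<and> t \<le> 2"
      then have t': "\<tau> n \<le> t" "t \<le> 2" "(1/2)^n \<le> t - \<tau> n" using \<tau>(3)[of n] pw(1)[of n] by linarith+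
      have c0: "0 \<le> c" unfolding c_def using a(5)[of n] by simp
      have "c / 2 * (t - \<tau> n)^2 \<le> Z t (a (Suc n))"
        using growth[where k = 1, OF Zt _ _ t'(1,2), of c] Vn Z0[OF a(3), of "\<tau> n" "Suc n"]
        by (simp add: numeral_2_eq_2)
      moreover have "c / 2 * ((1/2)^n)^2 \<le> c / 2 * (t - \<tau> n)^2"
        using t' c0 pw(1)[of n] by (intro mult_left_mono power_mono) auto
      moreover have "c / 2 * ((1/2)^n)^2 = 4 * (exp 4 / 8)^n"
        unfolding c_def a(4)
        by (simp add: power_divide exp_of_nat_mult[symmetric] mult.commute power2_eq_square
              power_mult_distrib[symmetric] flip: power_mult)
      moreover have "(2::real)^n \<le> (exp 4 / 8)^n"
      proof (rule power_mono)
        have "(2::real) ^ 4 \<le> exp 1 ^ 4" using exp_ge_add_one_self[of 1] by (intro power_mono) auto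
        then show "2 \<le> exp 4 / (8::real)" by (simp add: exp_of_nat_mult[symmetric])
      qed simp
      moreover have "real (Suc n) \<le> 2 ^ n"
      proof -
        have "Suc n \<le> 2 ^ n" by (induction n) auto
        then show ?thesis by (metis of_nat_le_iff of_nat_numeral of_nat_power)
      qed
      ultimately show "4 * real (Suc n) \<le> Z t (a (Suc n))"
        by argo
    qed
  qed
  obtain n where n: "Z 2 (b0 + 1/2) < real n" using reals_Archimedean2 by blast
  have "4 * real n \<le> Z 2 (a n)" using key[of n] \<tau>(2)[of n] by simp
  also have "\<dots> \<le> Z 2 (b0 + 1/2)" by (rule Zmono[OF a(2)])
  finally show False using n by simp
qed

section \<open>The blow-up time\<close>

definition Tstar :: real where "Tstar = Sup {t. \<exists>N. good N t}"

end

locale blowup_data = data +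
  assumes not_good: "\<And>N. \<not> good N 2"
begin

lemma good_less_2: "good N t \<Longrightarrow> t < 2"
  using not_good good_mono[of N t 2] by force

lemma Tstar_bdd: "bdd_above {t. \<exists>N. good N t}"
  using good_less_2 by (intro bdd_aboveI[of _ 2]) force

lemma good_less_Tstar: "good N t \<Longrightarrow> t < Tstar"
proof -
  assume "good N t"
  then obtain t' where "t < t'" "good (Suc N) t'" using good_extend by blast
  moreover have "t' \<le> Tstar" unfolding Tstar_def using calculation by (intro cSup_upper Tstar_bdd) auto
  ultimately show ?thesis by simp
qed

lemma Tstar_pos: "0 < Tstar" using good_less_Tstar[OF good_0] .

lemma less_Tstar_good: "0 \<le> t \<Longrightarrow> t < Tstar \<Longrightarrow> \<exists>N. good N t"
proof -
  assume t: "0 \<le> t" "t < Tstar"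
  have "{t. \<exists>N. good N t} \<noteq> {}" using good_0 by auto
  then obtain s N where "t < s" "good N s"
    using less_cSup_iff[OF _ Tstar_bdd] t(2) by (auto simp: Tstar_def)
  then show ?thesis using good_mono t(1) by (meson less_imp_le)
qed

text \<open>If \<open>h\<close> were bounded, a single level would serve at all times before
  \<open>Tstar\<close>, by continuity also at \<open>Tstar\<close>, and the extension of good times
  would pass beyond the supremum.\<close>

lemma h_unbounded: "\<exists>t N a. good N t \<and> C < \<bar>h N t a\<bar>"
proof (rule ccontr)
  assume "\<not> ?thesis"
  then have bd: "\<bar>h N t a\<bar> \<le> C" if "good N t" for N t a using that by (meson not_le)
  obtain N where N: "C \<le> real N" using real_arch_simple by blast
  have gN: "good N t" if t: "0 \<le> t" "t < Tstar" for t
  proof -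
    obtain M where M: "good M t" using less_Tstar_good[OF t] by blast
    have le: "\<bar>h M s a\<bar> \<le> real N" if "0 \<le> s" "s \<le> t" for s a
      using bd[OF good_mono[OF M that]] N by (meson order_trans)
    show ?thesis unfolding good_def using h_consistent(1)[OF M le] le t by auto
  qed
  have "\<bar>h N s a\<bar> \<le> real N" if s: "0 \<le> s" "s \<le> Tstar" for s a
  proof (cases "s < Tstar")
    case True
    then show ?thesis using gN[of s] s by (intro goodD) auto
  next
    case False
    then have s: "s = Tstar" using s by simp
    have "isCont (\<lambda>t. h N t a) Tstar" by (rule DERIV_isCont[OF h_t])
    then have "((\<lambda>t. \<bar>h N t a\<bar>) \<longlongrightarrow> \<bar>h N Tstar a\<bar>) (at_left Tstar)"
      by (intro tendsto_rabs) (simp add: isCont_def filterlim_at_split)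
    moreover have "\<forall>\<^sub>F t in at_left Tstar. \<bar>h N t a\<bar> \<le> real N"
      using Tstar_pos by (intro eventually_at_leftI[of 0]) (auto intro!: goodD[OF gN, OF _ _ _ order_refl])
    ultimately show ?thesis unfolding s by (intro tendsto_upperbound) auto
  qed
  then have "good N Tstar" using Tstar_pos by (auto simp: good_def)
  then show False using good_less_Tstar by blast
qed

end

section \<open>Weak derivatives of test functions\<close>

lemma
  assumes "\<phi> \<in> C0_infty"
  shows C0_infty_deriv: "((deriv ^^ k) \<phi> has_real_derivative (deriv ^^ Suc k) \<phi> x) (at x)"
    and C0_infty_support: "\<exists>a b. 0 < a \<and> a < b \<and> b < 1 \<and> (\<forall>x. \<phi> x \<noteq> 0 \<longrightarrow> a \<le> x \<and> x \<le> b)"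
proof -
  have "((deriv ^^ k) \<phi>) differentiable (at x)" using assms by (auto simp: C0_infty_def)
  then show "((deriv ^^ k) \<phi> has_real_derivative (deriv ^^ Suc k) \<phi> x) (at x)"
    by (simp add: DERIV_deriv_iff_real_differentiable)
  let ?K = "closure {x. \<phi> x \<noteq> 0}"
  have K: "compact ?K" "?K \<subseteq> {0<..<1}" using assms by (auto simp: C0_infty_def)
  show "\<exists>a b. 0 < a \<and> a < b \<and> b < 1 \<and> (\<forall>x. \<phi> x \<noteq> 0 \<longrightarrow> a \<le> x \<and> x \<le> b)"
  proof (cases "?K = {}")
    case True
    then show ?thesis by (intro exI[of _ "1/3"] exI[of _ "2/3"]) auto
  next
    case False
    obtain s where s: "s \<in> ?K" "\<forall>t\<in>?K. t \<le> s" using compact_attains_sup[OF K(1) False] by blast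
    obtain i where i: "i \<in> ?K" "\<forall>t\<in>?K. i \<le> t" using compact_attains_inf[OF K(1) False] by blast
    have "i \<le> s" using s i by blast
    moreover have "0 < i" "s < 1" using s i K(2) by auto
    moreover have "i \<le> x \<and> x \<le> s" if "\<phi> x \<noteq> 0" for x
    proof -
      have "x \<in> ?K" using that closure_subset[of "{x. \<phi> x \<noteq> 0}"] by blast
      with s i show ?thesis by blast
    qed
    \<comment> \<open>The midpoint of \<open>s\<close> and 1 replaces \<open>s\<close>, so that the
      interval is nondegenerate.\<close>
    ultimately show ?thesis
      by (intro exI[of _ i] exI[of _ "(s + 1) / 2"]) force
  qed
qed

lemma Ck_of_C0_infty:
  assumes "\<phi> \<in> C0_infty" shows "Ck n (\<lambda>_. (deriv ^^ k) \<phi>)"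
proof (induction n arbitrary: k)
  case 0
  have "continuous_on UNIV ((deriv ^^ k) \<phi>)"
    by (intro continuous_at_imp_continuous_on ballI DERIV_isCont[OF C0_infty_deriv[OF assms]])
  then show ?case by (simp add: cts2_fun)
next
  case (Suc n)
  have "continuous_on UNIV ((deriv ^^ k) \<phi>)"
    by (intro continuous_at_imp_continuous_on ballI DERIV_isCont[OF C0_infty_deriv[OF assms]])
  then show ?case
    by (rule Ck_SucI[OF cts2_fun C0_infty_deriv[OF assms] Suc.IH])
qed

lemma C0_infty_deriv_closed:
  assumes "\<phi> \<in> C0_infty" shows "(deriv ^^ k) \<phi> \<in> C0_infty"
proof (induction k)
  case (Suc k)
  obtain a b where ab: "0 < a" "b < 1" "\<And>x. (deriv ^^ k) \<phi> x \<noteq> 0 \<Longrightarrow> a \<le> x \<and> x \<le> b"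
    using C0_infty_support[OF Suc] by blast
  show ?case
  proof (rule C0_inftyI[OF Ck_of_C0_infty[OF assms] _ ab(1,2)])
    fix x assume nz: "(deriv ^^ Suc k) \<phi> x \<noteq> 0"
    show "a \<le> x \<and> x \<le> b"
    proof (rule ccontr)
      assume x: "\<not> (a \<le> x \<and> x \<le> b)"
      have z: "(deriv ^^ k) \<phi> y = 0" if "y \<in> {..<a} \<union> {b<..}" for y
      proof (rule ccontr)
        assume "(deriv ^^ k) \<phi> y \<noteq> 0"
        from ab(3)[OF this] that show False by auto
      qed
      have "(deriv ^^ Suc k) \<phi> x = 0"
        by (rule DERIV_zero_open[of _ _ _ "{..<a} \<union> {b<..}", OF C0_infty_deriv[OF assms] _ _ z]) (use x in auto)
      with nz show False by blast
    qed
  qed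
qed (simp add: assms)

lemma C0_infty_cont: "\<phi> \<in> C0_infty \<Longrightarrow> continuous_on S ((deriv ^^ k) \<phi>)"
  using cts2_slice_right[OF Ck_cts2[OF Ck_of_C0_infty[of \<phi> 0 k]]] .

lemma C0_infty_outside: "\<phi> \<in> C0_infty \<Longrightarrow> x \<le> 0 \<or> 1 \<le> x \<Longrightarrow> \<phi> x = 0"
  using C0_infty_support by fastforce

lemma C0_infty_diff:
  assumes "f \<in> C0_infty" "g \<in> C0_infty"
  shows "(\<lambda>x. f x - g x) \<in> C0_infty"
    and "(deriv ^^ k) (\<lambda>x. f x - g x) = (\<lambda>x. (deriv ^^ k) f x - (deriv ^^ k) g x)"
proof -
  obtain a b where ab: "0 < a" "b < 1" "\<And>x. f x \<noteq> 0 \<Longrightarrow> a \<le> x \<and> x \<le> b"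
    using C0_infty_support[OF assms(1)] by blast
  obtain c d where cd: "0 < c" "d < 1" "\<And>x. g x \<noteq> 0 \<Longrightarrow> c \<le> x \<and> x \<le> d"
    using C0_infty_support[OF assms(2)] by blast
  show "(\<lambda>x. f x - g x) \<in> C0_infty"
  proof (rule C0_inftyI[of _ "min a c" "max b d"])
    show "Ck n (\<lambda>t x. f x - g x)" for n
      using Ck_diff[OF Ck_of_C0_infty[OF assms(1), of n 0] Ck_of_C0_infty[OF assms(2), of n 0]] by simp
    fix x assume "f x - g x \<noteq> 0"
    then have "f x \<noteq> 0 \<or> g x \<noteq> 0" by auto
    then show "min a c \<le> x \<and> x \<le> max b d" using ab(3)[of x] cd(3)[of x] by auto
  qed (use ab cd in auto)
  show "(deriv ^^ k) (\<lambda>x. f x - g x) = (\<lambda>x. (deriv ^^ k) f x - (deriv ^^ k) g x)"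
  proof (induction k)
    case (Suc k)
    have "deriv (\<lambda>x. (deriv ^^ k) f x - (deriv ^^ k) g x) x = (deriv ^^ Suc k) f x - (deriv ^^ Suc k) g x" for x
      by (rule DERIV_imp_deriv[OF DERIV_diff[OF C0_infty_deriv[OF assms(1)] C0_infty_deriv[OF assms(2)]]])
    then show ?case using Suc by auto
  qed simp
qed

lemma unit_measure_integral:
  fixes f :: "real \<Rightarrow> real"
  assumes "continuous_on {0..1} f"
  shows "integrable unit_measure f" "integral\<^sup>L unit_measure f = integral {0..1} f"
proof -
  have "f absolutely_integrable_on {0..1}" by (rule absolutely_integrable_continuous_real[OF assms])
  then have "f absolutely_integrable_on {0<..<1}"
    by (rule set_integrable_subset) auto
  then show i: "integrable unit_measure f"
    by (rule absolutely_integrable_imp_integrable) simp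
  show "integral\<^sup>L unit_measure f = integral {0..1} f"
    by (simp add: lebesgue_integral_eq_integral[OF i] integral_open_interval_real)
qed

lemma integral_by_parts_C0_infty:
  assumes "F \<in> C0_infty" "\<phi> \<in> C0_infty"
  shows "(\<integral>x. F x * (deriv ^^ k) \<phi> x \<partial>unit_measure) = (-1) ^ k * (\<integral>x. (deriv ^^ k) F x * \<phi> x \<partial>unit_measure)"
  using assms(2)
proof (induction k arbitrary: \<phi>)
  case (Suc k)
  let ?G = "(deriv ^^ k) F"
  have G: "?G \<in> C0_infty" by (rule C0_infty_deriv_closed[OF assms(1)])
  have \<phi>': "deriv \<phi> \<in> C0_infty" using C0_infty_deriv_closed[OF Suc.prems, of 1] by simp
  have dG: "(?G has_real_derivative (deriv ^^ Suc k) F x) (at x)" for x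
    by (rule C0_infty_deriv[OF assms(1)])
  have d\<phi>: "(\<phi> has_real_derivative deriv \<phi> x) (at x)" for x
    using C0_infty_deriv[OF Suc.prems, of 0] by simp
  have cG: "continuous_on {0..1} ?G" "continuous_on {0..1} ((deriv ^^ Suc k) F)"
    by (rule C0_infty_cont[OF assms(1)])+
  have c\<phi>: "continuous_on {0..1} \<phi>" "continuous_on {0..1} (deriv \<phi>)"
    using C0_infty_cont[OF Suc.prems, of _ 0] C0_infty_cont[OF \<phi>', of _ 0] by simp_all
  have c: "continuous_on {0..1} (\<lambda>x. ?G x * deriv \<phi> x)" "continuous_on {0..1} (\<lambda>x. (deriv ^^ Suc k) F x * \<phi> x)"
    by (rule continuous_on_mult[OF cG(1) c\<phi>(2)] continuous_on_mult[OF cG(2) c\<phi>(1)])+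
  have "((\<lambda>x. (deriv ^^ Suc k) F x * \<phi> x + deriv \<phi> x * ?G x) has_integral ?G 1 * \<phi> 1 - ?G 0 * \<phi> 0) {0..1}"
  proof (rule fundamental_theorem_of_calculus)
    fix x
    show "((\<lambda>x. ?G x * \<phi> x) has_vector_derivative (deriv ^^ Suc k) F x * \<phi> x + deriv \<phi> x * ?G x) (at x within {0..1})"
      unfolding has_real_derivative_iff_has_vector_derivative[symmetric]
      by (rule has_field_derivative_at_within[OF DERIV_mult[OF dG d\<phi>]])
  qed simp
  moreover have "\<phi> 1 = 0" "\<phi> 0 = 0" using C0_infty_outside[OF Suc.prems] by auto
  ultimately have "((\<lambda>x. (deriv ^^ Suc k) F x * \<phi> x + ?G x * deriv \<phi> x) has_integral 0) {0..1}"
    by (simp only: mult.commute[of "deriv \<phi> _"] mult_zero_right diff_self)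
  then have "integral {0..1} (\<lambda>x. (deriv ^^ Suc k) F x * \<phi> x) + integral {0..1} (\<lambda>x. ?G x * deriv \<phi> x) = 0"
    using integral_add[OF integrable_continuous_real[OF c(2)] integrable_continuous_real[OF c(1)]]
    by (simp only: integral_unique)
  then have parts: "(\<integral>x. ?G x * deriv \<phi> x \<partial>unit_measure) = - (\<integral>x. (deriv ^^ Suc k) F x * \<phi> x \<partial>unit_measure)"
    unfolding unit_measure_integral(2)[OF c(1)] unit_measure_integral(2)[OF c(2)] by linarith
  have "(\<integral>x. F x * (deriv ^^ Suc k) \<phi> x \<partial>unit_measure) = (\<integral>x. F x * (deriv ^^ k) (deriv \<phi>) x \<partial>unit_measure)"
    by (simp only: funpow_Suc_right o_apply)
  also have "\<dots> = (-1) ^ k * (\<integral>x. ?G x * deriv \<phi> x \<partial>unit_measure)" by (rule Suc.IH[OF \<phi>'])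
  also have "\<dots> = (-1) ^ Suc k * (\<integral>x. (deriv ^^ Suc k) F x * \<phi> x \<partial>unit_measure)"
    unfolding parts by simp
  finally show ?case .
qed simp

lemma C0_infty_locally_integrable:
  assumes "F \<in> C0_infty" shows "locally_integrable ((deriv ^^ k) F)"
  unfolding locally_integrable_def
proof (intro allI impI)
  fix K :: "real set" assume K: "compact K \<and> K \<subseteq> {0<..<1}"
  have "(deriv ^^ k) F absolutely_integrable_on {0..1}"
    by (rule absolutely_integrable_continuous_real[OF C0_infty_cont[OF assms]])
  then show "set_integrable lebesgue K ((deriv ^^ k) F)"
    by (rule set_integrable_subset) (use K in \<open>auto intro: lmeasurable_compact fmeasurableD\<close>)
qed

lemma has_weak_deriv_C0_infty:
  assumes "F \<in> C0_infty" shows "has_weak_deriv k F ((deriv ^^ k) F)"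
  unfolding has_weak_deriv_def
  using C0_infty_locally_integrable[OF assms, of k] C0_infty_locally_integrable[OF assms, of 0]
    integral_by_parts_C0_infty[OF assms] by simp

section \<open>Uniqueness of weak derivatives\<close>

lemma locally_integrableD:
  assumes "locally_integrable f" "0 < a" "b < 1" shows "set_integrable lebesgue {a..b} f"
proof -
  have "compact {a..b}" "{a..b} \<subseteq> {0<..<1}" using assms(2,3) by auto
  with assms(1) show ?thesis unfolding locally_integrable_def by blast
qed

lemma bump_C0_infty:
  assumes "0 < \<epsilon>" "0 < a" "b < 1" shows "bump \<epsilon> a b \<in> C0_infty"
proof (rule C0_inftyI[OF bump_Ck[OF assms(1)] _ assms(2,3)])
  fix x assume "bump \<epsilon> a b x \<noteq> 0"
  then show "a \<le> x \<and> x \<le> b" by (auto simp: bump_def flat_def split: if_splits)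
qed

text \<open>The bumps \<open>exp (-\<epsilon>/(x - a) - \<epsilon>/(b - x))\<close> increase to the indicator of \<open>(a, b)\<close> as
  \<open>\<epsilon>\<close> tends to 0, so integrals against test functions determine integrals over intervals.\<close>

lemma interval_integral_test_functions:
  assumes f: "locally_integrable f" and ab: "0 < a" "b < 1"
    and z: "\<And>\<phi>. \<phi> \<in> C0_infty \<Longrightarrow> (\<integral>x. f x * \<phi> x \<partial>unit_measure) = 0"
  shows "integral {a..b} f = 0"
proof -
  have fi: "set_integrable lebesgue {a..b} f"
    by (rule locally_integrableD[OF f ab])
  define \<phi> where "\<phi> = (\<lambda>n::nat. bump (inverse (real (Suc n))) a b)"
  have bd: "0 \<le> \<phi> n x" "\<phi> n x \<le> indicator {a<..<b} x" for n x
    unfolding \<phi>_def bump_def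
    by (auto simp: flat_def indicator_def intro!: mult_le_one)
  have lim: "(\<lambda>n. \<phi> n x) \<longlonglongrightarrow> indicator {a<..<b} x" for x
  proof (cases "x \<in> {a<..<b}")
    case True
    have e: "(\<lambda>n. exp (- inverse (real (Suc n)) / y)) \<longlonglongrightarrow> exp (- 0 / y)" if "0 < y" for y :: real
      using that by (intro tendsto_intros LIMSEQ_inverse_real_of_nat) auto
    have "(\<lambda>n. exp (- inverse (real (Suc n)) / (x - a)) * exp (- inverse (real (Suc n)) / (b - x))) \<longlonglongrightarrow>
        exp (- 0 / (x - a)) * exp (- 0 / (b - x))"
      using True by (intro tendsto_mult e) auto
    then show ?thesis using True by (simp add: \<phi>_def bump_def flat_def)
  next
    case False
    then have i: "indicator {a<..<b} x = (0::real)" by simp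
    have "\<phi> n x = 0" for n using bd[where n = n and x = x] unfolding i by (rule antisym[rotated])
    then show ?thesis unfolding i by simp
  qed
  have eq: "(\<integral>x. indicator {0<..<1} x *\<^sub>R (f x * \<phi> n x) \<partial>lebesgue) = 0" for n
  proof -
    have "(\<integral>x. f x * \<phi> n x \<partial>unit_measure) = 0"
      unfolding \<phi>_def by (intro z bump_C0_infty ab) simp
    then show ?thesis by (subst (asm) integral_restrict_space) auto
  qed
  have \<phi>m: "\<phi> n \<in> borel_measurable lebesgue" for n
  proof -
    have "continuous_on UNIV (\<phi> n)"
      unfolding \<phi>_def by (rule cts2_slice_right[OF Ck_cts2[OF bump_Ck[of _ 0]]]) simp
    then show ?thesis by (intro measurable_completion) (simp add: borel_measurable_continuous_onI)
  qed
  have sub: "{a<..<b} \<subseteq> {0<..<1}" using ab by auto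
  have eq': "indicator {0<..<1} x *\<^sub>R (f x * \<phi> n x) = (indicator {a..b} x *\<^sub>R f x) * \<phi> n x" for n x
    using bd[of n x] ab by (auto simp: indicator_def split: if_splits)
  have "(\<lambda>n. \<integral>x. (indicator {a..b} x *\<^sub>R f x) * \<phi> n x \<partial>lebesgue) \<longlonglongrightarrow>
      (\<integral>x. (indicator {a..b} x *\<^sub>R f x) * indicator {a<..<b} x \<partial>lebesgue)"
  proof (rule integral_dominated_convergence[where w = "\<lambda>x. \<bar>indicator {a..b} x *\<^sub>R f x\<bar>"])
    have m: "(\<lambda>x. indicator {a..b} x *\<^sub>R f x) \<in> borel_measurable lebesgue"
      using fi by (auto simp: set_integrable_def)
    show "(\<lambda>x. (indicator {a..b} x *\<^sub>R f x) * \<phi> n x) \<in> borel_measurable lebesgue" for n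
      by (rule borel_measurable_times[OF m \<phi>m])
    show "(\<lambda>x. (indicator {a..b} x *\<^sub>R f x) * indicator {a<..<b} x) \<in> borel_measurable lebesgue"
      by (rule borel_measurable_times[OF m borel_measurable_indicator]) auto
    show "integrable lebesgue (\<lambda>x. \<bar>indicator {a..b} x *\<^sub>R f x\<bar>)"
      using fi by (auto simp: set_integrable_def intro: integrable_abs)
    show "AE x in lebesgue. (\<lambda>n. (indicator {a..b} x *\<^sub>R f x) * \<phi> n x) \<longlonglongrightarrow> (indicator {a..b} x *\<^sub>R f x) * indicator {a<..<b} x"
      by (intro AE_I2 tendsto_mult tendsto_const lim)
    show "AE x in lebesgue. norm ((indicator {a..b} x *\<^sub>R f x) * \<phi> n x) \<le> \<bar>indicator {a..b} x *\<^sub>R f x\<bar>" for n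
    proof (intro AE_I2)
      fix x
      have "\<bar>\<phi> n x\<bar> \<le> 1"
        using bd[where n = n and x = x] order_trans[OF _ indicator_le_1] by (simp only: abs_of_nonneg)
      then show "norm ((indicator {a..b} x *\<^sub>R f x) * \<phi> n x) \<le> \<bar>indicator {a..b} x *\<^sub>R f x\<bar>"
        by (simp add: abs_mult mult_left_le)
    qed
  qed
  then have "(\<integral>x. (indicator {a..b} x *\<^sub>R f x) * indicator {a<..<b} x \<partial>lebesgue) = 0"
    unfolding eq'[symmetric] eq by (simp add: LIMSEQ_const_iff)
  moreover have "(indicator {a..b} x *\<^sub>R f x) * indicator {a<..<b} x = indicator {a<..<b} x *\<^sub>R f x" for x
    by (auto simp: indicator_def)
  ultimately have "(LINT x:{a<..<b}|lebesgue. f x) = 0" by (simp only: set_lebesgue_integral_def)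
  moreover have "set_integrable lebesgue {a<..<b} f"
    by (rule set_integrable_subset[OF fi]) auto
  ultimately show ?thesis
    by (simp add: set_lebesgue_integral_eq_integral(2) integral_open_interval_real)
qed

text \<open>The fundamental lemma of the calculus of variations: integrals over intervals vanish,
  and Lebesgue differentiation recovers \<open>f\<close> almost everywhere. As \<open>f\<close> is
  only locally integrable, this is done on the intervals from 1/(n+1) to 1 - 1/(n+1), and the null
  sets are united.\<close>

lemma AE_zero_test_functions:
  assumes f: "locally_integrable f"
    and z: "\<And>\<phi>. \<phi> \<in> C0_infty \<Longrightarrow> (\<integral>x. f x * \<phi> x \<partial>unit_measure) = 0"
  shows "AE x in unit_measure. f x = 0"
proof -
  have N: "\<exists>N. negligible N \<and> (\<forall>x. a < x \<longrightarrow> x < b \<longrightarrow> x \<notin> N \<longrightarrow> f x = 0)" if ab: "0 < a" "b < 1" for a b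
  proof -
    let ?f = "\<lambda>x. if x \<in> {a..b} then f x else 0"
    have "set_integrable lebesgue {a..b} f" 
    by (rule locally_integrableD[OF f ab(1,2)])
    then have "f integrable_on {a..b}" by (rule set_lebesgue_integral_eq_integral)
    then have "?f integrable_on UNIV" by (simp only: integrable_restrict_UNIV)
    then have "?f integrable_on cbox c d" for c d by (rule integrable_on_subcbox) simp
    then obtain N where N: "negligible N" "\<And>x e. \<lbrakk>x \<notin> N; 0 < e\<rbrakk> \<Longrightarrow>
        \<exists>d>0. \<forall>h. 0 < h \<and> h < d \<longrightarrow> norm (integral (cbox x (x + h *\<^sub>R One)) ?f /\<^sub>R h ^ DIM(real) - ?f x) < e"
      by (rule integrable_ccontinuous_explicit) blast
    have "f x = 0" if x: "a < x" "x < b" "x \<notin> N" for x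
    proof (rule ccontr)
      assume "f x \<noteq> 0"
      then obtain d where d: "0 < d" "\<And>h. 0 < h \<Longrightarrow> h < d \<Longrightarrow>
          norm (integral (cbox x (x + h *\<^sub>R One)) ?f /\<^sub>R h ^ DIM(real) - ?f x) < \<bar>f x\<bar>"
        using N(2)[OF x(3), of "\<bar>f x\<bar>"] by auto
      define h where "h = min (d / 2) (b - x)"
      have h: "0 < h" "h < d" "x + h \<le> b" using d(1) x by (auto simp: h_def min_def)
      have "integral {x..x + h} ?f = integral {x..x + h} f"
        by (rule integral_cong) (use x h in auto)
      also have "\<dots> = 0"
        by (rule interval_integral_test_functions[OF f _ _ z]) (use x h ab in auto)
      finally have "integral (cbox x (x + h *\<^sub>R One)) ?f = 0" by simp
      then show False using d(2)[OF h(1,2)] x by simp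
    qed
    with N(1) show ?thesis by blast
  qed
  have "\<forall>n::nat. \<exists>N. negligible N \<and> (\<forall>x. inverse (real (Suc n)) < x \<longrightarrow> x < 1 - inverse (real (Suc n)) \<longrightarrow> x \<notin> N \<longrightarrow> f x = 0)"
    by (intro allI N) auto
  then obtain N where N: "\<And>n::nat. negligible (N n)"
    "\<And>n x. inverse (real (Suc n)) < x \<Longrightarrow> x < 1 - inverse (real (Suc n)) \<Longrightarrow> x \<notin> N n \<Longrightarrow> f x = 0"
    by metis
  have "negligible (\<Union>n. N n)" using N(1) by (intro negligible_countable_Union) auto
  then have "AE x in lebesgue. x \<notin> (\<Union>n. N n)"
    unfolding negligible_iff_null_sets by (rule AE_not_in)
  then have "AE x in lebesgue. x \<in> {0<..<1} \<longrightarrow> f x = 0"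
  proof (rule AE_mp, intro AE_I2 impI)
    fix x :: real assume x: "x \<notin> (\<Union>n. N n)" "x \<in> {0<..<1}"
    then obtain n where n: "inverse (real (Suc n)) < min x (1 - x)"
      using reals_Archimedean[of "min x (1 - x)"] by auto
    show "f x = 0" by (rule N(2)[of n]) (use x n in auto)
  qed
  then show ?thesis by (simp add: AE_restrict_space_iff)
qed

text \<open>Only the defining identities of the chosen weak derivative are known; the fundamental
  lemma forces it to agree almost everywhere with the classical derivative, so their norms
  coincide.\<close>

lemma weak_deriv_C0_infty_norm:
  assumes F: "F \<in> C0_infty"
  shows "(L2_norm (weak_deriv k F))\<^sup>2 = integral {0..1} (\<lambda>x. ((deriv ^^ k) F x)\<^sup>2)"
proof -
  let ?g = "weak_deriv k F"
  have g: "has_weak_deriv k F ?g"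
    unfolding weak_deriv_def by (rule someI[of _ "(deriv ^^ k) F"]) (rule has_weak_deriv_C0_infty[OF F])
  note c = C0_infty_cont[OF F, of _ k]
  have gl: "locally_integrable ?g" using g by (simp add: has_weak_deriv_def)
  have Fl: "locally_integrable ((deriv ^^ k) F)" by (rule C0_infty_locally_integrable[OF F])
  \<comment> \<open>A locally integrable factor may fail to be integrable near 0 and 1. The compact
    support of \<open>\<phi>\<close> restores integrability, which justifies splitting the integral
    of the difference below.\<close>
  have int: "integrable unit_measure (\<lambda>x. f x * \<phi> x)"
    if f: "locally_integrable f" and \<phi>: "\<phi> \<in> C0_infty" for f \<phi>
  proof -
    obtain a b where ab: "0 < a" "b < 1" "\<And>x. \<phi> x \<noteq> 0 \<Longrightarrow> a \<le> x \<and> x \<le> b"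
      using C0_infty_support[OF \<phi>] by blast
    have fi: "set_integrable lebesgue {a..b} f" 
    by (rule locally_integrableD[OF f ab(1,2)])
    have cont: "continuous_on UNIV \<phi>" using C0_infty_cont[OF \<phi>, of _ 0] by simp
    have z: "\<phi> x = 0" if "\<bar>1\<bar> < \<bar>x\<bar>" for x using that by (intro C0_infty_outside[OF \<phi>]) linarith
    obtain B where B: "\<And>x. \<bar>\<phi> x\<bar> \<le> B" using bounded_compact_support[OF cont, of 1] z by auto
    have "integrable lebesgue (\<lambda>x. \<phi> x * (indicator {a..b} x *\<^sub>R f x))"
    proof (rule Bochner_Integration.integrable_bound)
      show "integrable lebesgue (\<lambda>x. B * \<bar>indicator {a..b} x *\<^sub>R f x\<bar>)"
        using fi by (intro integrable_mult_right integrable_abs) (simp add: set_integrable_def)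
      show "(\<lambda>x. \<phi> x * (indicator {a..b} x *\<^sub>R f x)) \<in> borel_measurable lebesgue"
      proof (rule borel_measurable_times)
        show "\<phi> \<in> borel_measurable lebesgue"
          using cont by (intro measurable_completion) (simp add: borel_measurable_continuous_onI)
        show "(\<lambda>x. indicator {a..b} x *\<^sub>R f x) \<in> borel_measurable lebesgue"
          using fi by (auto simp: set_integrable_def)
      qed
      show "AE x in lebesgue. norm (\<phi> x * (indicator {a..b} x *\<^sub>R f x)) \<le> norm (B * \<bar>indicator {a..b} x *\<^sub>R f x\<bar>)"
      proof (intro AE_I2)
        fix x
        have "\<bar>\<phi> x\<bar> \<le> \<bar>B\<bar>" using B[of x] by linarith
        then show "norm (\<phi> x * (indicator {a..b} x *\<^sub>R f x)) \<le> norm (B * \<bar>indicator {a..b} x *\<^sub>R f x\<bar>)"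
          by (simp add: abs_mult mult_right_mono)
      qed
    qed
    also have "(\<lambda>x. \<phi> x * (indicator {a..b} x *\<^sub>R f x)) = (\<lambda>x. indicator {0<..<1} x *\<^sub>R (f x * \<phi> x))"
      using ab by (force simp: indicator_def)
    finally show ?thesis by (subst integrable_restrict_space) auto
  qed
  have "AE x in unit_measure. ?g x - (deriv ^^ k) F x = 0"
  proof (rule AE_zero_test_functions)
    show "locally_integrable (\<lambda>x. ?g x - (deriv ^^ k) F x)"
      using gl Fl by (auto simp: locally_integrable_def intro: set_integral_diff)
    fix \<phi> assume \<phi>: "\<phi> \<in> C0_infty"
    have "(\<integral>x. F x * (deriv ^^ k) \<phi> x \<partial>unit_measure) = (-1) ^ k * (\<integral>x. ?g x * \<phi> x \<partial>unit_measure)"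
      using g \<phi> by (simp add: has_weak_deriv_def)
    moreover have "(\<integral>x. F x * (deriv ^^ k) \<phi> x \<partial>unit_measure) = (-1) ^ k * (\<integral>x. (deriv ^^ k) F x * \<phi> x \<partial>unit_measure)"
      by (rule integral_by_parts_C0_infty[OF F \<phi>])
    ultimately have "(\<integral>x. ?g x * \<phi> x \<partial>unit_measure) = (\<integral>x. (deriv ^^ k) F x * \<phi> x \<partial>unit_measure)" by simp
    then show "(\<integral>x. (?g x - (deriv ^^ k) F x) * \<phi> x \<partial>unit_measure) = 0"
      using Bochner_Integration.integral_diff[OF int[OF gl \<phi>] int[OF Fl \<phi>]]
      by (simp add: left_diff_distrib)
  qed
  then have ae: "AE x in unit_measure. ?g x = (deriv ^^ k) F x" by simp
  have Fm: "(deriv ^^ k) F \<in> borel_measurable unit_measure"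
    using borel_measurable_integrable[OF unit_measure_integral(1)[OF c]] .
  \<comment> \<open>Measurability of the chosen representative is inherited from the classical
    derivative, since Lebesgue measure is complete.\<close>
  have "(\<lambda>x. indicator {0<..<1} x *\<^sub>R ?g x) \<in> borel_measurable lebesgue"
  proof -
    let ?h = "\<lambda>x. indicator {0<..<1} x *\<^sub>R (deriv ^^ k) F x"
    have "?h \<in> borel_measurable lebesgue"
      using Fm by (subst (asm) borel_measurable_restrict_space_iff) auto
    moreover have "AE x in lebesgue. ?h x = indicator {0<..<1} x *\<^sub>R ?g x"
    proof -
      have "AE x in lebesgue. x \<in> {0<..<1} \<longrightarrow> ?g x = (deriv ^^ k) F x"
        using ae by (simp add: AE_restrict_space_iff)
      then show ?thesis by eventually_elim (auto simp: indicator_def)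
    qed
    ultimately show ?thesis by (rule borel_measurable_AE)
  qed
  then have gm: "?g \<in> borel_measurable unit_measure"
    by (subst borel_measurable_restrict_space_iff) auto
  have "(\<integral>x. (?g x)\<^sup>2 \<partial>unit_measure) = (\<integral>x. ((deriv ^^ k) F x)\<^sup>2 \<partial>unit_measure)"
    by (rule integral_cong_AE) (use gm Fm ae in auto)
  also have "\<dots> = integral {0..1} (\<lambda>x. ((deriv ^^ k) F x)\<^sup>2)"
    by (intro unit_measure_integral continuous_intros c)
  finally have eq: "(\<integral>x. (?g x)\<^sup>2 \<partial>unit_measure) = integral {0..1} (\<lambda>x. ((deriv ^^ k) F x)\<^sup>2)" .
  have "0 \<le> (\<integral>x. (?g x)\<^sup>2 \<partial>unit_measure)" by (rule Bochner_Integration.integral_nonneg) simp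
  then show ?thesis unfolding L2_norm_def eq[symmetric] by (rule real_sqrt_pow2)
qed

lemma Sobolev_norm_C0_infty:
  "F \<in> C0_infty \<Longrightarrow> Sobolev_norm m F = sqrt (\<Sum>k\<le>m. integral {0..1} (\<lambda>x. ((deriv ^^ k) F x)\<^sup>2))"
  by (simp add: Sobolev_norm_def weak_deriv_C0_infty_norm)

lemma deriv_L2: "F \<in> C0_infty \<Longrightarrow> (deriv ^^ k) F \<in> L2"
  unfolding L2_def
  using unit_measure_integral(1)[OF C0_infty_cont[of F _ k]]
    unit_measure_integral(1)[OF continuous_on_power[OF C0_infty_cont[of F _ k], of _ 2]] by auto

lemma C0_infty_Sobolev0:
  assumes F: "F \<in> C0_infty" shows "F \<in> Sobolev0 m"
proof -
  have "F \<in> Sobolev m"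
    unfolding Sobolev_def
    using deriv_L2[OF F, of 0] deriv_L2[OF F] has_weak_deriv_C0_infty[OF F] by auto
  moreover have "Sobolev_norm m (\<lambda>x. F x - F x) = 0"
    using Sobolev_norm_C0_infty[OF C0_infty_diff(1)[OF F F]] C0_infty_diff(2)[OF F F] by simp
  ultimately show ?thesis
    unfolding Sobolev0_def using F by (auto intro!: bexI[of _ F])
qed

text \<open>Near each time \<open>f\<close> agrees with a global family whose space derivatives are
  jointly continuous; the Sobolev distance of its members is an integral depending continuously on
  time. Agreement at all earlier times is what a truncation level provides.\<close>

lemma continuous_Sobolev0I:
  assumes F: "\<And>t. t \<in> time_interval T \<Longrightarrow> \<exists>F t'. (\<forall>n. Ck n F) \<and> t < t' \<and>
     (\<forall>s\<in>time_interval T. s < t' \<longrightarrow> f s = F s \<and> F s \<in> C0_infty)"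
  shows "continuous_Sobolev0 T m f"
  unfolding continuous_Sobolev0_def
proof (intro conjI ballI)
  fix t assume t: "t \<in> time_interval T"
  obtain F t' where F: "\<And>n. Ck n F" "t < t'"
    "\<And>s. s \<in> time_interval T \<Longrightarrow> s < t' \<Longrightarrow> f s = F s \<and> F s \<in> C0_infty"
    using F[OF t] by blast
  then show "f t \<in> Sobolev0 m" using C0_infty_Sobolev0 t by metis
  let ?I = "\<lambda>s. sqrt (\<Sum>k\<le>m. integral {0..1} (\<lambda>x. ((deriv ^^ k) (F s) x - (deriv ^^ k) (F t) x)\<^sup>2))"
  have "continuous_on UNIV ?I"
  proof (intro continuous_intros)
    fix k
    have c: "cts2 (\<lambda>s. (deriv ^^ k) (F s))" using Ck_deriv_iter[OF F(1)[of k], of k] by simp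
    have "continuous_on UNIV (\<lambda>s. integral (cbox 0 1) (\<lambda>x. ((deriv ^^ k) (F s) x - (deriv ^^ k) (F t) x)\<^sup>2))"
      by (rule integral_continuous_on_param, unfold case_prod_beta')
         (intro continuous_intros cts2_compose[OF c])
    then show "continuous_on UNIV (\<lambda>s. integral {0..1} (\<lambda>x. ((deriv ^^ k) (F s) x - (deriv ^^ k) (F t) x)\<^sup>2))"
      by simp
  qed
  then have "isCont ?I t" by (simp add: continuous_on_eq_continuous_at)
  then have "(?I \<longlongrightarrow> ?I t) (at t within time_interval T)"
    unfolding isCont_def by (rule tendsto_within_subset) simp
  then have "(?I \<longlongrightarrow> 0) (at t within time_interval T)" by simp
  moreover have "\<forall>\<^sub>F s in at t within time_interval T. ?I s = Sobolev_norm m (\<lambda>x. f s x - f t x)"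
  proof -
    have "\<forall>\<^sub>F s in at t within time_interval T. s < t'"
      using F(2) by (intro order_tendstoD(2)[OF tendsto_ident_at])
    moreover have "\<forall>\<^sub>F s in at t within time_interval T. s \<in> time_interval T"
      by (simp add: eventually_at_filter)
    ultimately show ?thesis
    proof eventually_elim
      case (elim s)
      have "f s = F s" "F s \<in> C0_infty" "f t = F t" "F t \<in> C0_infty" using F t elim by blast+
      then show ?case by (simp add: Sobolev_norm_C0_infty C0_infty_diff)
    qed
  qed
  ultimately show "((\<lambda>s. Sobolev_norm m (\<lambda>x. f s x - f t x)) \<longlongrightarrow> 0) (at t within time_interval T)"
    by (rule Lim_transform_eventually)
qed

section \<open>The solution up to the blow-up time\<close>

lemma continuous_on_glued:
  assumes "\<And>t. t \<in> I \<Longrightarrow> \<exists>G t'. cts2 G \<and> t < t' \<and> (\<forall>s\<in>I. s < t' \<longrightarrow> (\<forall>x\<in>S. f s x = G s x))"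
  shows "continuous_on (I \<times> S) (\<lambda>(t, x). f t x)"
  unfolding continuous_on_def
proof (intro ballI)
  fix p assume p: "p \<in> I \<times> S"
  obtain G t' where G: "cts2 G" "fst p < t'" "\<And>s x. s \<in> I \<Longrightarrow> s < t' \<Longrightarrow> x \<in> S \<Longrightarrow> f s x = G s x"
    using assms[of "fst p"] p by (auto simp: mem_Times_iff)
  have "continuous_on (I \<times> S) (\<lambda>p. G (fst p) (snd p))"
    using G(1) by (auto simp: cts2_def intro: continuous_on_subset)
  then have "((\<lambda>p. G (fst p) (snd p)) \<longlongrightarrow> G (fst p) (snd p)) (at p within I \<times> S)"
    using p by (cases p) (auto simp: continuous_on_def)
  moreover have "\<forall>\<^sub>F q in at p within I \<times> S. fst q < t'"
    by (rule order_tendstoD(2)[OF tendsto_fst[OF tendsto_ident_at] G(2)])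
  then have "\<forall>\<^sub>F q in at p within I \<times> S. G (fst q) (snd q) = (case q of (t, x) \<Rightarrow> f t x)"
    using eventually_at_topological[of "\<lambda>q. q \<in> I \<times> S" p "I \<times> S"]
    by (auto simp: eventually_at_filter elim!: eventually_mono intro!: G(3)[symmetric])
  ultimately have "((\<lambda>(t, x). f t x) \<longlongrightarrow> G (fst p) (snd p)) (at p within I \<times> S)"
    by (rule Lim_transform_eventually)
  moreover have "G (fst p) (snd p) = (case p of (t, x) \<Rightarrow> f t x)"
    using p G(2,3) by (auto simp: mem_Times_iff case_prod_beta')
  ultimately show "((\<lambda>(t, x). f t x) \<longlongrightarrow> (case p of (t, x) \<Rightarrow> f t x)) (at p within I \<times> S)"
    by simp
qed

text \<open>For a continuous function the set where a smaller bound is exceeded is open, hence not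
  null as soon as it contains a point.\<close>

lemma Linfty_norm_ge:
  assumes f: "continuous_on UNIV f" and x: "x \<in> {0<..<1}"
  shows "ennreal \<bar>f x\<bar> \<le> Linfty_norm f"
proof (rule ccontr)
  assume "\<not> ?thesis"
  then have lt: "Linfty_norm f < ennreal \<bar>f x\<bar>" by simp
  obtain c where c: "Linfty_norm f = ennreal c" "0 \<le> c" "c < \<bar>f x\<bar>"
    using lt by (cases "Linfty_norm f") (auto simp: ennreal_less_iff)
  have "open {y. c < \<bar>f y\<bar>}"
    by (intro open_Collect_less continuous_intros f)
  then have o: "open ({y. c < \<bar>f y\<bar>} \<inter> {0<..<1})" by auto
  have "AE y in unit_measure. ennreal \<bar>f y\<bar> \<le> Linfty_norm f"
    unfolding Linfty_norm_def by (rule esssup_AE)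
  then have "AE y in lebesgue. y \<in> {0<..<1} \<longrightarrow> \<bar>f y\<bar> \<le> c"
    using c by (auto simp: AE_restrict_space_iff)
  then have "AE y in lebesgue. y \<notin> {y. c < \<bar>f y\<bar>} \<inter> {0<..<1}"
    by eventually_elim auto
  then have "{y. c < \<bar>f y\<bar>} \<inter> {0<..<1} \<in> null_sets lebesgue"
    using o by (subst (asm) AE_iff_null_sets[symmetric]) auto
  then have "negligible ({y. c < \<bar>f y\<bar>} \<inter> {0<..<1})" by (simp add: negligible_iff_null_sets)
  then have "{y. c < \<bar>f y\<bar>} \<inter> {0<..<1} = {}" using open_not_negligible[OF o] by blast
  then show False using x c by auto
qed

section \<open>Assembling the Eulerian solution\<close>

context data
begin

text \<open>With the cutoff included, the position map of the associated flow is exactly the one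
  that occurs in \<open>Gt\<close>, at every time.\<close>

definition H :: "nat \<Rightarrow> real \<Rightarrow> real \<Rightarrow> real" where "H N t a = cutoff N (h N t a)"
definition Ht :: "nat \<Rightarrow> real \<Rightarrow> real \<Rightarrow> real" where "Ht N t a = deriv (cutoff N) (h N t a) * w N t a"

lemma flow_N: "flow (H N) (Ht N) a0 a1"
proof
  show "Ck n (H N)" for n unfolding H_def by (rule Ck_comp[OF cutoff_Ck h_Ck])
  show "cts2 (Ht N)" unfolding Ht_def
    by (intro cts2_mult cts2_fun_comp[OF cutoff_deriv_cont] h_cts2 w_cts2)
  show "((\<lambda>t. H N t a) has_real_derivative Ht N t a) (at t)" for t a
    unfolding H_def Ht_def by (rule DERIV_chain2[OF cutoff_deriv h_t])
  show "H N t a = 0" if "a < a0 \<or> a1 < a" for t a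
    using h_supp[OF that] by (simp add: H_def cutoff_id)
qed (use a01 in auto)

lemma H_good:
  assumes "good N t" "0 \<le> s" "s \<le> t"
  shows "H N s = h N s" "Ht N s = w N s"
proof -
  have "\<bar>h N s a\<bar> < real N + 1" for a using goodD[OF assms, of a] by linarith
  then show "H N s = h N s" "Ht N s = w N s"
    by (intro ext; simp add: H_def Ht_def cutoff_id cutoff_deriv_1 less_imp_le)+
qed

definition lev :: "real \<Rightarrow> nat" where "lev t = (LEAST N. good N t)"

text \<open>\<open>om\<close> and \<open>rh\<close> are the fields \<open>\<omega>\<close> and \<open>\<rho>\<close> of the solution. At time \<open>t\<close> they are read off from
  any truncated problem whose cutoff has not been active up to \<open>t\<close>.\<close>

definition om :: "real \<Rightarrow> real \<Rightarrow> real" where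
  "om t = flow.Eul (H (lev t)) (w (lev t)) t"

definition rh :: "real \<Rightarrow> real \<Rightarrow> real" where
  "rh t = flow.Eul (H (lev t)) (\<lambda>_. r) t"

lemma Eul_cong:
  assumes "H N s = H M s" "q s = q' s"
  shows "flow.Eul (H N) q s = flow.Eul (H M) q' s"
proof -
  interpret FN: flow "H N" "Ht N" a0 a1 by (rule flow_N)
  interpret FM: flow "H M" "Ht M" a0 a1 by (rule flow_N)
  have "FN.Z s = FM.Z s" by (intro ext) (simp add: FN.Z_def FM.Z_def assms)
  then have "FN.Lab s = FM.Lab s"
    by (intro ext) (simp add: FN.Lab_def FM.Lab_def FN.A_def FM.A_def)
  then show ?thesis
    by (intro ext) (simp add: FN.Eul_def FM.Eul_def assms)
qed

text \<open>Levels uncut at time \<open>s\<close> give the same flow and the same fields there, so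
  the least level chosen by \<open>lev\<close> can be exchanged for one level on a whole time
  interval.\<close>

lemma om_rh_good:
  assumes "good N t" "0 \<le> s" "s \<le> t"
  shows "om s = flow.Eul (H N) (w N) s" "rh s = flow.Eul (H N) (\<lambda>_. r) s"
proof -
  have g: "good N s" by (rule good_mono[OF assms])
  then have l: "good (lev s) s" unfolding lev_def by (rule LeastI)
  note ag = good_agree[OF g l assms(2) order_refl]
  have "H (lev s) s = H N s"
    using H_good(1)[OF g assms(2) order_refl] H_good(1)[OF l assms(2) order_refl] ag(1) by auto
  moreover have "w (lev s) s = w N s" using ag(2) by auto
  ultimately show "om s = flow.Eul (H N) (w N) s" "rh s = flow.Eul (H N) (\<lambda>_. r) s"
    unfolding om_def rh_def by (auto intro: Eul_cong)
qed

lemma supp_w: "flow.supp a0 a1 (w N)" and supp_r: "flow.supp a0 a1 (\<lambda>_. r)"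
proof -
  interpret F: flow "H N" "Ht N" a0 a1 by (rule flow_N)
  show "flow.supp a0 a1 (w N)" "flow.supp a0 a1 (\<lambda>_. r)"
    by (auto simp: F.supp_def w_supp r_supp)
qed

definition omx where "omx t x = deriv (om t) x"
definition rhx where "rhx t x = deriv (rh t) x"
text \<open>The time derivatives are read off from the equations, which therefore hold by
  construction; the content lies in showing that these are the actual continuous partial
  derivatives.\<close>

definition omt where "omt t x = rhx t x - velocity om t x * omx t x"
definition rht where "rht t x = - velocity om t x * rhx t x"

text \<open>On the time interval of one level all four derivatives come from globally continuous
  fields. The equations reduce to w' = g e^(Z-h) along trajectories and to x e^Z = 1, which turns
  the drift of the label into the transport term.\<close>

lemma slab:
  assumes good: "good N t'"
  obtains Ot Ox Rt Rx where "cts2 Ot" "cts2 Ox" "cts2 Rt" "cts2 Rx"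
    "\<And>t x. ((\<lambda>s. flow.Eul (H N) (w N) s x) has_real_derivative Ot t x) (at t)"
    "\<And>t x. (flow.Eul (H N) (w N) t has_real_derivative Ox t x) (at x)"
    "\<And>t x. ((\<lambda>s. flow.Eul (H N) (\<lambda>_. r) s x) has_real_derivative Rt t x) (at t)"
    "\<And>t x. (flow.Eul (H N) (\<lambda>_. r) t has_real_derivative Rx t x) (at x)"
    "\<And>t x. 0 \<le> t \<Longrightarrow> t \<le> t' \<Longrightarrow> 0 \<le> x \<Longrightarrow> x \<le> 1 \<Longrightarrow>
       omt t x = Ot t x \<and> omx t x = Ox t x \<and> rht t x = Rt t x \<and> rhx t x = Rx t x"
proof -
  interpret F: flow "H N" "Ht N" a0 a1 by (rule flow_N)
  define wa where "wa = (\<lambda>t. deriv (w N t))"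
  have wa: "(w N t has_real_derivative wa t a) (at a)" for t a
    unfolding wa_def by (rule Ck_has_deriv[OF w_Ck])
  have wa_Ck: "Ck n wa" for n by (rule Ck_deriv[OF w_Ck wa])
  have s: "F.supp wa" "F.supp (\<lambda>_ a. - g a)" "F.supp (Gt N (h N))"
    by (rule F.supp_deriv[OF wa supp_w]) (auto simp: F.supp_def g_supp Gt_eq)
  define Ot where "Ot = F.Eul (\<lambda>t a. Gt N (h N) t a - wa t a * F.V t a * exp (- H N t a))"
  define Ox where "Ox = F.Eul (\<lambda>t a. - wa t a * exp (F.Z t a - H N t a))"
  define Rt where "Rt = F.Eul (\<lambda>t a. 0 - - g a * F.V t a * exp (- H N t a))"
  define Rx where "Rx = F.Eul (\<lambda>t a. - (- g a) * exp (F.Z t a - H N t a))"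
  have gc: "cts2 (\<lambda>_. g)" using Ck_cts2[OF g_Ck] .
  note cts = F.V_cts2 F.Z_cts2 F.H_cts2 Ck_cts2[OF wa_Ck] gc Gt_cts2[OF h_cts2]
  have c1: "cts2 Ot" unfolding Ot_def
    by (rule F.Eul_cts2) (intro cts2_diff cts2_mult cts2_minus cts2_exp cts, use s in \<open>simp add: F.supp_def\<close>)
  have c2: "cts2 Ox" unfolding Ox_def
    by (rule F.Eul_cts2) (intro cts2_diff cts2_mult cts2_minus cts2_exp cts, use s in \<open>simp add: F.supp_def\<close>)
  have c3: "cts2 Rt" unfolding Rt_def
    by (rule F.Eul_cts2) (intro cts2_diff cts2_mult cts2_minus cts2_exp cts2_const cts, use s in \<open>simp add: F.supp_def\<close>)
  have c4: "cts2 Rx" unfolding Rx_def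
    by (rule F.Eul_cts2) (intro cts2_diff cts2_mult cts2_minus cts2_exp cts, use s in \<open>simp add: F.supp_def\<close>)
  have d1: "((\<lambda>s. F.Eul (w N) s x) has_real_derivative Ot t x) (at t)" for t x
    unfolding Ot_def by (rule F.Eul_t[OF w_t wa Ck_cts2[OF wa_Ck]])
  have d2: "(F.Eul (w N) t has_real_derivative Ox t x) (at x)" for t x
    unfolding Ox_def by (rule F.Eul_x[OF wa supp_w s(1)])
  have d3: "((\<lambda>s. F.Eul (\<lambda>_. r) s x) has_real_derivative Rt t x) (at t)" for t x
    unfolding Rt_def
    by (rule F.Eul_t[where q = "\<lambda>_. r" and qt = "\<lambda>_ _. 0" and qa = "\<lambda>_ a. - g a"])
       (use r_deriv cts2_minus[OF gc] in auto)
  have d4: "(F.Eul (\<lambda>_. r) t has_real_derivative Rx t x) (at x)" for t x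
    unfolding Rx_def
    by (rule F.Eul_x[where q = "\<lambda>_. r" and q' = "\<lambda>_ a. - g a", OF r_deriv supp_r s(2)])
  have pde: "Rt t x + velocity om t x * Rx t x = 0 \<and> Ot t x + velocity om t x * Ox t x = Rx t x"
    if t: "0 \<le> t" "t \<le> t'" and x: "0 \<le> x" "x \<le> 1" for t x
  proof (cases "x = 0")
    case True
    then show ?thesis by (simp add: Ot_def Ox_def Rt_def Rx_def F.Eul_def velocity_def)
  next
    case False
    with x have x: "0 < x" "x \<le> 1" by auto
    have "om t = F.Eul (Ht N) t"
      unfolding om_rh_good(1)[OF good t] by (rule Eul_cong) (use H_good(2)[OF good t] in auto)
    then have "Omega om t x = F.V t (F.Lab t x)"
      unfolding Omega_def using F.Omega_Eul[OF x] by simp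
    then have vel: "velocity om t x = - x * F.V t (F.Lab t x)" by (simp add: velocity_def)
    let ?a = "F.Lab t x"
    have xZ: "x * exp (F.Z t ?a - H N t ?a) = exp (- H N t ?a)"
      using x by (simp add: F.Lab_def exp_diff exp_minus field_simps)
    have G: "Gt N (h N) t ?a = g ?a * exp (F.Z t ?a - H N t ?a)"
      unfolding Gt_good[OF good t] F.Z_def H_good(1)[OF good t] by (simp add: exp_diff exp_minus field_simps)
    have e: "Rt t x = g ?a * F.V t ?a * exp (- H N t ?a)" "Rx t x = g ?a * exp (F.Z t ?a - H N t ?a)"
      "Ot t x = g ?a * exp (F.Z t ?a - H N t ?a) - wa t ?a * F.V t ?a * exp (- H N t ?a)"
      "Ox t x = - wa t ?a * exp (F.Z t ?a - H N t ?a)"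
      using x by (simp_all add: Rt_def Rx_def Ot_def Ox_def F.Eul_def G)
    show ?thesis unfolding e vel xZ[symmetric] by (simp add: algebra_simps)
  qed
  have "omt t x = Ot t x \<and> omx t x = Ox t x \<and> rht t x = Rt t x \<and> rhx t x = Rx t x"
    if t: "0 \<le> t" "t \<le> t'" and x: "0 \<le> x" "x \<le> 1" for t x
  proof -
    have 1: "omx t x = Ox t x" "rhx t x = Rx t x"
      unfolding omx_def rhx_def om_rh_good[OF good t] by (rule DERIV_imp_deriv[OF d2] DERIV_imp_deriv[OF d4])+
    with pde[OF t x] show ?thesis by (simp add: omt_def rht_def)
  qed
  then show ?thesis by (rule that[OF c1 c2 c3 c4 d1 d2 d3 d4])
qed

end

context blowup_data
begin

lemma time_interval_Tstar: "t \<in> time_interval (ereal Tstar) \<longleftrightarrow> 0 \<le> t \<and> t < Tstar"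
  by (simp add: time_interval_def)

text \<open>The slack between \<open>t\<close> and \<open>t'\<close> makes one level valid near
  \<open>t\<close>, so local statements can be read off from a single truncated problem.\<close>

lemma good_beyond:
  assumes "t \<in> time_interval (ereal Tstar)"
  obtains N t' where "t < t'" "good N t'"
  using assms less_Tstar_good good_extend by (auto simp: time_interval_Tstar) blast

lemma om_C1: "C1_with_partials (ereal Tstar) om omt omx"
  and rh_C1: "C1_with_partials (ereal Tstar) rh rht rhx"
proof -
  let ?I = "time_interval (ereal Tstar)"
  have ex: "\<exists>Ot Ox Rt Rx t'. t < t' \<and> cts2 Ot \<and> cts2 Ox \<and> cts2 Rt \<and> cts2 Rx \<and>
     (\<forall>s\<in>?I. s < t' \<longrightarrow> (\<forall>x\<in>{0..1}. omt s x = Ot s x \<and> omx s x = Ox s x \<and> rht s x = Rt s x \<and> rhx s x = Rx s x))"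
    if t: "t \<in> ?I" for t
  proof -
    obtain N t' where N: "t < t'" "good N t'" using good_beyond[OF t] .
    obtain Ot Ox Rt Rx where *: "cts2 Ot" "cts2 Ox" "cts2 Rt" "cts2 Rx"
      "\<And>t x. 0 \<le> t \<Longrightarrow> t \<le> t' \<Longrightarrow> 0 \<le> x \<Longrightarrow> x \<le> 1 \<Longrightarrow>
       omt t x = Ot t x \<and> omx t x = Ox t x \<and> rht t x = Rt t x \<and> rhx t x = Rx t x"
      by (rule slab[OF N(2)]) blast
    show ?thesis
      by (intro exI[of _ Ot] exI[of _ Ox] exI[of _ Rt] exI[of _ Rx] exI[of _ t'])
         (use * N in \<open>auto simp: time_interval_Tstar\<close>)
  qed
  have cont: "continuous_on (?I \<times> {0..1}) (\<lambda>(t, x). omt t x)" "continuous_on (?I \<times> {0..1}) (\<lambda>(t, x). omx t x)"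
    "continuous_on (?I \<times> {0..1}) (\<lambda>(t, x). rht t x)" "continuous_on (?I \<times> {0..1}) (\<lambda>(t, x). rhx t x)"
    by (rule continuous_on_glued; drule ex; blast)+
  have der: "((\<lambda>s. om s x) has_real_derivative omt t x) (at t within ?I) \<and>
      (om t has_real_derivative omx t x) (at x within {0..1}) \<and>
      ((\<lambda>s. rh s x) has_real_derivative rht t x) (at t within ?I) \<and>
      (rh t has_real_derivative rhx t x) (at x within {0..1})"
    if t: "t \<in> ?I" and x: "x \<in> {0..1}" for t x
  proof -
    obtain N t' where N: "t < t'" "good N t'" using good_beyond[OF t] .
    have t0: "0 \<le> t" "t \<le> t'" using t N by (auto simp: time_interval_Tstar)
    obtain Ot Ox Rt Rx where d: "\<And>t x. ((\<lambda>s. flow.Eul (H N) (w N) s x) has_real_derivative Ot t x) (at t)"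
      "\<And>t x. (flow.Eul (H N) (w N) t has_real_derivative Ox t x) (at x)"
      "\<And>t x. ((\<lambda>s. flow.Eul (H N) (\<lambda>_. r) s x) has_real_derivative Rt t x) (at t)"
      "\<And>t x. (flow.Eul (H N) (\<lambda>_. r) t has_real_derivative Rx t x) (at x)" and
      e: "\<And>t x. 0 \<le> t \<Longrightarrow> t \<le> t' \<Longrightarrow> 0 \<le> x \<Longrightarrow> x \<le> 1 \<Longrightarrow>
       omt t x = Ot t x \<and> omx t x = Ox t x \<and> rht t x = Rt t x \<and> rhx t x = Rx t x"
      by (rule slab[OF N(2)]) blast
    have e': "omt t x = Ot t x" "omx t x = Ox t x" "rht t x = Rt t x" "rhx t x = Rx t x"
      using e[OF t0] x by auto
    have near: "s \<in> ?I \<Longrightarrow> dist s t < t' - t \<Longrightarrow> 0 \<le> s \<and> s \<le> t'" for s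
      using N by (auto simp: time_interval_Tstar dist_real_def)
    have "((\<lambda>s. om s x) has_real_derivative Ot t x) (at t within ?I)"
      by (rule has_field_derivative_transform_within[OF has_field_derivative_at_within[OF d(1)], of "t' - t"])
         (use N t near om_rh_good(1)[OF N(2)] in auto)
    moreover have "((\<lambda>s. rh s x) has_real_derivative Rt t x) (at t within ?I)"
      by (rule has_field_derivative_transform_within[OF has_field_derivative_at_within[OF d(3)], of "t' - t"])
         (use N t near om_rh_good(2)[OF N(2)] in auto)
    moreover have "(om t has_real_derivative Ox t x) (at x within {0..1})"
      unfolding om_rh_good(1)[OF N(2) t0] by (rule has_field_derivative_at_within[OF d(2)])
    moreover have "(rh t has_real_derivative Rx t x) (at x within {0..1})"
      unfolding om_rh_good(2)[OF N(2) t0] by (rule has_field_derivative_at_within[OF d(4)])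
    ultimately show ?thesis unfolding e' by blast
  qed
  show "C1_with_partials (ereal Tstar) om omt omx" "C1_with_partials (ereal Tstar) rh rht rhx"
    unfolding C1_with_partials_def using cont der by blast+
qed

lemma om_rh_Sobolev:
  "continuous_Sobolev0 (ereal Tstar) m om" "continuous_Sobolev0 (ereal Tstar) m rh"
proof -
  have "\<exists>F G t'. (\<forall>n. Ck n F) \<and> (\<forall>n. Ck n G) \<and> t < t' \<and>
     (\<forall>s\<in>time_interval (ereal Tstar). s < t' \<longrightarrow> om s = F s \<and> F s \<in> C0_infty \<and> rh s = G s \<and> G s \<in> C0_infty)"
    if t: "t \<in> time_interval (ereal Tstar)" for t
  proof -
    obtain N t' where N: "t < t'" "good N t'" using good_beyond[OF t] .
    interpret F: flow "H N" "Ht N" a0 a1 by (rule flow_N)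
    have "Ck n (F.Eul (w N))" "Ck n (F.Eul (\<lambda>_. r))" for n
      by (intro F.Eul_Ck w_Ck r_Ck supp_w supp_r)+
    moreover have "F.Eul (w N) s \<in> C0_infty" "F.Eul (\<lambda>_. r) s \<in> C0_infty" for s
      by (intro F.Eul_C0_infty w_Ck r_Ck supp_w supp_r)+
    ultimately show ?thesis
      by (intro exI[of _ "F.Eul (w N)"] exI[of _ "F.Eul (\<lambda>_. r)"] exI[of _ t'])
         (use N om_rh_good[OF N(2)] in \<open>auto simp: time_interval_Tstar\<close>)
  qed
  then show "continuous_Sobolev0 (ereal Tstar) m om" "continuous_Sobolev0 (ereal Tstar) m rh"
    by (intro continuous_Sobolev0I; meson)+
qed

lemma om_boundary:
  assumes "t \<in> time_interval (ereal Tstar)"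
  shows "om t 0 = 0 \<and> om t 1 = 0 \<and> rh t 0 = 0 \<and> rh t 1 = 0"
proof -
  obtain N t' where N: "t < t'" "good N t'" using good_beyond[OF assms] .
  interpret F: flow "H N" "Ht N" a0 a1 by (rule flow_N)
  have t: "0 \<le> t" "t \<le> t'" using assms N by (auto simp: time_interval_Tstar)
  show ?thesis
    unfolding om_rh_good[OF N(2) t] using a01 by (simp add: F.Eul_def w_supp r_supp)
qed

lemma om_0: "om 0 x = 0"
proof -
  interpret F: flow "H 0" "Ht 0" a0 a1 by (rule flow_N)
  show ?thesis
    unfolding om_rh_good(1)[OF good_0[of 0] order_refl order_refl] by (simp add: F.Eul_def)
qed

lemma rh_0_C0_infty: "rh 0 \<in> C0_infty"
proof -
  interpret F: flow "H 0" "Ht 0" a0 a1 by (rule flow_N)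
  show ?thesis
    unfolding om_rh_good(2)[OF good_0[of 0] order_refl order_refl]
    by (intro F.Eul_C0_infty r_Ck supp_r)
qed

lemma om_rh_classical: "classical_solution (ereal Tstar) (\<lambda>_. 0) (rh 0) om rh"
  unfolding classical_solution_def
proof (intro conjI allI impI)
  show "0 < ereal Tstar" using Tstar_pos by simp
  show "\<exists>\<omega>t \<omega>x \<rho>t \<rho>x. C1_with_partials (ereal Tstar) om \<omega>t \<omega>x \<and> C1_with_partials (ereal Tstar) rh \<rho>t \<rho>x \<and>
     (\<forall>t\<in>time_interval (ereal Tstar). \<forall>x\<in>{0..1}.
        \<rho>t t x + velocity om t x * \<rho>x t x = 0 \<and> \<omega>t t x + velocity om t x * \<omega>x t x = \<rho>x t x)"
    by (intro exI[of _ omt] exI[of _ omx] exI[of _ rht] exI[of _ rhx] conjI om_C1 rh_C1)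
       (simp add: omt_def rht_def)
qed (use om_boundary om_0 om_rh_Sobolev in auto)

section \<open>Divergence of the vorticity integral\<close>

lemma om_lower: "good N t \<Longrightarrow> 0 \<le> s \<Longrightarrow> s \<le> t \<Longrightarrow> ennreal \<bar>w N s a\<bar> \<le> Linfty_norm (om s)"
proof (cases "0 < a")
  case False
  then show "ennreal \<bar>w N s a\<bar> \<le> Linfty_norm (om s)" using a01 by (simp add: w_supp)
next
  case True
  assume *: "good N t" "0 \<le> s" "s \<le> t"
  interpret F: flow "H N" "Ht N" a0 a1 by (rule flow_N)
  have om: "om s = F.Eul (w N) s" by (rule om_rh_good(1)[OF *])
  \<comment> \<open>The label \<open>a\<close> occupies this interior point at time
    \<open>s\<close>, and the vorticity there is \<open>w N s a\<close>.\<close>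
  have "ennreal \<bar>om s (exp (- F.Z s a))\<bar> \<le> Linfty_norm (om s)"
  proof (rule Linfty_norm_ge)
    show "continuous_on UNIV (om s)"
      unfolding om by (rule cts2_slice_right[OF F.Eul_cts2[OF w_cts2 supp_w]])
    show "exp (- F.Z s a) \<in> {0<..<1}" using F.Z_less_iff[of s 0 a] True by simp
  qed
  then show "ennreal \<bar>w N s a\<bar> \<le> Linfty_norm (om s)" by (simp add: om)
qed

text \<open>A continuation criterion of Beale-Kato-Majda type: \<open>h\<close> is the time integral
  of the vorticity along a trajectory, so unbounded \<open>h\<close> forces the integral of the norm
  to diverge.\<close>

lemma h_le_norm_integral:
  assumes "good N t"
  shows "ennreal \<bar>h N t a\<bar> \<le> (\<integral>\<^sup>+s\<in>{0..t}. Linfty_norm (om s) \<partial>lborel)"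
proof -
  have t: "0 \<le> t" using assms by (simp add: good_def)
  have c: "continuous_on {0..t} (\<lambda>s. w N s a)" by (rule cts2_slice_left[OF w_cts2])
  have "((\<lambda>s. w N s a) has_integral (h N t a - h N 0 a)) {0..t}"
    by (rule fundamental_theorem_of_calculus[OF t])
       (use h_t in \<open>auto simp: has_real_derivative_iff_has_vector_derivative[symmetric] intro: has_field_derivative_at_within\<close>)
  then have hint: "h N t a = integral {0..t} (\<lambda>s. w N s a)" by (simp add: integral_unique)
  have i: "set_integrable lborel {0..t} (\<lambda>s. w N s a)"
    by (rule borel_integrable_compact[OF _ c, folded set_integrable_def]) simp
  have "h N t a = (LINT s:{0..t}|lborel. w N s a)"
    unfolding hint by (rule set_borel_integral_eq_integral(2)[OF i, symmetric])
  then have "ennreal \<bar>h N t a\<bar> \<le> (\<integral>\<^sup>+s. norm (indicator {0..t} s *\<^sub>R w N s a) \<partial>lborel)"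
    using integral_norm_bound_ennreal[OF i[unfolded set_integrable_def]]
    by (simp add: set_lebesgue_integral_def)
  also have "\<dots> \<le> (\<integral>\<^sup>+s\<in>{0..t}. Linfty_norm (om s) \<partial>lborel)"
    by (rule nn_integral_mono) (use om_lower[OF assms] in \<open>auto simp: indicator_def\<close>)
  finally show ?thesis .
qed

lemma norm_integral_mono:
  "A \<subseteq> B \<Longrightarrow> (\<integral>\<^sup>+s\<in>A. Linfty_norm (om s) \<partial>lborel) \<le> (\<integral>\<^sup>+s\<in>B. Linfty_norm (om s) \<partial>lborel)"
  by (rule nn_integral_mono) (auto simp: indicator_def)

lemma norm_integral_unbounded:
  "\<exists>t. 0 \<le> t \<and> t < Tstar \<and> ennreal C < (\<integral>\<^sup>+s\<in>{0..t}. Linfty_norm (om s) \<partial>lborel)"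
proof -
  obtain t N a where t: "good N t" "\<bar>C\<bar> < \<bar>h N t a\<bar>" using h_unbounded by blast
  have "ennreal C \<le> ennreal \<bar>C\<bar>" by (intro ennreal_leI) simp
  also have "\<dots> < ennreal \<bar>h N t a\<bar>" using t(2) by (simp add: ennreal_less_iff)
  also have "\<dots> \<le> (\<integral>\<^sup>+s\<in>{0..t}. Linfty_norm (om s) \<partial>lborel)" by (rule h_le_norm_integral[OF t(1)])
  finally show ?thesis using good_less_Tstar[OF t(1)] t(1) by (auto simp: good_def)
qed

lemma norm_integral_infinite: "(\<integral>\<^sup>+s\<in>{0..<Tstar}. Linfty_norm (om s) \<partial>lborel) = \<infinity>"
proof (rule ccontr)
  assume "\<not> ?thesis"
  then obtain C where C: "(\<integral>\<^sup>+s\<in>{0..<Tstar}. Linfty_norm (om s) \<partial>lborel) = ennreal C"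
    by (cases "(\<integral>\<^sup>+s\<in>{0..<Tstar}. Linfty_norm (om s) \<partial>lborel)") auto
  obtain t where t: "0 \<le> t" "t < Tstar" "ennreal C < (\<integral>\<^sup>+s\<in>{0..t}. Linfty_norm (om s) \<partial>lborel)"
    using norm_integral_unbounded by blast
  have "(\<integral>\<^sup>+s\<in>{0..t}. Linfty_norm (om s) \<partial>lborel) \<le> ennreal C"
    unfolding C[symmetric] by (rule norm_integral_mono) (use t in auto)
  with t(3) show False by simp
qed

lemma norm_integral_tendsto:
  "((\<lambda>t. \<integral>\<^sup>+s\<in>{0..t}. Linfty_norm (om s) \<partial>lborel) \<longlongrightarrow> \<infinity>) (at_left Tstar)"
proof (rule order_tendstoI)
  fix y :: ennreal assume "y < \<infinity>"
  then obtain C where "y = ennreal C" by (cases y) auto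
  then obtain t0 where t0: "0 \<le> t0" "t0 < Tstar" "y < (\<integral>\<^sup>+s\<in>{0..t0}. Linfty_norm (om s) \<partial>lborel)"
    using norm_integral_unbounded by blast
  show "\<forall>\<^sub>F t in at_left Tstar. y < (\<integral>\<^sup>+s\<in>{0..t}. Linfty_norm (om s) \<partial>lborel)"
  proof (rule eventually_at_leftI[OF _ t0(2)])
    fix t assume "t \<in> {t0<..<Tstar}"
    then have "(\<integral>\<^sup>+s\<in>{0..t0}. Linfty_norm (om s) \<partial>lborel) \<le> (\<integral>\<^sup>+s\<in>{0..t}. Linfty_norm (om s) \<partial>lborel)"
      by (intro norm_integral_mono) auto
    with t0(3) show "y < (\<integral>\<^sup>+s\<in>{0..t}. Linfty_norm (om s) \<partial>lborel)" by simp
  qed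
qed simp

end

section \<open>Uniqueness\<close>

text \<open>Class C^1 is encoded by separate partial derivatives. Continuity of the spatial one
  gives joint differentiability, and with it the compactness bounds needed for an arbitrary
  competitor.\<close>

lemma C1_continuous:
  assumes "C1_with_partials T f ft fx"
  shows "continuous_on (time_interval T \<times> {0..1}) (\<lambda>(t, x). f t x)"
  unfolding continuous_on_eq_continuous_within
proof (intro ballI)
  fix p assume "p \<in> time_interval T \<times> {0..1::real}"
  then obtain t x where p: "p = (t, x)" "t \<in> time_interval T" "x \<in> {0..1}" by auto
  have c: "continuous_on (time_interval T \<times> {0..1}) (\<lambda>p. blinfun_mult_right ((\<lambda>(t, x). fx t x) p))"
    using assms unfolding C1_with_partials_def
    by (intro bounded_linear.continuous_on[OF bounded_linear_blinfun_mult_right]) blast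
  have "((\<lambda>(t, x). f t x) has_derivative (\<lambda>(tx, ty). ft t x * tx + blinfun_mult_right (fx t x) ty))
      (at (t, x) within time_interval T \<times> {0..1})"
  proof (rule has_derivative_partialsI[where fy = "\<lambda>t x. blinfun_mult_right (fx t x)"])
    show "((\<lambda>t. f t x) has_derivative (\<lambda>h. ft t x * h)) (at t within time_interval T)"
      using assms p unfolding C1_with_partials_def has_field_derivative_def by auto
    show "(f t has_derivative blinfun_apply (blinfun_mult_right (fx t x))) (at x within {0..1})"
      if "t \<in> time_interval T" "x \<in> {0..1}" for t x
      using assms that unfolding C1_with_partials_def has_field_derivative_def by auto
    show "continuous (at (t, x) within time_interval T \<times> {0..1}) (\<lambda>(t, x). blinfun_mult_right (fx t x))"
      using c p by (simp add: continuous_on_eq_continuous_within case_prod_beta')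
  qed (use p in auto)
  then show "continuous (at p within time_interval T \<times> {0..1}) (\<lambda>(t, x). f t x)"
    unfolding p(1) by (rule has_derivative_continuous)
qed

lemma bounded_on_slab:
  fixes f :: "real \<Rightarrow> real \<Rightarrow> real"
  assumes "continuous_on (time_interval T \<times> {0..1}) (\<lambda>(t, x). f t x)" "ereal t1 < T"
  shows "\<exists>M\<ge>0. \<forall>t\<in>{0..t1}. \<forall>x\<in>{0..1}. \<bar>f t x\<bar> \<le> M"
proof -
  have "{0..t1} \<times> {0..1} \<subseteq> time_interval T \<times> {0..1::real}"
    using assms(2) by (auto simp: time_interval_def) (metis ereal_less_eq(3) le_less_trans)
  then have "bounded ((\<lambda>(t, x). f t x) ` ({0..t1} \<times> {0..1::real}))"
    by (intro compact_imp_bounded compact_continuous_image continuous_on_subset[OF assms(1)] compact_Times compact_Icc)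
  then obtain M where "\<forall>y\<in>(\<lambda>(t, x). f t x) ` ({0..t1} \<times> {0..1::real}). norm y \<le> M"
    unfolding bounded_iff by blast
  note M = bspec[OF this]
  have "\<bar>f t x\<bar> \<le> \<bar>M\<bar>" if "t \<in> {0..t1}" "x \<in> {0..1}" for t x
    using M[OF image_eqI[of "f t x" _ "(t, x)"]] that by simp
  then show ?thesis by (intro exI[of _ "\<bar>M\<bar>"]) auto
qed

lemma prim_const [simp]: "prim (\<lambda>_. c) x = x * c"
  by (simp add: prim_def)

text \<open>A second solution with the same data, on a time interval \<open>[0, t1]\<close> before the blow-up.\<close>

locale competitor = data +
  fixes om' rh' omt' omx' rht' rhx' :: "real \<Rightarrow> real \<Rightarrow> real" and t1 M :: real and N :: nat
  assumes t1: "0 \<le> t1" and M: "0 \<le> M" and N: "good N t1" "t1 * M \<le> real N"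
    and om'_cont: "continuous_on ({0..t1} \<times> {0..1}) (\<lambda>(t, x). om' t x)"
    and omx'_cont: "continuous_on ({0..t1} \<times> {0..1}) (\<lambda>(t, x). omx' t x)"
    and rhx'_cont: "continuous_on ({0..t1} \<times> {0..1}) (\<lambda>(t, x). rhx' t x)"
    and om'_bound: "\<And>t x. t \<in> {0..t1} \<Longrightarrow> x \<in> {0..1} \<Longrightarrow> \<bar>om' t x\<bar> \<le> M"
    and omx'_bound: "\<And>t x. t \<in> {0..t1} \<Longrightarrow> x \<in> {0..1} \<Longrightarrow> \<bar>omx' t x\<bar> \<le> M"
    and om'_t: "\<And>t x. t \<in> {0..t1} \<Longrightarrow> x \<in> {0..1} \<Longrightarrow> ((\<lambda>s. om' s x) has_real_derivative omt' t x) (at t within {0..t1})"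
    and om'_x: "\<And>t x. t \<in> {0..t1} \<Longrightarrow> x \<in> {0..1} \<Longrightarrow> (om' t has_real_derivative omx' t x) (at x within {0..1})"
    and rh'_t: "\<And>t x. t \<in> {0..t1} \<Longrightarrow> x \<in> {0..1} \<Longrightarrow> ((\<lambda>s. rh' s x) has_real_derivative rht' t x) (at t within {0..t1})"
    and rh'_x: "\<And>t x. t \<in> {0..t1} \<Longrightarrow> x \<in> {0..1} \<Longrightarrow> (rh' t has_real_derivative rhx' t x) (at x within {0..1})"
    and pde: "\<And>t x. t \<in> {0..t1} \<Longrightarrow> x \<in> {0..1} \<Longrightarrow> rht' t x + velocity om' t x * rhx' t x = 0 \<and>
        omt' t x + velocity om' t x * omx' t x = rhx' t x"
    and bc: "\<And>t. t \<in> {0..t1} \<Longrightarrow> om' t 0 = 0 \<and> om' t 1 = 0 \<and> rh' t 0 = 0 \<and> rh' t 1 = 0"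
    and init: "\<And>x. x \<in> {0..1} \<Longrightarrow> om' 0 x = 0 \<and> rh' 0 x = rh 0 x"
begin

text \<open>The vorticity of the competitor in the coordinate z = -ln x. Clamping time to
  \<open>[0, t1]\<close> and z to nonnegative values extends it continuously to the whole plane, as
  the fixed point requires, with \<open>M\<close> both as bound and as Lipschitz constant.\<close>

definition W :: "real \<Rightarrow> real \<Rightarrow> real" where
  "W t z = om' (max 0 (min t1 t)) (exp (- max z 0))"

lemma W_cts2: "cts2 W"
proof -
  let ?c = "\<lambda>p. (max 0 (min t1 (fst p)), exp (- max (snd p) 0)) :: real \<times> real"
  have c: "continuous_on UNIV ?c"
    by (intro continuous_intros)
  have "range ?c \<subseteq> {0..t1} \<times> {0..1}"
    using t1 by auto
  from continuous_on_compose2[OF om'_cont c this]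
  show ?thesis unfolding cts2_def W_def by simp
qed

lemma W_bound: "\<bar>W t z\<bar> \<le> M"
  unfolding W_def by (rule om'_bound) (use t1 in auto)

lemma W_lipschitz: "\<bar>W t y - W t z\<bar> \<le> M * \<bar>y - z\<bar>"
proof -
  let ?s = "max 0 (min t1 t)"
  have s: "?s \<in> {0..t1}" using t1 by auto
  let ?e = "\<lambda>z. exp (- max z (0::real))"
  have 1: "norm (om' ?s (?e y) - om' ?s (?e z)) \<le> M * norm (?e y - ?e z)"
    by (rule field_differentiable_bound[of "{0..1}" _ "omx' ?s"]) (use s om'_x omx'_bound in auto)
  have 2: "\<bar>?e y - ?e z\<bar> \<le> exp 0 * \<bar>- max y 0 - - max z 0\<bar>"
    by (rule exp_lipschitz) auto
  have 3: "\<bar>- max y 0 - - max z 0\<bar> \<le> \<bar>y - z\<bar>" by auto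
  have 4: "norm (?e y - ?e z) \<le> \<bar>y - z\<bar>"
    unfolding real_norm_def using 2 3 by (simp only: exp_zero mult_1)
  show ?thesis
    unfolding W_def real_norm_def[symmetric]
    by (rule order_trans[OF 1 mult_left_mono[OF _ M]]) (use 4 in \<open>simp only: real_norm_def\<close>)
qed

lemma W_0: "W t 0 = 0"
  using bc[of "max 0 (min t1 t)"] t1 by (simp add: W_def)

lemma W_eq: "t \<in> {0..t1} \<Longrightarrow> 0 \<le> z \<Longrightarrow> W t z = om' t (exp (- z))"
  by (auto simp: W_def max_def min_def)

definition Zc :: "(real \<Rightarrow> real \<Rightarrow> real) \<Rightarrow> real \<Rightarrow> real \<Rightarrow> real" where
  "Zc f t a = prim (\<lambda>b. exp (cutoff N (f t b))) a"

text \<open>The flow of the competitor is obtained together with the logarithm \<open>k\<close> of its Jacobian,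
  as a fixed point, so that no differentiability of a flow with respect to its initial value
  has to be established.\<close>

lemma jacobian_exists:
  obtains k where "cts2 k" "\<And>t a. k t a = prim (\<lambda>s. W s (Zc k s a)) t"
proof -
  obtain R Gm B L where "truncated g (cutoff N) R Gm B L" using truncated_ex by blast
  then interpret T: truncated g "cutoff N" R Gm B L .
  have ZT: "Zc f = T.Zt f" for f by (intro ext) (simp add: Zc_def T.Zt_def)
  define \<Lambda> where "\<Lambda> = M * exp B * L + 1"
  have MBL: "0 \<le> M * exp B * L" using M T.L_nonneg by simp
  then have \<Lambda>: "1 \<le> \<Lambda>" by (simp add: \<Lambda>_def)
  \<comment> \<open>\<open>Zc\<close> integrates over a segment of length |a|, so its Lipschitz
    constant grows linearly with the label and the rate must follow. The weight then increases with
    |a|, and its value at \<open>a\<close> dominates those on the segment.\<close>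
  define m where "m = (\<lambda>(s::real) a. \<Lambda> * (1 + \<bar>a\<bar>))"
  have m: "cts2 m" unfolding m_def by (intro cts2_mult cts2_add cts2_abs cts2_const cts2_snd)
  have m1: "1 \<le> m s a" for s a
    using mult_mono[OF \<Lambda>, of 1 "1 + \<bar>a\<bar>"] \<Lambda> by (simp add: m_def)
  have m0: "0 \<le> m s a" for s a using m1[of s a] by linarith
  have wm: "weight m t b \<le> weight m t a" if "\<bar>b\<bar> \<le> \<bar>a\<bar>" for t a b
    using that \<Lambda> by (auto simp: weight_def m_def abs_mult intro!: mult_left_mono)
  show ?thesis
  proof (rule volterra_fixpoint[OF m m0, where F = "\<lambda>f t a. W t (Zc f t a)" and ?C0.0 = M])
    show "m (- s) a = m s a" for s a by (simp add: m_def)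
    show "cts2 (\<lambda>t a. W t (Zc f t a))" if "cts2 f" for f
      unfolding ZT by (rule cts2_comp[OF W_cts2 cts2_fst T.Zt_cts2[OF that]])
    show "0 \<le> M" by (rule M)
    show "\<bar>W t (Zc (\<lambda>_ _. 0) t a)\<bar> \<le> M * m t a * weight m t a" for t a
    proof -
      have "1 * 1 \<le> m t a * weight m t a" by (intro mult_mono m1 weight_ge_1 m0) simp
      then have "M * 1 \<le> M * (m t a * weight m t a)" using M by (intro mult_left_mono) auto
      with W_bound[of t "Zc (\<lambda>_ _. 0) t a"] show ?thesis by (simp add: mult.assoc)
    qed
    fix h1 h2 C t a
    assume h: "cts2 h1" "cts2 h2" "0 \<le> C" "\<And>t a. \<bar>h1 t a - h2 t a\<bar> \<le> C * weight m t a"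
    have "\<bar>Zc h1 t a - Zc h2 t a\<bar> \<le> \<bar>a\<bar> * (exp B * (L * (C * weight m t a)))"
      unfolding ZT
    proof (rule T.Zt_lipschitz[OF h(1,2)])
      fix b assume "b \<in> closed_segment 0 a"
      then have "\<bar>b\<bar> \<le> \<bar>a\<bar>" by (auto simp: closed_segment_eq_real_ivl split: if_splits)
      from wm[OF this] have "C * weight m t b \<le> C * weight m t a" using h(3) by (rule mult_left_mono)
      with h(4)[of t b] show "\<bar>h1 t b - h2 t b\<bar> \<le> C * weight m t a" by linarith
    qed
    then have "M * \<bar>Zc h1 t a - Zc h2 t a\<bar> \<le> M * (\<bar>a\<bar> * (exp B * (L * (C * weight m t a))))"
      using M by (rule mult_left_mono)
    also have "\<dots> = (M * exp B * L) * \<bar>a\<bar> * (C * weight m t a)" by (simp add: mult_ac)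
    also have "\<dots> \<le> m t a * (C * weight m t a)"
    proof (rule mult_right_mono)
      show "(M * exp B * L) * \<bar>a\<bar> \<le> m t a"
        unfolding m_def by (rule mult_mono) (use MBL in \<open>auto simp: \<Lambda>_def\<close>)
      show "0 \<le> C * weight m t a" using h(3) weight_ge_1[of m t a] by simp
    qed
    finally show "\<bar>W t (Zc h1 t a) - W t (Zc h2 t a)\<bar> \<le> C * m t a * weight m t a"
      using W_lipschitz[of t "Zc h1 t a" "Zc h2 t a"] by (simp add: mult_ac)
  next
    fix k assume "cts2 k" "\<And>t a. k t a = prim (\<lambda>s. W s (Zc k s a)) t"
    then show ?thesis by (rule that)
  qed
qed

text \<open>The substitution y = e^(-z) in the defining integral, carried out through the primitive
  of the integrand.\<close>

lemma Omega_competitor: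
  assumes t: "t \<in> {0..t1}" and x: "0 < x" "x \<le> 1"
  shows "Omega om' t x = prim (W t) (- ln x)"
proof -
  have c: "continuous_on UNIV (W t)" by (rule cts2_slice_right[OF W_cts2])
  have d: "((\<lambda>y. - prim (W t) (- ln y)) has_real_derivative om' t y / y) (at y within {x..1})"
    if "y \<in> {x..1}" for y
  proof -
    have y: "0 < y" "y \<le> 1" using that x by auto
    have "((\<lambda>y. - ln y) has_real_derivative - (1 / y)) (at y within {x..1})"
      using y by (auto intro!: derivative_eq_intros)
    from DERIV_minus[OF prim_deriv_comp[OF c this]]
    have "((\<lambda>y. - prim (W t) (- ln y)) has_real_derivative - (W t (- ln y) * - (1 / y))) (at y within {x..1})" .
    moreover have "W t (- ln y) = om' t y" using W_eq[OF t, of "- ln y"] y by simp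
    ultimately show ?thesis by simp
  qed
  have "((\<lambda>y. om' t y / y) has_integral (- prim (W t) (- ln 1) - - prim (W t) (- ln x))) {x..1}"
    by (rule fundamental_theorem_of_calculus[OF x(2)])
       (use d in \<open>auto simp: has_real_derivative_iff_has_vector_derivative\<close>)
  moreover have "continuous_on {x..1} (\<lambda>y. om' t y / y)"
  proof (intro continuous_intros)
    have "continuous_on {0..1} (om' t)" using om'_x[OF t] DERIV_continuous_on by blast
    then show "continuous_on {x..1} (om' t)" by (rule continuous_on_subset) (use x in auto)
  qed (use x in auto)
  then have "set_integrable lebesgue {x..1} (\<lambda>y. om' t y / y)"
    by (rule absolutely_integrable_continuous_real)
  ultimately show ?thesis
    by (simp add: Omega_def set_lebesgue_integral_eq_integral(2) integral_unique)
qed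

lemma competitor_eq:
  assumes t: "t \<in> {0..t1}" and x: "x \<in> {0..1}"
  shows "om' t x = om t x" "rh' t x = rh t x"
proof -
  obtain k where k: "cts2 k" "\<And>t a. k t a = prim (\<lambda>s. W s (Zc k s a)) t"
    by (rule jacobian_exists) blast
  define Z where "Z = Zc k"
  have J_cts2: "cts2 (\<lambda>t b. exp (cutoff N (k t b)))"
    by (intro cts2_exp cts2_fun_comp[OF cutoff_cont] k)
  have Z_cts2: "cts2 Z" unfolding Z_def Zc_def by (rule prim_cts2[OF J_cts2])
  have WZ_cts2: "cts2 (\<lambda>t a. W t (Z t a))" by (rule cts2_comp[OF W_cts2 cts2_fst Z_cts2])
  have k_t: "((\<lambda>t. k t a) has_real_derivative W t (Z t a)) (at t)" for t a
    using prim_deriv[OF cts2_slice_left[OF WZ_cts2], of a t] k(2)[of _ a] by (simp add: Z_def)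
  \<comment> \<open>Here \<open>t1 * M \<le> real N\<close> enters: the competitor's own bound keeps
    \<open>k\<close> where the cutoff is the identity, before any relation to \<open>h\<close> is
    known.\<close>
  have k_bound: "\<bar>k t a\<bar> \<le> real N" if "t \<in> {0..t1}" for t a
  proof -
    have "\<bar>k t a\<bar> \<le> \<bar>t\<bar> * M"
      unfolding k(2)[of t a] Z_def[symmetric] by (intro prim_abs_le cts2_slice_left[OF WZ_cts2] W_bound)
    also have "\<dots> \<le> t1 * M" using that M by (intro mult_right_mono) auto
    finally show ?thesis using N(2) by linarith
  qed
  have cut: "cutoff N (k t a) = k t a" "deriv (cutoff N) (k t a) = 1" if "t \<in> {0..t1}" for t a
    using k_bound[OF that, of a] by (auto intro: cutoff_id cutoff_deriv_1)
  have Z_0 [simp]: "Z t 0 = 0" for t by (simp add: Z_def Zc_def)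
  have Z_a: "(Z t has_real_derivative exp (k t a)) (at a)" if "t \<in> {0..t1}" for t a
    using prim_deriv[OF cts2_slice_right[OF J_cts2], of t a] cut[OF that]
    by (simp add: Z_def Zc_def[abs_def])
  have Z_nonneg: "0 \<le> Z t a" if "0 \<le> a" for t a
    unfolding Z_def Zc_def using that by (intro prim_nonneg cts2_slice_right[OF J_cts2]) auto
  \<comment> \<open>Differentiation under the integral produces W(Z) e^k, which is the label
    derivative of \<open>prim (W t) (Z t a)\<close>. Hence \<open>Z\<close> moves with the
    competitor's velocity.\<close>
  have Z_t: "((\<lambda>t. Z t a) has_real_derivative prim (W t) (Z t a)) (at t)" if t: "t \<in> {0..t1}" for t a
  proof -
    define f' where "f' = (\<lambda>t b. exp (cutoff N (k t b)) * (deriv (cutoff N) (k t b) * W t (Z t b)))"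
    have "((\<lambda>t. prim (\<lambda>b. exp (cutoff N (k t b))) a) has_real_derivative prim (f' t) a) (at t)"
    proof (rule prim_param_deriv[OF _ J_cts2])
      show "((\<lambda>t. exp (cutoff N (k t b))) has_real_derivative f' t b) (at t)" for t b
        unfolding f'_def by (rule DERIV_chain2[OF DERIV_exp DERIV_chain2[OF cutoff_deriv k_t]])
      show "cts2 f'" unfolding f'_def
        by (intro cts2_mult J_cts2 WZ_cts2 cts2_fun_comp[OF cutoff_deriv_cont] k)
    qed
    moreover have "prim (f' t) a = prim (W t) (Z t a) - prim (W t) (Z t 0)"
    proof (rule prim_FTC)
      show "((\<lambda>b. prim (W t) (Z t b)) has_real_derivative f' t b) (at b)" for b
        using DERIV_chain2[OF prim_deriv[OF cts2_slice_right[OF W_cts2]] Z_a[OF t], of t b]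
        by (simp add: f'_def cut[OF t] mult.commute)
    qed
    ultimately show ?thesis by (simp add: Z_def Zc_def[abs_def])
  qed
  define X where "X = (\<lambda>t a. exp (- Z t a))"
  have X01: "X t a \<in> {0..1}" "0 < X t a" if "0 \<le> a" for t a
    using Z_nonneg[OF that, of t] by (auto simp: X_def)
  have vel: "velocity om' t (X t a) = - X t a * prim (W t) (Z t a)" if "t \<in> {0..t1}" "0 \<le> a" for t a
    using Omega_competitor[OF that(1), of "X t a"] X01[OF that(2), of t] by (simp add: velocity_def X_def)
  have X_t: "((\<lambda>t. X t a) has_real_derivative velocity om' t (X t a)) (at t within {0..t1})"
    if "t \<in> {0..t1}" "0 \<le> a" for t a
    unfolding vel[OF that] unfolding X_def
    using DERIV_chain2[OF DERIV_exp DERIV_minus[OF Z_t[OF that(1), of a]]]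
    by (auto intro: has_field_derivative_at_within)
  have rh_flow: "rh' t (X t a) = r a" if t: "t \<in> {0..t1}" and a: "0 \<le> a" for t a
  proof -
    have "((\<lambda>s. rh' s (X s a)) has_real_derivative 0) (at s within {0..t1})" if s: "s \<in> {0..t1}" for s
    proof -
      have "((\<lambda>s. rh' s (X s a)) has_real_derivative rht' s (X s a) + rhx' s (X s a) * velocity om' s (X s a)) (at s within {0..t1})"
        by (rule DERIV_along_curve[where Y = "{0..1}" and f = rh' and fx = rhx' and \<gamma> = "\<lambda>s. X s a"])
           (use rh'_t rh'_x rhx'_cont X_t[OF s a] s X01[OF a] in auto)
      moreover have "rht' s (X s a) + velocity om' s (X s a) * rhx' s (X s a) = 0"
        using pde[OF s X01(1)[OF a]] by blast
      ultimately show ?thesis by (simp add: mult.commute)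
    qed
    then obtain c where c: "\<And>s. s \<in> {0..t1} \<Longrightarrow> rh' s (X s a) = c"
      using has_field_derivative_zero_constant[of "{0..t1}" "\<lambda>s. rh' s (X s a)"] by auto
    interpret F: flow "H 0" "Ht 0" a0 a1 by (rule flow_N)
    have "k 0 b = 0" for b by (subst k) simp
    then have "Z 0 a = a" by (simp add: Z_def Zc_def cutoff_id)
    moreover have "F.Z 0 a = a" by (simp add: F.Z_def H_def cutoff_id)
    ultimately have "rh 0 (X 0 a) = r a"
      unfolding om_rh_good(2)[OF good_0[of 0] order_refl order_refl] X_def
      using F.Eul_flow[of "\<lambda>_. r" 0 a] by simp
    moreover have "rh' 0 (X 0 a) = rh 0 (X 0 a)" using init[OF X01(1)[OF a]] by blast
    ultimately show ?thesis using c[OF t] c[of 0] t1 by simp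
  qed
  \<comment> \<open>Conservation of density is differentiated in the label, and division by the
    nonzero factor X e^k isolates the slope. Working on the open half line of labels makes the
    derivative there two-sided.\<close>
  have rhx_flow: "rhx' t (X t a) = Gt N k t a" if t: "t \<in> {0..t1}" and a: "0 < a" for t a
  proof -
    have dX: "(X t has_real_derivative - X t a * exp (k t a)) (at a within {0<..})"
      using DERIV_chain2[OF DERIV_exp DERIV_minus[OF Z_a[OF t, of a]]]
      by (auto simp: X_def intro: has_field_derivative_at_within)
    have "(rh' t has_real_derivative rhx' t (X t a)) (at (X t a) within X t ` {0<..})"
      by (rule has_field_derivative_subset[OF rh'_x[OF t X01(1)]]) (use a X01(1) in \<open>auto simp: less_imp_le\<close>)
    from DERIV_image_chain[OF this dX]
    have "(rh' t \<circ> X t has_real_derivative rhx' t (X t a) * (- X t a * exp (k t a))) (at a)"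
      using a by (simp add: at_within_open[of a "{0<..}"])
    then have "(r has_real_derivative rhx' t (X t a) * (- X t a * exp (k t a))) (at a)"
      by (rule has_field_derivative_transform_within_open[of _ _ _ "{0<..}"])
         (use a rh_flow[OF t] in auto)
    from DERIV_unique[OF this r_deriv] have "rhx' t (X t a) * (X t a * exp (k t a)) = g a" by simp
    moreover have "Gt N k t a * (X t a * exp (k t a)) = g a"
    proof -
      have "Gt N k t a = g a * exp (Z t a) * exp (- k t a)"
        by (simp add: Gt_eq Z_def Zc_def cut[OF t])
      then show ?thesis by (simp add: X_def exp_minus field_simps)
    qed
    moreover have "X t a * exp (k t a) \<noteq> 0" by (simp add: X_def)
    ultimately show ?thesis by (metis mult_right_cancel)
  qed
  have om_flow: "om' t (X t a) = prim (\<lambda>s. Gt N k s a) t" if t: "t \<in> {0..t1}" and a: "0 < a" for t a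
  proof -
    have sub: "closed_segment 0 t \<subseteq> {0..t1}" using t by (auto simp: closed_segment_eq_real_ivl)
    have "prim (\<lambda>s. Gt N k s a) t = om' t (X t a) - om' 0 (X 0 a)"
    proof (rule prim_FTC_segment)
      fix s assume "s \<in> closed_segment 0 t"
      then have s: "s \<in> {0..t1}" using sub by blast
      have "((\<lambda>s. om' s (X s a)) has_real_derivative omt' s (X s a) + omx' s (X s a) * velocity om' s (X s a)) (at s within {0..t1})"
        by (rule DERIV_along_curve[where Y = "{0..1}" and f = om' and fx = omx' and \<gamma> = "\<lambda>s. X s a"])
           (use om'_t om'_x omx'_cont X_t[OF s] s X01 a in auto)
      moreover have "omt' s (X s a) + velocity om' s (X s a) * omx' s (X s a) = rhx' s (X s a)"
        using pde[OF s X01(1)] a by simp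
      ultimately have "((\<lambda>s. om' s (X s a)) has_real_derivative Gt N k s a) (at s within {0..t1})"
        using rhx_flow[OF s a] by (simp add: mult.commute)
      then show "((\<lambda>s. om' s (X s a)) has_real_derivative Gt N k s a) (at s within closed_segment 0 t)"
        by (rule has_field_derivative_subset[OF _ sub])
    qed
    moreover have "om' 0 (X 0 a) = 0" using init[OF X01(1)] a by simp
    ultimately show ?thesis by simp
  qed
  \<comment> \<open>The time derivative of \<open>k\<close> is the vorticity, whose own time
    derivative along the trajectory is \<open>Gt\<close>. So \<open>k\<close> solves the same
    second-order equation as \<open>h N\<close>, and uniqueness applies.\<close>
  have k_eq: "k t a = prim2 (\<lambda>s. Gt N k s a) t" if t: "0 \<le> t" "t \<le> t1" and a: "0 \<le> a" for t a
  proof (cases "a = 0")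
    case True
    have "g 0 = 0" using g_supp a01 by simp
    then show ?thesis using True k(2)[of t 0] by (simp add: Gt_eq W_0 Z_def[symmetric])
  next
    case False
    show ?thesis
      unfolding prim2_def k(2)[of t a]
    proof (rule prim_cong)
      fix s assume "s \<in> closed_segment 0 t"
      then have s: "s \<in> {0..t1}" using t by (auto simp: closed_segment_eq_real_ivl)
      show "W s (Zc k s a) = prim (\<lambda>s. Gt N k s a) s"
        using om_flow[OF s, of a] W_eq[OF s Z_nonneg[OF a]] a False by (simp add: X_def Z_def)
    qed
  qed
  have kh: "k t a = h N t a" if "t \<in> {0..t1}" "0 \<le> a" for t a
    by (rule h_unique[OF k(1), of t1 a]) (use k_eq that in auto)
  show "om' t x = om t x" "rh' t x = rh t x"
  proof -
    interpret F: flow "H N" "Ht N" a0 a1 by (rule flow_N)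
    have om: "om t = F.Eul (w N) t" "rh t = F.Eul (\<lambda>_. r) t"
      using om_rh_good[OF N(1)] t by auto
    have "om' t x = om t x \<and> rh' t x = rh t x"
    proof (cases "x = 0")
      case True
      then show ?thesis using bc[OF t] by (simp add: om F.Eul_def)
    next
      case False
      with x have x: "0 < x" "x \<le> 1" by auto
      define a where "a = F.Lab t x"
      have a: "0 \<le> a"
        using F.A_less[of t "- ln x" 0] x unfolding a_def F.Lab_def by (simp add: not_less[symmetric])
      have Ga: "Gt N k s a = Gt N (h N) s a" if s: "s \<in> {0..t1}" for s
        using kh[OF s] a unfolding Gt_eq
        by (intro arg_cong2[where f = "(*)"] arg_cong[where f = exp] prim_cong refl)
           (auto simp: closed_segment_eq_real_ivl)
      have "Z t a = F.Z t a"
        unfolding Z_def Zc_def F.Z_def H_def using kh[OF t] a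
        by (intro prim_cong) (auto simp: closed_segment_eq_real_ivl)
      then have Xa: "X t a = x" using x by (simp add: X_def a_def F.Lab_def)
      have e: "om t x = w N t a" "rh t x = r a" using x by (simp_all add: om F.Eul_def a_def)
      have "rh' t x = r a" using rh_flow[OF t a] Xa by simp
      moreover have "om' t x = w N t a"
      proof (cases "a = 0")
        case True
        then have "x = 1" using Xa by (simp add: X_def)
        then show ?thesis using bc[OF t] w_supp a01 True by simp
      next
        case False
        then have "om' t x = prim (\<lambda>s. Gt N k s a) t" using om_flow[OF t, of a] Xa a by simp
        also have "\<dots> = w N t a"
          unfolding w_def by (intro prim_cong Ga) (use t in \<open>auto simp: closed_segment_eq_real_ivl\<close>)
        finally show ?thesis .
      qed
      ultimately show ?thesis using e by simp
    qed
    then show "om' t x = om t x" "rh' t x = rh t x" by blast+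
  qed
qed

end

section \<open>Maximality of the solution\<close>

context blowup_data
begin

text \<open>Two levels come together: one at which the constructed solution is uncut up to
  \<open>t\<close>, and one large enough for the bounds on the competitor. Their maximum does
  both.\<close>

lemma classical_unique:
  assumes sol: "classical_solution T' (\<lambda>_. 0) (rh 0) om' rh'"
    and t: "0 \<le> t" "ereal t < T'" "t < Tstar" and x: "x \<in> {0..1}"
  shows "om' t x = om t x \<and> rh' t x = rh t x"
proof -
  from sol obtain omt' omx' rht' rhx' where
    C1: "C1_with_partials T' om' omt' omx'" "C1_with_partials T' rh' rht' rhx'" and
    pde: "\<And>t x. t \<in> time_interval T' \<Longrightarrow> x \<in> {0..1} \<Longrightarrow>
       rht' t x + velocity om' t x * rhx' t x = 0 \<and> omt' t x + velocity om' t x * omx' t x = rhx' t x"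
    unfolding classical_solution_def by blast
  have sub: "{0..t} \<subseteq> time_interval T'"
    using t(2) by (auto simp: time_interval_def) (metis ereal_less_eq(3) le_less_trans)
  have sub2: "{0..t} \<times> {0..1} \<subseteq> time_interval T' \<times> {0..1::real}" using sub by auto
  note D = C1[unfolded C1_with_partials_def]
  have cont: "continuous_on (time_interval T' \<times> {0..1}) (\<lambda>(t, x). omx' t x)"
    "continuous_on (time_interval T' \<times> {0..1}) (\<lambda>(t, x). rhx' t x)" using D by blast+
  obtain M1 where M1: "0 \<le> M1" "\<forall>s\<in>{0..t}. \<forall>x\<in>{0..1}. \<bar>om' s x\<bar> \<le> M1"
    using bounded_on_slab[OF C1_continuous[OF C1(1)] t(2)] by blast
  obtain M2 where M2: "0 \<le> M2" "\<forall>s\<in>{0..t}. \<forall>x\<in>{0..1}. \<bar>omx' s x\<bar> \<le> M2"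
    using bounded_on_slab[OF cont(1) t(2)] by blast
  obtain N1 where N1: "good N1 t" using less_Tstar_good[OF t(1,3)] by blast
  obtain N2 :: nat where N2: "t * (M1 + M2) \<le> real N2" using real_arch_simple by blast
  have der: "((\<lambda>s. om' s x) has_real_derivative omt' s x) (at s within {0..t})"
    "(om' s has_real_derivative omx' s x) (at x within {0..1})"
    "((\<lambda>s. rh' s x) has_real_derivative rht' s x) (at s within {0..t})"
    "(rh' s has_real_derivative rhx' s x) (at x within {0..1})"
    if "s \<in> {0..t}" "x \<in> {0..1}" for s x
    using D sub that by (blast intro: has_field_derivative_subset)+
  interpret competitor r a0 a1 om' rh' omt' omx' rht' rhx' t "M1 + M2" "max N1 N2"
  proof
    show "good (max N1 N2) t" by (rule good_le[OF N1]) simp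
    show "t * (M1 + M2) \<le> real (max N1 N2)" using N2 by simp
    show "continuous_on ({0..t} \<times> {0..1}) (\<lambda>(t, x). om' t x)"
      by (rule continuous_on_subset[OF C1_continuous[OF C1(1)] sub2])
    show "continuous_on ({0..t} \<times> {0..1}) (\<lambda>(t, x). omx' t x)"
      by (rule continuous_on_subset[OF cont(1) sub2])
    show "continuous_on ({0..t} \<times> {0..1}) (\<lambda>(t, x). rhx' t x)"
      by (rule continuous_on_subset[OF cont(2) sub2])
    show "\<bar>om' s x\<bar> \<le> M1 + M2" "\<bar>omx' s x\<bar> \<le> M1 + M2" if "s \<in> {0..t}" "x \<in> {0..1}" for s x
      using M1 M2 that by (fastforce intro: order_trans)+
    show "om' s 0 = 0 \<and> om' s 1 = 0 \<and> rh' s 0 = 0 \<and> rh' s 1 = 0" if "s \<in> {0..t}" for s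
      using sol sub that unfolding classical_solution_def by blast
    show "om' 0 x = 0 \<and> rh' 0 x = rh 0 x" if "x \<in> {0..1}" for x
      using sol that unfolding classical_solution_def by blast
  qed (use t(1) M1(1) M2(1) der pde sub in \<open>auto intro: add_nonneg_nonneg\<close>)
  from competitor_eq[of t x] t(1) x show ?thesis by simp
qed

text \<open>A solution reaching past \<open>Tstar\<close> would be continuous, hence bounded, on the
  compact slab up to \<open>Tstar\<close>. Before \<open>Tstar\<close> it agrees with the
  constructed one, whose norm would then have a finite time integral.\<close>

lemma classical_lifespan:
  assumes sol: "classical_solution T' (\<lambda>_. 0) (rh 0) om' rh'"
  shows "T' \<le> ereal Tstar"
proof (rule ccontr)
  assume "\<not> ?thesis"
  then have T': "ereal Tstar < T'" by simp
  obtain omt' omx' where "C1_with_partials T' om' omt' omx'"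
    using sol unfolding classical_solution_def by blast
  from bounded_on_slab[OF C1_continuous[OF this] T']
  obtain M where M: "0 \<le> M" "\<And>t x. t \<in> {0..Tstar} \<Longrightarrow> x \<in> {0..1} \<Longrightarrow> \<bar>om' t x\<bar> \<le> M" by blast
  have le: "Linfty_norm (om t) \<le> ennreal M" if t: "0 \<le> t" "t < Tstar" for t
  proof -
    obtain N where N: "good N t" using less_Tstar_good[OF t] by blast
    interpret F: flow "H N" "Ht N" a0 a1 by (rule flow_N)
    have "continuous_on UNIV (om t)"
      unfolding om_rh_good(1)[OF N t(1) order_refl]
      by (rule cts2_slice_right[OF F.Eul_cts2[OF w_cts2 supp_w]])
    then have "om t \<in> borel_measurable unit_measure"
      by (intro measurable_restrict_space1 measurable_completion) (simp add: borel_measurable_continuous_onI)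
    then have meas: "(\<lambda>x. ennreal \<bar>om t x\<bar>) \<in> borel_measurable unit_measure" by measurable
    have "\<bar>om t x\<bar> \<le> M" if "x \<in> {0<..<1}" for x
    proof -
      have "ereal t < T'" using t(2) T' by (meson ereal_less(2) less_ereal.simps(1) less_trans)
      then have "om' t x = om t x" using classical_unique[OF sol t(1) _ t(2), of x] that by auto
      then show ?thesis using M(2)[of t x] t that by auto
    qed
    then show ?thesis unfolding Linfty_norm_def
      by (intro esssup_I meas AE_I2) (auto intro: ennreal_leI)
  qed
  have "(\<integral>\<^sup>+s\<in>{0..<Tstar}. Linfty_norm (om s) \<partial>lborel) \<le> (\<integral>\<^sup>+s. ennreal M * indicator {0..<Tstar} s \<partial>lborel)"
    by (rule nn_integral_mono) (use le in \<open>auto simp: indicator_def\<close>)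
  also have "\<dots> = ennreal M * emeasure lborel {0..<Tstar}" by (rule nn_integral_cmult_indicator) simp
  also have "\<dots> < \<infinity>" using Tstar_pos by (simp add: ennreal_mult_less_top)
  finally show False using norm_integral_infinite by simp
qed

lemma om_rh_maximal: "maximal_solution (ereal Tstar) (\<lambda>_. 0) (rh 0) om rh"
  unfolding maximal_solution_def
proof (intro conjI allI impI ballI om_rh_classical)
  fix T' om' rh' assume sol: "classical_solution T' (\<lambda>_. 0) (rh 0) om' rh'"
  show le: "T' \<le> ereal Tstar" by (rule classical_lifespan[OF sol])
  fix t x assume "t \<in> time_interval T'" "x \<in> {0..1::real}"
  moreover from this le have "t < Tstar"
    by (auto simp: time_interval_def) (metis ereal_less_eq(3) le_less_trans not_le)
  ultimately show "om' t x = om t x" "rh' t x = rh t x"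
    using classical_unique[OF sol, of t x] by (auto simp: time_interval_def)
qed

end

section \<open>A concrete initial density\<close>

lemma blowup_data_exists: "\<exists>r a0 a1. blowup_data r a0 a1"
proof -
  let ?b = "bump 1 1 3"
  have b_deriv: "(?b has_real_derivative ?b x * (1 / (x - 1)\<^sup>2 - 1 / (3 - x)\<^sup>2)) (at x)" if "1 < x" "x < 3" for x
  proof -
    have "((\<lambda>x. exp (- 1 / (x - 1)) * exp (- 1 / (3 - x))) has_real_derivative
       exp (- 1 / (x - 1)) * exp (- 1 / (3 - x)) * (1 / (x - 1)\<^sup>2 - 1 / (3 - x)\<^sup>2)) (at x)"
      using that by (auto intro!: derivative_eq_intros simp: power2_eq_square field_simps)
    then have "((\<lambda>x. exp (- 1 / (x - 1)) * exp (- 1 / (3 - x))) has_real_derivative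
       ?b x * (1 / (x - 1)\<^sup>2 - 1 / (3 - x)\<^sup>2)) (at x)"
      using that by (simp add: bump_def flat_def)
    then show ?thesis
      by (rule has_field_derivative_transform_within_open[of _ _ _ "{1<..<3}"])
         (use that in \<open>auto simp: bump_def flat_def\<close>)
  qed
  have b_Ck: "Ck n (\<lambda>t. ?b)" for n by (rule bump_Ck) simp
  have b'_cont: "continuous_on UNIV (deriv ?b)"
    using cts2_slice_right[OF Ck_cts2[OF Ck_deriv[OF b_Ck[of "Suc 0"] Ck_has_deriv[OF b_Ck]]]] .
  have b'_pos: "0 < deriv ?b x" if "1 < x" "x < 2" for x
  proof -
    have "deriv ?b x = ?b x * (1 / (x - 1)\<^sup>2 - 1 / (3 - x)\<^sup>2)"
      by (rule DERIV_imp_deriv[OF b_deriv]) (use that in auto)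
    moreover have "(x - 1)\<^sup>2 < (3 - x)\<^sup>2" using that by (intro power_strict_mono) auto
    then have "1 / (3 - x)\<^sup>2 < 1 / (x - 1)\<^sup>2" using that by (intro divide_strict_left_mono) auto
    moreover have "0 < ?b x" using that by (simp add: bump_def flat_def)
    ultimately show ?thesis by simp
  qed
  \<comment> \<open>On this interval of length 1/2, left of the peak at 2, the slope of the bump has
    a positive minimum \<open>c\<close>; the scaling by \<open>32 / c\<close> lifts it to the
    threshold 32 of the growth argument.\<close>
  obtain y where y: "y \<in> {5/4..7/4}" "\<And>x. x \<in> {5/4..7/4} \<Longrightarrow> deriv ?b y \<le> deriv ?b x"
    using continuous_attains_inf[of "{5/4..7/4::real}" "deriv ?b"] continuous_on_subset[OF b'_cont] by auto
  define c where "c = deriv ?b y"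
  have c: "0 < c" unfolding c_def by (rule b'_pos) (use y in auto)
  define r where "r = (\<lambda>a. - (32 / c) * ?b a)"
  have r_Ck: "Ck n (\<lambda>t. r)" for n unfolding r_def by (intro Ck_mult Ck_const b_Ck)
  interpret data r 1 3
  proof
    show "Ck n (\<lambda>t. r)" for n by (rule r_Ck)
    show "r a = 0" if "a < 1 \<or> 3 < a" for a
      using that by (auto simp: r_def bump_def flat_def)
  qed auto
  have g: "g a = 32 / c * deriv ?b a" for a
  proof -
    have "(r has_real_derivative - (32 / c) * deriv ?b a) (at a)"
      unfolding r_def by (rule DERIV_cmult[OF Ck_has_deriv[OF b_Ck]])
    from DERIV_unique[OF r_deriv this] show ?thesis by simp
  qed
  have "\<not> good N 2" for N
  proof (rule not_good_2[of "5/4"])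
    fix a :: real assume a: "5/4 \<le> a" "a \<le> 5/4 + 1/2"
    then have "c \<le> deriv ?b a" unfolding c_def by (intro y) auto
    then show "32 \<le> g a" using c by (simp add: g field_simps)
  next
    fix a :: real assume a: "0 \<le> a" "a \<le> 5/4 + 1/2"
    have "0 \<le> deriv ?b a"
    proof (cases "1 < a")
      case True
      then show ?thesis using b'_pos[of a] a by simp
    next
      case False
      \<comment> \<open>The support property covers only labels below 1; continuity of the
        derivative extends its vanishing to the label 1.\<close>
      have "closure {..<1} \<subseteq> {x. deriv ?b x = 0}"
      proof (rule closure_minimal)
        show "closed {x. deriv ?b x = 0}"
          using closed_Collect_eq[OF b'_cont continuous_on_const] .
        show "{..<1} \<subseteq> {x. deriv ?b x = 0}"
        proof
          fix x :: real assume "x \<in> {..<1}"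
          then have "g x = 0" by (intro g_supp) auto
          then show "x \<in> {x. deriv ?b x = 0}" using c by (simp add: g)
        qed
      qed
      then have "deriv ?b a = 0" using False by (auto simp: subset_eq)
      then show ?thesis by simp
    qed
    then show "0 \<le> g a" using c by (simp add: g)
  qed simp
  then have "blowup_data r 1 3" by unfold_locales
  then show ?thesis by blast
qed

theorem theorem1p1:
  shows "\<exists>\<omega>0 \<rho>0 \<omega> \<rho> Tmax.
    \<omega>0 \<in> C0_infty \<and> \<rho>0 \<in> C0_infty \<and>
    maximal_solution Tmax \<omega>0 \<rho>0 \<omega> \<rho> \<and> Tmax < \<infinity> \<and>
    (\<exists>Tstar::real.
       classical_solution (ereal Tstar) \<omega>0 \<rho>0 \<omega> \<rho> \<and>
       (\<integral>\<^sup>+t\<in>{0..<Tstar}. Linfty_norm (\<omega> t) \<partial>lborel) = \<infinity> \<and>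
       ((\<lambda>t. \<integral>\<^sup>+s\<in>{0..t}. Linfty_norm (\<omega> s) \<partial>lborel) \<longlongrightarrow> \<infinity>) (at_left Tstar))"
proof -
  obtain r a0 a1 where "blowup_data r a0 a1" using blowup_data_exists by blast
  then interpret blowup_data r a0 a1 .
  have "(\<lambda>_. 0) \<in> C0_infty"
    by (rule C0_inftyI[of _ "1/3" "2/3"]) (auto intro: Ck_const)
  then show ?thesis
    using rh_0_C0_infty om_rh_maximal om_rh_classical norm_integral_infinite norm_integral_tendsto
    by (intro exI[of _ "\<lambda>_. 0"] exI[of _ "rh 0"] exI[of _ om] exI[of _ rh] exI[of _ "ereal Tstar"] conjI
        exI[of _ Tstar]) auto
qed

end
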